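(* Let $(A,\mathfrak{m})$ be a Noetherian local ring with $\operatorname{depth} A\ge 2$. Let $\mathcal{R}=\bigoplus_{n\ge 0}\mathfrak{m}^n t^n\subset A[t]$ be the Rees algebra of $\mathfrak{m}$, let $\mathfrak{M}=\mathfrak{m}\mathcal{R}+\mathcal{R}_+$, and let $G=\bigoplus_{n\ge 0}\mathfrak{m}^n/\mathfrak{m}^{n+1}$. Assume that $H^1_{\mathfrak{M}}(G)$ has finite length. Let $\ell\ge 1$ be an integer. If $\mathfrak{m}^{\ell}$ is Ratliff-Rush closed, then $\mathfrak{m}^{\ell}$ has the strong Rees property.
   Context: For an ideal $I$ of $A$, $\mu(I)=\ell_A(I/\mathfrak{m}I)$ denotes the minimal number of generators. An $\mathfrak{m}$-primary ideal $I$ has the strong Rees property if $\mu(J)<\mu(I)$ for every ideal $J$ of $A$ with $J\supsetneq I$. The Ratliff-Rush closure of an ideal $I$ is $\widetilde{I}=\bigcup_{n\ge 0}(I^{n+1}:I^n)$, and $I$ is Ratliff-Rush closed if $\widetilde{I}=I$. $\mathcal{R}_+=\bigoplus_{n\ge1}\mathfrak{m}^nt^n$, and $H^i_{\mathfrak{M}}(-)$ is local cohomology of $\mathcal{R}$-modules with support in $\mathfrak{M}$; $G=\mathcal{R}/\mathfrak{m}\mathcal{R}$ is regarded as a graded $\mathcal{R}$-module. *)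

theory Defs
  imports "HOL-Algebra.Ideal_Product" "HOL-Algebra.Ring_Divisibility" "HOL-Algebra.UnivPoly"
    "HOL-Algebra.Subrings"
    "HOL-Library.Extended_Nat"
begin

section \<open>Ideals of commutative rings\<close>

abbreviation ideal_power :: "('a, 'b) ring_scheme \<Rightarrow> 'a set \<Rightarrow> nat \<Rightarrow> 'a set"
  where "ideal_power R I n \<equiv> I [^]\<^bsub>ideals_set R\<^esub> n"

definition ideal_colon :: "('a, 'b) ring_scheme \<Rightarrow> 'a set \<Rightarrow> 'a set \<Rightarrow> 'a set"
  where "ideal_colon R I J = {x \<in> carrier R. \<forall>y\<in>J. x \<otimes>\<^bsub>R\<^esub> y \<in> I}"

definition ratliff_rush_closure :: "('a, 'b) ring_scheme \<Rightarrow> 'a set \<Rightarrow> 'a set"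
  where "ratliff_rush_closure R I =
    (\<Union>n::nat. ideal_colon R (ideal_power R I (n + 1)) (ideal_power R I n))"

definition ratliff_rush_closed :: "('a, 'b) ring_scheme \<Rightarrow> 'a set \<Rightarrow> bool"
  where "ratliff_rush_closed R I \<longleftrightarrow> ratliff_rush_closure R I = I"

definition ideal_radical :: "('a, 'b) ring_scheme \<Rightarrow> 'a set \<Rightarrow> 'a set"
  where "ideal_radical R I = {x \<in> carrier R. \<exists>n::nat. x [^]\<^bsub>R\<^esub> n \<in> I}"

definition primary_ideal :: "('a, 'b) ring_scheme \<Rightarrow> 'a set \<Rightarrow> bool"
  where "primary_ideal R I \<longleftrightarrow> ideal I R \<and> I \<noteq> carrier R \<and>
    (\<forall>a\<in>carrier R. \<forall>b\<in>carrier R. a \<otimes>\<^bsub>R\<^esub> b \<in> I \<longrightarrow> a \<in> I \<or> b \<in> ideal_radical R I)"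

definition noetherian_local_ring :: "('a, 'b) ring_scheme \<Rightarrow> 'a set \<Rightarrow> bool"
  where "noetherian_local_ring A \<mm> \<longleftrightarrow> cring A \<and> noetherian_ring A \<and>
    maximalideal \<mm> A \<and> (\<forall>\<nn>. maximalideal \<nn> A \<longrightarrow> \<nn> = \<mm>)"

text \<open>\<open>xs ! i\<close> is a nonzerodivisor on the quotient by the preceding elements, and the whole
  sequence does not generate the unit ideal.\<close>

definition regular_sequence :: "('a, 'b) ring_scheme \<Rightarrow> 'a list \<Rightarrow> bool"
  where "regular_sequence R xs \<longleftrightarrow> set xs \<subseteq> carrier R \<and>
    genideal R (set xs) \<noteq> carrier R \<and>
    (\<forall>i<length xs. \<forall>a\<in>carrier R.
      (xs ! i) \<otimes>\<^bsub>R\<^esub> a \<in> genideal R (set (take i xs)) \<longrightarrow> a \<in> genideal R (set (take i xs)))"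

definition local_depth :: "('a, 'b) ring_scheme \<Rightarrow> 'a set \<Rightarrow> enat"
  where "local_depth A \<mm> =
    Sup {enat (length xs) | xs. regular_sequence A xs \<and> set xs \<subseteq> \<mm>}"


section \<open>Modules\<close>

definition regular_module :: "('r, 's) ring_scheme \<Rightarrow> ('r, 'r) module"
  where "regular_module R = \<lparr>carrier = carrier R, monoid.mult = monoid.mult R, one = one R,
    ring.zero = ring.zero R, ring.add = ring.add R, smult = monoid.mult R\<rparr>"

text \<open>The fields \<open>mult\<close> and \<open>one\<close> of a module record carry no information; they get dummy
  values here. Adding \<open>N\<close> in \<open>smult\<close> turns the elementwise multiple of a coset into a full
  coset.\<close>

definition quotient_module ::
    "('r, 's) ring_scheme \<Rightarrow> ('r, 'n, 'q) module_scheme \<Rightarrow> 'n set \<Rightarrow> ('r, 'n set) module"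
  where "quotient_module R M N = \<lparr>carrier = a_rcosets\<^bsub>M\<^esub> N,
    monoid.mult = (\<lambda>_ _. N), one = N, ring.zero = N, ring.add = set_add M,
    smult = (\<lambda>a X. N <+>\<^bsub>M\<^esub> ((\<lambda>x. a \<odot>\<^bsub>M\<^esub> x) ` X))\<rparr>"

definition module_length :: "('r, 's) ring_scheme \<Rightarrow> ('r, 'n, 'q) module_scheme \<Rightarrow> enat"
  where "module_length R M = Sup {enat n | n. \<exists>N.
    (\<forall>i\<le>n. submodule (N i) R M) \<and> (\<forall>i<n. N i \<subset> N (Suc i))}"

definition module_hom :: "('r, 's) ring_scheme \<Rightarrow> ('r, 'n, 'q) module_scheme \<Rightarrow>
    ('r, 'k, 'l) module_scheme \<Rightarrow> ('n \<Rightarrow> 'k) set"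
  where "module_hom R M N = {f. f \<in> carrier M \<rightarrow> carrier N \<and>
    (\<forall>x\<in>carrier M. \<forall>y\<in>carrier M. f (x \<oplus>\<^bsub>M\<^esub> y) = f x \<oplus>\<^bsub>N\<^esub> f y) \<and>
    (\<forall>a\<in>carrier R. \<forall>x\<in>carrier M. f (a \<odot>\<^bsub>M\<^esub> x) = a \<odot>\<^bsub>N\<^esub> f x)}"

abbreviation hom_kernel :: "('r, 'n, 'q) module_scheme \<Rightarrow> ('r, 'k, 'l) module_scheme \<Rightarrow>
    ('n \<Rightarrow> 'k) \<Rightarrow> 'n set"
  where "hom_kernel M N f \<equiv> {x \<in> carrier M. f x = \<zero>\<^bsub>N\<^esub>}"


section \<open>Local cohomology\<close>

text \<open>A definition cannot quantify over types, so the test modules \<open>N\<close> live on the element type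
  of \<open>R\<close>. They include \<open>R\<close> with its ideals as submodules; hence, by Baer's criterion, this is
  injectivity with respect to modules on arbitrary types.\<close>

definition injective_module :: "('r, 's) ring_scheme \<Rightarrow> ('r, 'e, 'q) module_scheme \<Rightarrow> bool"
  where "injective_module R E \<longleftrightarrow> module R E \<and>
    (\<forall>(N :: ('r, 'r) module) H f. module R N \<longrightarrow> submodule H R N \<longrightarrow>
      f \<in> module_hom R (N\<lparr>carrier := H\<rparr>) E \<longrightarrow>
      (\<exists>g \<in> module_hom R N E. \<forall>x\<in>H. g x = f x))"

text \<open>All terms \<open>E i\<close> live on one type \<open>'e\<close>, which is a parameter: for a Noetherian ring on
  type \<open>'r\<close>, every module on \<open>'n\<close> has an injective resolution on any type at least as large as
  \<open>'r\<close>, \<open>'n\<close> and \<open>nat\<close>.\<close>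

definition injective_resolution :: "('r, 's) ring_scheme \<Rightarrow> ('r, 'n, 'q) module_scheme \<Rightarrow>
    ('n \<Rightarrow> 'e) \<Rightarrow> (nat \<Rightarrow> ('r, 'e) module) \<Rightarrow> (nat \<Rightarrow> 'e \<Rightarrow> 'e) \<Rightarrow> bool"
  where "injective_resolution R N \<epsilon> E d \<longleftrightarrow>
    (\<forall>i. injective_module R (E i)) \<and>
    \<epsilon> \<in> module_hom R N (E 0) \<and> inj_on \<epsilon> (carrier N) \<and>
    (\<forall>i. d i \<in> module_hom R (E i) (E (Suc i))) \<and>
    \<epsilon> ` carrier N = hom_kernel (E 0) (E 1) (d 0) \<and>
    (\<forall>i. d i ` carrier (E i) = hom_kernel (E (Suc i)) (E (Suc (Suc i))) (d (Suc i)))"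

definition torsion :: "('r, 's) ring_scheme \<Rightarrow> 'r set \<Rightarrow> ('r, 'n, 'q) module_scheme \<Rightarrow> 'n set"
  where "torsion R I N =
    {x \<in> carrier N. \<exists>n. \<forall>a\<in>ideal_power R I n. a \<odot>\<^bsub>N\<^esub> x = \<zero>\<^bsub>N\<^esub>}"

definition torsion_cocycles :: "('r, 's) ring_scheme \<Rightarrow> 'r set \<Rightarrow>
    (nat \<Rightarrow> ('r, 'e) module) \<Rightarrow> (nat \<Rightarrow> 'e \<Rightarrow> 'e) \<Rightarrow> nat \<Rightarrow> 'e set"
  where "torsion_cocycles R I E d i = {x \<in> torsion R I (E i). d i x = \<zero>\<^bsub>E (Suc i)\<^esub>}"

fun torsion_coboundaries :: "('r, 's) ring_scheme \<Rightarrow> 'r set \<Rightarrow>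
    (nat \<Rightarrow> ('r, 'e) module) \<Rightarrow> (nat \<Rightarrow> 'e \<Rightarrow> 'e) \<Rightarrow> nat \<Rightarrow> 'e set"
  where
    "torsion_coboundaries R I E d 0 = {\<zero>\<^bsub>E 0\<^esub>}"
  | "torsion_coboundaries R I E d (Suc i) = d i ` torsion R I (E i)"

text \<open>For an injective resolution \<open>(E, d)\<close> of \<open>N\<close>, this is the right derived functor
  \<open>H\<^sup>i\<^sub>I(N)\<close> of the torsion functor; up to isomorphism it does not depend on the resolution.\<close>

definition local_cohomology :: "('r, 's) ring_scheme \<Rightarrow> 'r set \<Rightarrow>
    (nat \<Rightarrow> ('r, 'e) module) \<Rightarrow> (nat \<Rightarrow> 'e \<Rightarrow> 'e) \<Rightarrow> nat \<Rightarrow> ('r, 'e set) module"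
  where "local_cohomology R I E d i =
    quotient_module R ((E i)\<lparr>carrier := torsion_cocycles R I E d i\<rparr>)
      (torsion_coboundaries R I E d i)"


section \<open>Rees algebra and associated graded module\<close>

definition rees_algebra :: "('a, 'b) ring_scheme \<Rightarrow> 'a set \<Rightarrow> ('a, nat \<Rightarrow> 'a) up_ring"
  where "rees_algebra A I = (UP A)
    \<lparr>carrier := {p \<in> carrier (UP A). \<forall>n. coeff (UP A) p n \<in> ideal_power A I n}\<rparr>"

definition rees_extension :: "('a, 'b) ring_scheme \<Rightarrow> 'a set \<Rightarrow> (nat \<Rightarrow> 'a) set"
  where "rees_extension A I = genideal (rees_algebra A I) ((\<lambda>a. monom (UP A) a 0) ` I)"

definition rees_plus :: "('a, 'b) ring_scheme \<Rightarrow> 'a set \<Rightarrow> (nat \<Rightarrow> 'a) set"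
  where "rees_plus A I = {p \<in> carrier (rees_algebra A I). coeff (UP A) p 0 = \<zero>\<^bsub>A\<^esub>}"

definition rees_max_ideal :: "('a, 'b) ring_scheme \<Rightarrow> 'a set \<Rightarrow> (nat \<Rightarrow> 'a) set"
  where "rees_max_ideal A \<mm> = rees_extension A \<mm> <+>\<^bsub>rees_algebra A \<mm>\<^esub> rees_plus A \<mm>"

text \<open>\<open>G = \<R>/\<mm>\<R>\<close> as an \<open>\<R>\<close>-module. Since \<open>\<mm>\<R>\<close> is \<open>\<mm>\<^bsup>n+1\<^esup>\<close> in degree \<open>n\<close> (lemma
  \<open>rees_extension_degreewise\<close> below), this is the direct sum of the \<open>\<mm>\<^bsup>n\<^esup>/\<mm>\<^bsup>n+1\<^esup>\<close>.\<close>

definition assoc_graded :: "('a, 'b) ring_scheme \<Rightarrow> 'a set \<Rightarrow> (nat \<Rightarrow> 'a, (nat \<Rightarrow> 'a) set) module"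
  where "assoc_graded A \<mm> =
    quotient_module (rees_algebra A \<mm>) (regular_module (rees_algebra A \<mm>)) (rees_extension A \<mm>)"

context cring
begin

lemma ideal_power_ideal: "ideal I R \<Longrightarrow> ideal (ideal_power R I n) R"
proof -
  assume I: "ideal I R"
  interpret M: comm_monoid "ideals_set R" by (rule ideals_set_is_comm_monoid)
  have "I \<in> carrier (ideals_set R)" using I by (simp add: ideals_set_def)
  then show ?thesis using M.nat_pow_closed[of I n] by (simp add: ideals_set_def)
qed

lemma ideal_power_add:
  assumes I: "ideal I R"
  shows "ideal_power R I m \<cdot> ideal_power R I n = ideal_power R I (m + n)"
proof -
  interpret M: comm_monoid "ideals_set R" by (rule ideals_set_is_comm_monoid)
  have "I \<in> carrier (ideals_set R)" using I by (simp add: ideals_set_def)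
  then show ?thesis using M.nat_pow_mult[of I m n] by (simp add: ideals_set_def)
qed

lemma ideal_power_Suc_prod: "ideal_power R I (Suc n) = ideal_power R I n \<cdot> I"
  by (simp add: ideals_set_def)

lemma ideal_power_mult:
  assumes I: "ideal I R" and "a \<in> ideal_power R I m" "b \<in> ideal_power R I n"
  shows "a \<otimes> b \<in> ideal_power R I (m + n)"
  using assms ideal_power_add[OF I] ideal_prod.prod by metis

lemma ideal_power_finsum:
  assumes J: "ideal J R" and "finite S" and "\<And>i. i \<in> S \<Longrightarrow> f i \<in> J"
  shows "finsum R f S \<in> J"
  using assms(2,3)
proof (induction S rule: finite_induct)
  case empty
  then show ?case by (simp add: additive_subgroup.zero_closed ideal.axioms(1) J)
next
  case (insert x F)
  have c: "f \<in> F \<rightarrow> carrier R" "f x \<in> carrier R" using insert ideal.Icarr[OF J] by auto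
  then show ?case using insert J by (simp add: additive_subgroup.a_closed ideal.axioms(1))
qed

end

lemma (in UP_cring) rees_cring:
  assumes I: "ideal I R"
  shows "cring (rees_algebra R I)"
proof -
  let ?H = "{p \<in> carrier P. \<forall>n. coeff P p n \<in> ideal_power R I n}"
  note J = R.ideal_power_ideal[OF I]
  have "subring ?H P"
  proof (rule ring.subringI[OF UP_ring])
    show "\<one>\<^bsub>P\<^esub> \<in> ?H"
    proof -
      have "\<one> \<in> ideal_power R I 0" by (simp add: ideals_set_def)
      then show ?thesis using J additive_subgroup.zero_closed[OF ideal.axioms(1)] by auto
    qed
  next
    fix h assume "h \<in> ?H"
    then show "\<ominus>\<^bsub>P\<^esub> h \<in> ?H"
      using additive_subgroup.a_inv_closed[OF ideal.axioms(1)[OF J]] by auto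
  next
    fix h1 h2 assume h: "h1 \<in> ?H" "h2 \<in> ?H"
    have "(\<Oplus>i\<in>{..n}. coeff P h1 i \<otimes> coeff P h2 (n - i)) \<in> ideal_power R I n" for n
    proof (rule R.ideal_power_finsum[OF J])
      fix i assume "i \<in> {..n}"
      then show "coeff P h1 i \<otimes> coeff P h2 (n - i) \<in> ideal_power R I n"
        using R.ideal_power_mult[OF I, of "coeff P h1 i" i "coeff P h2 (n - i)" "n - i"] h by simp
    qed simp
    then show "h1 \<otimes>\<^bsub>P\<^esub> h2 \<in> ?H" using h by simp
    show "h1 \<oplus>\<^bsub>P\<^esub> h2 \<in> ?H"
      using h additive_subgroup.a_closed[OF ideal.axioms(1)[OF J]] by auto
  qed auto
  then have "subcring ?H P" by (rule cring.subcringI'[OF UP_cring])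
  then show ?thesis using ring.subcring_iff[OF UP_ring, of ?H] by (auto simp: rees_algebra_def P_def)
qed

lemma (in UP_cring) rees_extension_degreewise:
  assumes I: "ideal I R"
  shows "rees_extension R I = {p \<in> carrier P. \<forall>n. coeff P p n \<in> ideal_power R I (n + 1)}"
proof -
  note [simp del] = Group.nat_pow_Suc
  let ?S = "rees_algebra R I"
  interpret S: cring ?S by (rule rees_cring[OF I])
  let ?K = "{p \<in> carrier P. \<forall>n. coeff P p n \<in> ideal_power R I (n + 1)}"
  note J = R.ideal_power_ideal[OF I]
  have S_simps: "add ?S = add P" "monoid.mult ?S = monoid.mult P" "zero ?S = zero P"
    "one ?S = one P" by (auto simp: rees_algebra_def P_def)
  have Sc: "carrier ?S = {p \<in> carrier P. \<forall>n. coeff P p n \<in> ideal_power R I n}"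
    by (auto simp: rees_algebra_def P_def)
  have sub: "ideal_power R I (Suc n) \<subseteq> ideal_power R I n" for n
    using R.ideal_power_Suc_prod R.ideal_prod_inter[OF J I] by auto
  have J1: "ideal_power R I 1 = I" 
    using I R.ideal_power_Suc_prod[of I 0] R.ideal_prod_one[OF I]
    by (metis One_nat_def Group.nat_pow_0 R.ideal_prod_commute ideals_set_def monoid.select_convs(2)
        R.oneideal)
  have Ic: "I \<subseteq> carrier R" using ideal.Icarr[OF I] by auto
  have gen_sub: "(\<lambda>a. monom P a 0) ` I \<subseteq> ?K"
  proof (rule image_subsetI)
    fix a assume a: "a \<in> I"
    have "coeff P (monom P a 0) n \<in> ideal_power R I (n + 1)" for n
    proof (cases "n = 0")
      case True
      then show ?thesis using a Ic J1 by (simp add: subsetD)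
    next
      case False
      then show ?thesis using a Ic additive_subgroup.zero_closed[OF ideal.axioms(1)[OF J]]
        by (simp add: subsetD)
    qed
    then show "monom P a 0 \<in> ?K" using a Ic by auto
  qed
  have KS: "?K \<subseteq> carrier ?S" using sub by (auto simp: Sc)
  have inv: "\<ominus>\<^bsub>?S\<^esub> p = \<ominus>\<^bsub>P\<^esub> p" if "p \<in> ?K" for p
    using that KS
    by (metis (no_types, lifting) abelian_group.minus_equality[OF ring.is_abelian_group[OF UP_ring]]
        S.a_inv_closed S.l_neg S_simps(1,3) Sc mem_Collect_eq subsetD)
  have K_ideal: "ideal ?K ?S"
  proof (rule idealI)
    show "subgroup ?K (add_monoid ?S)"
    proof (rule S.add.subgroupI, goal_cases)
      case 1 then show ?case using KS by simp
    next
      case 2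
      have "\<zero>\<^bsub>P\<^esub> \<in> ?K"
        using additive_subgroup.zero_closed[OF ideal.axioms(1)[OF J]] by auto
      then show ?case by blast
    next
      case (3 p)
      then show ?case using inv[OF 3] additive_subgroup.a_inv_closed[OF ideal.axioms(1)[OF J]]
        by (auto simp: a_inv_def[symmetric])
    next
      case (4 p q)
      then show ?case using additive_subgroup.a_closed[OF ideal.axioms(1)[OF J]] by (auto simp: S_simps)
    qed
    fix p x assume p: "p \<in> ?K" and x: "x \<in> carrier ?S"
    have "(\<Oplus>i\<in>{..n}. coeff P x i \<otimes> coeff P p (n - i)) \<in> ideal_power R I (n + 1)" for n
    proof (rule R.ideal_power_finsum[OF J])
      fix i assume "i \<in> {..n}"
      then show "coeff P x i \<otimes> coeff P p (n - i) \<in> ideal_power R I (n + 1)"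
        using R.ideal_power_mult[OF I, of "coeff P x i" i "coeff P p (n - i)" "n - i + 1"] p x
        by (auto simp: Sc)
    qed simp
    then show *: "x \<otimes>\<^bsub>?S\<^esub> p \<in> ?K" using p x by (auto simp: Sc S_simps)
    show "p \<otimes>\<^bsub>?S\<^esub> x \<in> ?K" 
      by (subst S.m_comm) (use * x p KS in blast)+
  qed (rule S.ring_axioms)
  have 1: "rees_extension R I \<subseteq> ?K"
    unfolding rees_extension_def P_def[symmetric]
    using S.genideal_minimal[OF K_ideal gen_sub] .
  let ?L = "rees_extension R I"
  have gS: "(\<lambda>a. monom P a 0) ` I \<subseteq> carrier ?S" using gen_sub KS by (rule order_trans)
  have L: "ideal ?L ?S" unfolding rees_extension_def P_def[symmetric]
    by (rule S.genideal_ideal[OF gS])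
  have gL: "monom P a 0 \<in> ?L" if "a \<in> I" for a
    using subsetD[OF S.genideal_self[OF gS] imageI[OF that]]
    unfolding rees_extension_def P_def[symmetric] .
  have monoS: "monom P b n \<in> carrier ?S" if "b \<in> ideal_power R I n" for b n
    using that ideal.Icarr[OF J] additive_subgroup.zero_closed[OF ideal.axioms(1)[OF J]]
    by (auto simp: Sc)
  have monoL: "monom P c n \<in> ?L" if "c \<in> ideal_power R I (n + 1)" for c n
  proof -
    have "c \<in> ideal_power R I n \<cdot> I" using that R.ideal_power_Suc_prod by simp
    then show ?thesis
    proof (induction c rule: ideal_prod.induct)
      case (prod b a)
      have "monom P b n \<otimes>\<^bsub>P\<^esub> monom P a 0 = monom P (b \<otimes> a) n"
        using prod ideal.Icarr[OF J] Ic monom_mult[of b a n 0] by auto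
      then show ?case using ideal.I_l_closed[OF L gL[OF prod(2)] monoS[OF prod(1)]]
        by (simp add: S_simps)
    next
      case (sum s1 s2)
      then have "s1 \<in> carrier R" "s2 \<in> carrier R"
        using R.ideal_prod_in_carrier[OF J I] by blast+
      then show ?case using sum additive_subgroup.a_closed[OF ideal.axioms(1)[OF L]]
        by (simp add: S_simps)
    qed
  qed
  have Lfin: "(\<Oplus>\<^bsub>P\<^esub>i\<in>A. f i) \<in> ?L" if "finite A" "\<And>i. i \<in> A \<Longrightarrow> f i \<in> ?L" for A :: "nat set" and f
    using that
  proof (induction A rule: finite_induct)
    case empty
    then show ?case using additive_subgroup.zero_closed[OF ideal.axioms(1)[OF L]] by (simp add: S_simps)
  next
    case (insert x F)
    have "f \<in> F \<rightarrow> carrier P" "f x \<in> carrier P" using insert 1 by auto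
    then show ?case using insert additive_subgroup.a_closed[OF ideal.axioms(1)[OF L]]
      by (simp add: S_simps)
  qed
  have "?K \<subseteq> ?L"
  proof
    fix p assume p: "p \<in> ?K"
    have "(\<Oplus>\<^bsub>P\<^esub>i\<in>{..deg R p}. monom P (coeff P p i) i) \<in> ?L"
      by (rule Lfin) (use p monoL in auto)
    then show "p \<in> ?L" using up_repr p by auto
  qed
  with 1 show ?thesis by blast
qed


section \<open>Number of generators and the strong Rees property\<close>

definition ideal_module :: "('a, 'b) ring_scheme \<Rightarrow> 'a set \<Rightarrow> ('a, 'a) module"
  where "ideal_module A I = (regular_module A)\<lparr>carrier := I\<rparr>"

definition num_generators :: "('a, 'b) ring_scheme \<Rightarrow> 'a set \<Rightarrow> 'a set \<Rightarrow> enat"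
  where "num_generators A \<mm> I =
    module_length A (quotient_module A (ideal_module A I) (\<mm> \<cdot>\<^bsub>A\<^esub> I))"

definition strong_rees_property :: "('a, 'b) ring_scheme \<Rightarrow> 'a set \<Rightarrow> 'a set \<Rightarrow> bool"
  where "strong_rees_property A \<mm> I \<longleftrightarrow> primary_ideal A I \<and> ideal_radical A I = \<mm> \<and>
    (\<forall>J. ideal J A \<longrightarrow> I \<subset> J \<longrightarrow> num_generators A \<mm> J < num_generators A \<mm> I)"

end

theory Submission imports Defs begin

text \<open>
  Write \<open>I = \<mm>\<^bsup>l\<^esup>\<close> and let \<open>J\<close> be an ideal strictly containing \<open>I\<close>. Computing the length of
  \<open>J/\<mm>I\<close> through \<open>I\<close> and through \<open>\<mm>J\<close> shows that \<open>\<mu>(J) < \<mu>(I)\<close> holds if and only if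
  \<open>\<mm>J/\<mm>I\<close> is longer than \<open>J/I\<close>.

  Let \<open>F\<^sub>p\<close> be the union of the colon ideals \<open>(\<mm>\<^bsup>p+k\<^esup> : \<mm>\<^bsup>k\<^esup>)\<close>. Then \<open>F\<^sub>l = I\<close> because \<open>I\<close> is
  Ratliff-Rush closed, and \<open>(F\<^bsub>p+1\<^esub> : \<mm>) = F\<^sub>p\<close>. The last equality says that elements outside
  \<open>F\<^sub>p\<close> are not killed modulo \<open>F\<^bsub>p+1\<^esub>\<close> by all of \<open>\<mm>\<close>. If one \<open>x \<in> \<mm>\<close> kills none of them, then
  \<open>x : J/I \<rightarrow> \<mm>J/\<mm>I\<close> is injective. In general \<open>J/I\<close> is filtered by kernels of multiplications so
  that an injective \<open>x\<close> exists on each subquotient (\<open>ideal_length_grows\<close>), which avoids any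
  assumption on the residue field. So \<open>\<mm>J/\<mm>I\<close> is at least as long as \<open>J/I\<close>. Equality would imply
  \<open>\<mm>J' = xJ' + \<mm>K\<close> for one of the subquotients \<open>J'/K\<close>.

  Such an equation propagates to \<open>\<mm>\<^sup>nJ' = x\<^sup>nJ' + \<mm>\<^sup>nK\<close> for all \<open>n\<close>. After multiplication by an
  element that carries \<open>K\<close> but not \<open>J'\<close> into some \<open>F\<^sub>p\<close>, leading forms give a graded submodule
  \<open>V\<close> of \<open>G\<close> that is nonzero in all large degrees and on which \<open>x\<close> is bijective in large degrees
  (\<open>persistent_exists\<close>). Fix an element \<open>u\<close> whose multiples by powers of \<open>x\<close> are nonzero in \<open>V\<close>.
  Division by \<open>x\<^sup>D\<close> defines a homomorphism \<open>p \<mapsto> x\<^bsup>-D\<^esup>pu\<close> from a power of \<open>\<MM>\<close> to \<open>G\<close>. It has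
  degree \<open>-D\<close> up to a constant and vanishes on no power of \<open>\<MM>\<close>. Extended to the first injective
  module of a resolution of \<open>G\<close>, it yields a class in \<open>H\<^sup>1\<^sub>\<MM>(G)\<close>. The classes for different \<open>D\<close>
  have different degrees, so \<open>H\<^sup>1\<^sub>\<MM>(G)\<close> has infinite length
  (\<open>local_cohomology_length_infinite\<close>). Since its length
  is finite by hypothesis, the inequality is strict.\<close>

section \<open>Lengths of intervals of ideals\<close>

text \<open>The ends of the chain need not be \<open>K\<close> and \<open>J\<close>, so enlarging the interval keeps every chain.\<close>

definition ideal_chain :: "('a, 'b) ring_scheme \<Rightarrow> 'a set \<Rightarrow> 'a set \<Rightarrow> nat \<Rightarrow> bool"
  where "ideal_chain R K J n \<longleftrightarrow>
    (\<exists>N. (\<forall>i\<le>n. ideal (N i) R \<and> K \<subseteq> N i \<and> N i \<subseteq> J) \<and> (\<forall>i<n. N i \<subset> N (Suc i)))"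

text \<open>For ideals \<open>K \<subseteq> J\<close> this is the length of the \<open>R\<close>-module \<open>J/K\<close>.\<close>

definition ideal_length :: "('a, 'b) ring_scheme \<Rightarrow> 'a set \<Rightarrow> 'a set \<Rightarrow> enat"
  where "ideal_length R K J = Sup {enat n | n. ideal_chain R K J n}"

lemma ideal_chain_mono:
  "ideal_chain R K J n \<Longrightarrow> K' \<subseteq> K \<Longrightarrow> J \<subseteq> J' \<Longrightarrow> ideal_chain R K' J' n"
  unfolding ideal_chain_def by (meson order_trans)

lemma ideal_chain_0: "ideal K R \<Longrightarrow> K \<subseteq> J \<Longrightarrow> ideal_chain R K J 0"
  unfolding ideal_chain_def by (rule exI[of _ "\<lambda>_. K"]) simp

lemma ideal_chain_Suc:
  assumes "ideal_chain R K J n" "J \<subset> J'" "ideal J' R"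
  shows "ideal_chain R K J' (Suc n)"
proof -
  obtain N where N: "\<forall>i\<le>n. ideal (N i) R \<and> K \<subseteq> N i \<and> N i \<subseteq> J" "\<forall>i<n. N i \<subset> N (Suc i)"
    using assms(1) unfolding ideal_chain_def by blast
  have "K \<subseteq> J" using N(1) by blast
  have "N i \<subseteq> J'" if "i \<le> n" for i using N(1) that assms(2) by blast
  moreover have "N n \<subset> J'" using N(1) assms(2) by blast
  ultimately show ?thesis unfolding ideal_chain_def using N \<open>K \<subseteq> J\<close> assms(2,3)
    by (intro exI[of _ "N(Suc n := J')"]) (auto simp: le_Suc_eq less_Suc_eq)
qed

lemma ideal_chain_SucE:
  assumes "ideal_chain R K J (Suc n)"
  obtains L T where "ideal L R" "ideal T R" "K \<subseteq> L" "L \<subset> T" "T \<subseteq> J" "ideal_chain R K L n"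
proof -
  obtain N where N: "\<forall>i\<le>Suc n. ideal (N i) R \<and> K \<subseteq> N i \<and> N i \<subseteq> J" "\<forall>i<Suc n. N i \<subset> N (Suc i)"
    using assms unfolding ideal_chain_def by blast
  have "N i \<subseteq> N n" if "i \<le> n" for i
    using that
  proof (induction rule: inc_induct)
    case (step k)
    then have "N k \<subset> N (Suc k)" using N(2) by simp
    then show ?case using step.IH by blast
  qed simp
  then have "ideal_chain R K (N n) n" unfolding ideal_chain_def using N
    by (intro exI[of _ N]) auto
  then show ?thesis using that[of "N n" "N (Suc n)"] N by auto
qed

lemma ideal_chain_append:
  assumes "ideal_chain R K L m" "ideal_chain R L J n"
  shows "ideal_chain R K J (m + n)"
  using assms(2)
proof (induction n arbitrary: J)
  case 0
  then have "L \<subseteq> J" unfolding ideal_chain_def by blast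
  then show ?case using assms(1) ideal_chain_mono by fastforce
next
  case (Suc n)
  then obtain M T where M: "ideal T R" "M \<subset> T" "T \<subseteq> J" "ideal_chain R L M n"
    using ideal_chain_SucE[OF Suc.prems] by metis
  then show ?case using ideal_chain_mono[OF ideal_chain_Suc[OF Suc.IH[OF M(4)] M(2,1)] order_refl M(3)]
    by simp
qed

context ring
begin

lemma add_idealsI: "a \<in> I \<Longrightarrow> b \<in> J \<Longrightarrow> a \<oplus> b \<in> I <+>\<^bsub>R\<^esub> J"
  by (auto simp: set_add_def')

lemma subset_add_ideals:
  assumes "ideal I R" "ideal J R"
  shows "I \<subseteq> I <+>\<^bsub>R\<^esub> J" "J \<subseteq> I <+>\<^bsub>R\<^esub> J"
proof -
  have z: "\<zero> \<in> I" "\<zero> \<in> J" and c: "I \<subseteq> carrier R" "J \<subseteq> carrier R"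
    using assms by (auto simp: ideal_def additive_subgroup.zero_closed additive_subgroup.a_Hcarr)
  show "I \<subseteq> I <+>\<^bsub>R\<^esub> J" using add_idealsI[OF _ z(2)] c by (metis r_zero subsetD subsetI)
  show "J \<subseteq> I <+>\<^bsub>R\<^esub> J" using add_idealsI[OF z(1)] c by (metis l_zero subsetD subsetI)
qed

lemma ideal_minus_closed: "ideal I R \<Longrightarrow> a \<in> I \<Longrightarrow> b \<in> I \<Longrightarrow> a \<ominus> b \<in> I"
  by (simp add: a_minus_def ideal_def additive_subgroup.a_closed additive_subgroup.a_inv_closed)

lemma ideal_plus_closed: "ideal I R \<Longrightarrow> a \<in> I \<Longrightarrow> b \<in> I \<Longrightarrow> a \<oplus> b \<in> I"
  by (simp add: ideal_def additive_subgroup.a_closed)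

lemma ideal_zero_closed: "ideal I R \<Longrightarrow> \<zero> \<in> I"
  by (simp add: ideal_def additive_subgroup.zero_closed)

lemma add_ideals_mono: "(I::'a set) \<subseteq> I' \<Longrightarrow> (J::'a set) \<subseteq> J' \<Longrightarrow> I <+>\<^bsub>R\<^esub> J \<subseteq> I' <+>\<^bsub>R\<^esub> J'"
  by (auto simp: set_add_def')

lemma add_ideals_least:
  assumes "ideal T R" "I \<subseteq> T" "J \<subseteq> T" shows "I <+>\<^bsub>R\<^esub> J \<subseteq> T"
  using assms by (auto simp: set_add_def' ideal_def additive_subgroup.a_closed subsetD)

lemma add_idealsE:
  assumes "v \<in> I <+>\<^bsub>R\<^esub> J" obtains a b where "a \<in> I" "b \<in> J" "v = a \<oplus> b"
  using assms by (auto simp: set_add_def')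

lemma modular_ideals_eq:
  assumes I: "ideal I R" "ideal J R" "ideal L R" "I \<subseteq> J"
    and "I \<inter> L = J \<inter> L" "I <+>\<^bsub>R\<^esub> L = J <+>\<^bsub>R\<^esub> L"
  shows "I = J"
proof
  show "J \<subseteq> I"
  proof
    fix w assume w: "w \<in> J"
    then have "w \<in> I <+>\<^bsub>R\<^esub> L" using subset_add_ideals[OF I(2,3)] assms(6) by blast
    then obtain a b where ab: "a \<in> I" "b \<in> L" "w = a \<oplus> b" by (rule add_idealsE)
    have c: "a \<in> carrier R" "b \<in> carrier R" using ab I ideal.Icarr by metis+
    have "b = w \<ominus> a" using ab(3) c by algebra
    then have "b \<in> J" using w ab(1) I(2,4) ideal_minus_closed by blast
    then have "b \<in> I" using ab(2) assms(5) by blast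
    then show "w \<in> I" using ab I(1) by (simp add: ideal_def additive_subgroup.a_closed)
  qed
qed (rule I(4))

text \<open>By the modular law (\<open>modular_ideals_eq\<close>), each strict step of a chain from \<open>K\<close> to \<open>J\<close>
  remains strict after intersecting with \<open>L\<close> or after adding \<open>L\<close>. So the strict steps of
  these two chains together are at least as many as those of the given one. Induction on \<open>n\<close>
  needs \<open>L\<close> to be arbitrary with respect to \<open>J\<close>, hence \<open>J \<inter> L\<close> and \<open>J + L\<close>.\<close>

lemma ideal_chain_split:
  assumes "ideal_chain R K J n" "ideal J R" "ideal K R" "ideal L R" "K \<subseteq> L"
  shows "\<exists>a b. n \<le> a + b \<and> ideal_chain R K (J \<inter> L) a \<and> ideal_chain R L (J <+>\<^bsub>R\<^esub> L) b"
  using assms(1,2)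
proof (induction n arbitrary: J)
  case 0
  then have "K \<subseteq> J" unfolding ideal_chain_def by blast
  then show ?case using 0 assms ideal_chain_0[of K R "J \<inter> L"] ideal_chain_0[of L R "J <+>\<^bsub>R\<^esub> L"]
    subset_add_ideals[of J L] by force
next
  case (Suc n)
  obtain M where M: "ideal M R" "M \<subset> J" "ideal_chain R K M n"
    using Suc.prems(1) by (rule ideal_chain_SucE) blast
  obtain a b where ab: "n \<le> a + b" "ideal_chain R K (M \<inter> L) a" "ideal_chain R L (M <+>\<^bsub>R\<^esub> L) b"
    using Suc.IH[OF M(3,1)] by blast
  have i: "ideal (J \<inter> L) R" "ideal (J <+>\<^bsub>R\<^esub> L) R"
    using i_intersect add_ideals Suc.prems(2) assms(4) by blast+
  have s: "M \<inter> L \<subseteq> J \<inter> L" "M <+>\<^bsub>R\<^esub> L \<subseteq> J <+>\<^bsub>R\<^esub> L" using M(2) add_ideals_mono[of M J L L] by auto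
  consider "M \<inter> L \<subset> J \<inter> L" | "M <+>\<^bsub>R\<^esub> L \<subset> J <+>\<^bsub>R\<^esub> L"
    using s modular_ideals_eq[OF M(1) Suc.prems(2) assms(4)] M(2) by blast
  then show ?case
  proof cases
    case 1
    show ?thesis using ideal_chain_Suc[OF ab(2) 1 i(1)] ideal_chain_mono[OF ab(3) order_refl s(2)] ab(1)
      by (intro exI[of _ "Suc a"] exI[of _ b]) simp
  next
    case 2
    show ?thesis using ideal_chain_Suc[OF ab(3) 2 i(2)] ideal_chain_mono[OF ab(2) order_refl s(1)] ab(1)
      by (intro exI[of _ a] exI[of _ "Suc b"]) simp
  qed
qed

end

lemma ideal_chain_length_le: "ideal_chain R K J n \<Longrightarrow> enat n \<le> ideal_length R K J"
  unfolding ideal_length_def by (rule Sup_upper) blast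

lemma ideal_length_leI: "(\<And>n. ideal_chain R K J n \<Longrightarrow> enat n \<le> B) \<Longrightarrow> ideal_length R K J \<le> B"
  unfolding ideal_length_def by (rule Sup_least) blast

lemma ideal_length_mono:
  "K' \<subseteq> K \<Longrightarrow> J \<subseteq> J' \<Longrightarrow> ideal_length R K J \<le> ideal_length R K' J'"
  by (intro ideal_length_leI ideal_chain_length_le) (rule ideal_chain_mono)

lemma ideal_length_attained:
  assumes "ideal_length R K J = enat n" "ideal K R" "K \<subseteq> J"
  shows "ideal_chain R K J n"
proof -
  let ?X = "{enat n | n. ideal_chain R K J n}"
  have "?X \<noteq> {}" using ideal_chain_0[OF assms(2,3)] by blast
  then have "Sup ?X \<in> ?X" using assms(1) Max_in[of ?X]
    unfolding ideal_length_def Sup_enat_def by (auto split: if_splits)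
  then show ?thesis using assms(1) unfolding ideal_length_def by auto
qed

text \<open>Additivity of length on \<open>0 \<rightarrow> L/K \<rightarrow> J/K \<rightarrow> J/L \<rightarrow> 0\<close>, also for infinite lengths: chains
  can be concatenated at \<open>L\<close>, and conversely \<open>ideal_chain_split\<close> cuts a chain at \<open>L\<close>.\<close>

lemma (in ring) ideal_length_add:
  assumes "ideal K R" "ideal L R" "ideal J R" "K \<subseteq> L" "L \<subseteq> J"
  shows "ideal_length R K J = ideal_length R K L + ideal_length R L J"
proof (rule antisym)
  show "ideal_length R K J \<le> ideal_length R K L + ideal_length R L J"
  proof (rule ideal_length_leI)
    fix n assume "ideal_chain R K J n"
    then obtain a b where ab: "n \<le> a + b" "ideal_chain R K (J \<inter> L) a" "ideal_chain R L (J <+>\<^bsub>R\<^esub> L) b"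
      using ideal_chain_split assms by blast
    have "J \<inter> L \<subseteq> L" "J <+>\<^bsub>R\<^esub> L \<subseteq> J" using add_ideals_least[of J J L] assms by auto
    then have "enat a \<le> ideal_length R K L" "enat b \<le> ideal_length R L J"
      using ab ideal_chain_length_le ideal_chain_mono by (metis order_refl)+
    then have "enat (a + b) \<le> ideal_length R K L + ideal_length R L J"
      unfolding plus_enat_simps(1)[symmetric] by (rule add_mono)
    moreover have "enat n \<le> enat (a + b)" using ab(1) by simp
    ultimately show "enat n \<le> ideal_length R K L + ideal_length R L J" by (rule order_trans[rotated])
  qed
  show "ideal_length R K L + ideal_length R L J \<le> ideal_length R K J"
  proof (cases "ideal_length R K J")
    case (enat s)
    then have "ideal_length R K L \<le> enat s" "ideal_length R L J \<le> enat s"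
      using ideal_length_mono[OF order_refl assms(5), of R K] ideal_length_mono[OF assms(4) order_refl, of R J]
      by simp_all
    then obtain a b where ab: "ideal_length R K L = enat a" "ideal_length R L J = enat b"
      by (metis enat_ile)
    then have "ideal_chain R K J (a + b)"
      using ideal_chain_append[OF ideal_length_attained[OF ab(1)] ideal_length_attained[OF ab(2)]] assms by blast
    then show ?thesis using ideal_chain_length_le ab by fastforce
  qed simp
qed

lemma (in cring) image_mult_ideal:
  assumes "x \<in> carrier R" "ideal J R"
  shows "ideal ((\<otimes>) x ` J) R"
proof (rule idealI[OF ring_axioms])
  interpret J: ideal J R by fact
  show "subgroup ((\<otimes>) x ` J) (add_monoid R)"
  proof (rule add.subgroupI)
    show "(\<otimes>) x ` J \<subseteq> carrier R" using assms(1) by auto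
    show "(\<otimes>) x ` J \<noteq> {}" using J.zero_closed by blast
    fix a assume "a \<in> (\<otimes>) x ` J"
    then obtain w where w: "w \<in> J" "a = x \<otimes> w" by blast
    then have "\<ominus> a = x \<otimes> (\<ominus> w)" using assms(1) J.Icarr by (simp add: r_minus)
    then show "\<ominus> a \<in> (\<otimes>) x ` J" using w(1) by simp
    fix b assume "b \<in> (\<otimes>) x ` J"
    then obtain v where v: "v \<in> J" "b = x \<otimes> v" by blast
    then have "a \<oplus> b = x \<otimes> (w \<oplus> v)" using assms(1) J.Icarr w by (simp add: r_distr)
    then show "a \<oplus> b \<in> (\<otimes>) x ` J" using w(1) v(1) by simp
  qed
  fix a r assume "a \<in> (\<otimes>) x ` J" and r: "r \<in> carrier R"
  then obtain w where w: "w \<in> J" "a = x \<otimes> w" by blast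
  then have "r \<otimes> a = x \<otimes> (r \<otimes> w)" "a \<otimes> r = x \<otimes> (w \<otimes> r)"
    using assms(1) J.Icarr r by (simp_all add: m_lcomm m_assoc)
  then show "r \<otimes> a \<in> (\<otimes>) x ` J" "a \<otimes> r \<in> (\<otimes>) x ` J"
    using w(1) r J.I_l_closed J.I_r_closed by auto
qed

text \<open>The hypothesis \<open>inj\<close> makes multiplication by \<open>x\<close> reflect equality of ideals between \<open>K\<close> and
  \<open>J\<close>, so that \<open>I \<mapsto> xI + K'\<close> sends strict chains to strict chains. When \<open>xK \<subseteq> K'\<close>, it says
  that \<open>x : J/K \<rightarrow> (xJ + K')/K'\<close> is injective.\<close>

lemma (in cring) ideal_length_mult_le:
  assumes x: "x \<in> carrier R" and I: "ideal J R" "ideal K' R"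
    and inj: "\<And>w. w \<in> J \<Longrightarrow> x \<otimes> w \<in> K' \<Longrightarrow> w \<in> K"
  shows "ideal_length R K J \<le> ideal_length R K' (((\<otimes>) x ` J) <+>\<^bsub>R\<^esub> K')"
proof (intro ideal_length_leI ideal_chain_length_le)
  fix n assume "ideal_chain R K J n"
  then obtain N where N: "\<forall>i\<le>n. ideal (N i) R \<and> K \<subseteq> N i \<and> N i \<subseteq> J" "\<forall>i<n. N i \<subset> N (Suc i)"
    unfolding ideal_chain_def by blast
  define T where "T i = ((\<otimes>) x ` N i) <+>\<^bsub>R\<^esub> K'" for i
  have "ideal (T i) R \<and> K' \<subseteq> T i \<and> T i \<subseteq> ((\<otimes>) x ` J) <+>\<^bsub>R\<^esub> K'" if "i \<le> n" for i
  proof -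
    have "ideal (N i) R" "N i \<subseteq> J" using that N(1) by auto
    then show ?thesis unfolding T_def
      using add_ideals[OF image_mult_ideal[OF x] I(2)] subset_add_ideals(2)[OF image_mult_ideal[OF x] I(2)]
        add_ideals_mono[OF image_mono order_refl] by meson
  qed
  moreover have "T i \<subset> T (Suc i)" if i: "i < n" for i
  proof
    show "T i \<subseteq> T (Suc i)" unfolding T_def by (intro add_ideals_mono image_mono) (use N i in auto)
    show "T i \<noteq> T (Suc i)"
    proof
      assume eq: "T i = T (Suc i)"
      have "N (Suc i) \<subseteq> N i"
      proof
        fix w assume w: "w \<in> N (Suc i)"
        have NS: "ideal (N (Suc i)) R" "ideal (N i) R" "N (Suc i) \<subseteq> J" "N i \<subset> N (Suc i)" "K \<subseteq> N i"
          using N i by auto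
        have "x \<otimes> w \<in> T (Suc i)" unfolding T_def
          by (rule subsetD[OF subset_add_ideals(1)[OF image_mult_ideal[OF x NS(1)] I(2)] imageI[OF w]])
        then have "x \<otimes> w \<in> T i" using eq by simp
        then obtain v k where vk: "v \<in> N i" "k \<in> K'" "x \<otimes> w = x \<otimes> v \<oplus> k"
          unfolding T_def by (auto elim: add_idealsE)
        have c: "w \<in> carrier R" "v \<in> carrier R" "k \<in> carrier R"
          using ideal.Icarr[OF NS(1) w] ideal.Icarr[OF NS(2) vk(1)] ideal.Icarr[OF I(2) vk(2)] .
        have "x \<otimes> (w \<ominus> v) = x \<otimes> w \<ominus> x \<otimes> v" using x c(1,2) by algebra
        also have "\<dots> = (x \<otimes> v \<oplus> k) \<ominus> x \<otimes> v" using vk(3) by simp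
        also have "\<dots> = k" using x c by algebra
        finally have "x \<otimes> (w \<ominus> v) \<in> K'" using vk(2) by simp
        moreover have "w \<ominus> v \<in> J" using w vk NS by (intro ideal_minus_closed[OF I(1)]) auto
        ultimately have "w \<ominus> v \<in> N i" using inj NS by blast
        moreover have "w = (w \<ominus> v) \<oplus> v" using c by algebra
        ultimately show "w \<in> N i" using vk(1) NS(2) by (metis ideal_plus_closed)
      qed
      then show False using N(2) i by blast
    qed
  qed
  ultimately show "ideal_chain R K' (((\<otimes>) x ` J) <+>\<^bsub>R\<^esub> K') n" unfolding ideal_chain_def by blast
qed

section \<open>Ideal arithmetic and finite length\<close>

context cring
begin

lemma ideal_prod_least:
  assumes "ideal T R" "\<And>a b. a \<in> I \<Longrightarrow> b \<in> J \<Longrightarrow> a \<otimes> b \<in> T"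
  shows "I \<cdot> J \<subseteq> T"
proof
  fix v assume "v \<in> I \<cdot> J"
  then show "v \<in> T"
    by (induction v rule: ideal_prod.induct) (use assms ideal_plus_closed in auto)
qed

lemma ideal_prod_mono:
  assumes "I \<subseteq> I'" "J \<subseteq> J'" shows "I \<cdot> J \<subseteq> I' \<cdot> J'"
proof
  fix v assume "v \<in> I \<cdot> J"
  then show "v \<in> I' \<cdot> J'"
    by (induction v rule: ideal_prod.induct) (use assms in \<open>auto intro: ideal_prod.intros\<close>)
qed

lemma ideal_colon_ideal:
  assumes I: "ideal I R" and J: "J \<subseteq> carrier R"
  shows "ideal (ideal_colon R I J) R"
proof (rule idealI[OF ring_axioms])
  interpret I: ideal I R by fact
  show "subgroup (ideal_colon R I J) (add_monoid R)"
  proof (rule add.subgroupI)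
    show "ideal_colon R I J \<subseteq> carrier R" by (auto simp: ideal_colon_def)
    have "\<zero> \<in> ideal_colon R I J" using J by (auto simp: ideal_colon_def)
    then show "ideal_colon R I J \<noteq> {}" by blast
  next
    fix a assume "a \<in> ideal_colon R I J"
    then show "\<ominus> a \<in> ideal_colon R I J" using J by (auto simp: ideal_colon_def l_minus subsetD)
  next
    fix a b assume "a \<in> ideal_colon R I J" "b \<in> ideal_colon R I J"
    then show "a \<oplus> b \<in> ideal_colon R I J" using J by (auto simp: ideal_colon_def l_distr subsetD)
  qed
  fix a r assume a: "a \<in> ideal_colon R I J" and r: "r \<in> carrier R"
  have "r \<otimes> a \<otimes> y = r \<otimes> (a \<otimes> y)" if "y \<in> J" for y
    using that a r J by (auto simp: ideal_colon_def m_assoc)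
  then show "r \<otimes> a \<in> ideal_colon R I J" using a r I.I_l_closed by (auto simp: ideal_colon_def)
  moreover have "a \<otimes> r = r \<otimes> a" using a r by (auto simp: ideal_colon_def m_comm)
  ultimately show "a \<otimes> r \<in> ideal_colon R I J" by simp
qed

lemma ideal_colon_singleton:
  "h \<in> carrier R \<Longrightarrow> ideal_colon R I {h} = {w \<in> carrier R. h \<otimes> w \<in> I}"
  by (auto simp: ideal_colon_def m_comm)

lemma preimage_mult_ideal:
  "h \<in> carrier R \<Longrightarrow> ideal I R \<Longrightarrow> ideal {w \<in> carrier R. h \<otimes> w \<in> I} R"
  using ideal_colon_ideal[of I "{h}"] by (simp add: ideal_colon_singleton)

lemma ideal_power_antimono:
  assumes "ideal I R" "i \<le> j" shows "ideal_power R I j \<subseteq> ideal_power R I i"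
  using assms(2)
proof (rule lift_Suc_antimono_le[rotated])
  show "ideal_power R I (Suc n) \<subseteq> ideal_power R I n" for n
    unfolding ideal_power_Suc_prod using ideal_prod_inter[OF ideal_power_ideal assms(1)] assms(1) by blast
qed

text \<open>The module \<open>(L + Ra)/L\<close> is a quotient of the simple module \<open>R/\<mm>\<close>.\<close>

lemma ideal_length_cyclic_le_1:
  assumes max: "maximalideal \<mm> R" and L: "ideal L R" and a: "a \<in> carrier R"
    and ann: "\<And>y. y \<in> \<mm> \<Longrightarrow> y \<otimes> a \<in> L"
  shows "ideal_length R L (L <+>\<^bsub>R\<^esub> PIdl a) \<le> 1"
proof -
  interpret M: maximalideal \<mm> R by fact
  have no_middle: "L <+>\<^bsub>R\<^esub> PIdl a \<subseteq> N"
    if N: "ideal N R" "L \<subseteq> N" and w: "w \<in> N" "w \<in> L <+>\<^bsub>R\<^esub> PIdl a" "w \<notin> L" for N w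
  proof -
    obtain l r where lr: "l \<in> L" "r \<in> carrier R" "w = l \<oplus> r \<otimes> a"
      using w(2) unfolding cgenideal_def by (auto elim!: add_idealsE)
    have "r \<notin> \<mm>" using lr w(3) ann ideal_plus_closed[OF L] by auto
    have i: "ideal (\<mm> <+>\<^bsub>R\<^esub> PIdl r) R" by (intro add_ideals M.is_ideal cgenideal_ideal lr)
    have "\<mm> <+>\<^bsub>R\<^esub> PIdl r \<noteq> \<mm>"
      using subset_add_ideals(2)[OF M.is_ideal cgenideal_ideal[OF lr(2)]] cgenideal_self[OF lr(2)]
        \<open>r \<notin> \<mm>\<close> by blast
    then have "\<mm> <+>\<^bsub>R\<^esub> PIdl r = carrier R"
      using M.I_maximal[OF i subset_add_ideals(1)[OF M.is_ideal cgenideal_ideal[OF lr(2)]]]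
        ideal.Icarr[OF i] by blast
    then have "\<one> \<in> \<mm> <+>\<^bsub>R\<^esub> PIdl r" by simp
    then obtain y c where yc: "y \<in> \<mm>" "c \<in> carrier R" "\<one> = y \<oplus> c \<otimes> r"
      unfolding cgenideal_def by (auto elim!: add_idealsE)
    have car: "l \<in> carrier R" "y \<in> carrier R" "w \<in> carrier R"
      using ideal.Icarr[OF L lr(1)] M.Icarr[OF yc(1)] ideal.Icarr[OF N(1) w(1)] .
    \<comment> \<open>An element \<open>w = l + ra\<close> outside \<open>L\<close> recovers \<open>a\<close>, because \<open>r\<close> is invertible modulo \<open>\<mm>\<close>.\<close>
    have "a = \<one> \<otimes> a" using a by simp
    also have "\<dots> = (y \<oplus> c \<otimes> r) \<otimes> a" using yc(3) by simp
    also have "\<dots> = y \<otimes> a \<oplus> (c \<otimes> (l \<oplus> r \<otimes> a) \<ominus> c \<otimes> l)"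
      using car(1,2) yc(2) lr(2) a by algebra
    finally have "a = y \<otimes> a \<oplus> (c \<otimes> w \<ominus> c \<otimes> l)" using lr(3) by simp
    moreover have "y \<otimes> a \<in> N" "c \<otimes> w \<in> N" "c \<otimes> l \<in> N"
      using ann[OF yc(1)] N(2) ideal.I_l_closed[OF N(1) w(1) yc(2)] ideal.I_l_closed[OF L lr(1) yc(2)]
      by auto
    ultimately have "a \<in> N"
      using ideal_plus_closed[OF N(1)] ideal_minus_closed[OF N(1)] by metis
    then show ?thesis using add_ideals_least[OF N(1,2) cgenideal_minimal[OF N(1)]] by blast
  qed
  show ?thesis
  proof (rule ideal_length_leI, rule ccontr)
    fix n assume "ideal_chain R L (L <+>\<^bsub>R\<^esub> PIdl a) n" and "\<not> enat n \<le> 1"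
    then obtain N where N: "\<forall>i\<le>n. ideal (N i) R \<and> L \<subseteq> N i \<and> N i \<subseteq> L <+>\<^bsub>R\<^esub> PIdl a"
      "\<forall>i<n. N i \<subset> N (Suc i)" and n: "1 < n"
      unfolding ideal_chain_def by (auto simp: one_enat_def)
    have s: "N 0 \<subset> N 1" "N 1 \<subset> N 2" using N(2) n by (auto simp: numeral_2_eq_2)
    have c: "ideal (N 1) R" "L \<subseteq> N 0" "N 1 \<subseteq> L <+>\<^bsub>R\<^esub> PIdl a" "N 2 \<subseteq> L <+>\<^bsub>R\<^esub> PIdl a"
      using N(1) n by auto
    obtain w where "w \<in> N 1" "w \<notin> L" using s(1) c(2) by blast
    then have "L <+>\<^bsub>R\<^esub> PIdl a \<subseteq> N 1" using no_middle[of "N 1" w] c s(1) by blast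
    then show False using s(2) c(4) by blast
  qed
qed

text \<open>The generators in \<open>S\<close> are adjoined to \<open>L\<close> one at a time; each adds at most one to the length.
  The lemma is stated for every \<open>L\<close> because \<open>L\<close> grows in the induction.\<close>

lemma ideal_length_finitely_generated:
  assumes max: "maximalideal \<mm> R" and "finite S" "S \<subseteq> carrier R" "ideal L R"
    and "\<And>y s. y \<in> \<mm> \<Longrightarrow> s \<in> S \<Longrightarrow> y \<otimes> s \<in> L"
  shows "ideal_length R L (L <+>\<^bsub>R\<^esub> Idl S) < \<infinity>"
  using assms(2-)
proof (induction S arbitrary: L rule: finite_induct)
  case empty
  have "L <+>\<^bsub>R\<^esub> Idl {} \<subseteq> L"
    using add_ideals_least[OF empty(2) order_refl genideal_minimal[OF empty(2)]] by blast
  then have "ideal_length R L (L <+>\<^bsub>R\<^esub> Idl {}) \<le> 0"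
  proof (intro ideal_length_leI)
    fix n assume "ideal_chain R L (L <+>\<^bsub>R\<^esub> Idl {}) n"
    then have "ideal_chain R L L n"
      by (rule ideal_chain_mono) (use \<open>L <+>\<^bsub>R\<^esub> Idl {} \<subseteq> L\<close> in auto)
    then have "n = 0" by (cases n) (auto elim: ideal_chain_SucE)
    then show "enat n \<le> 0" by (simp add: zero_enat_def)
  qed
  then show ?case by simp
next
  case (insert a S)
  define L1 where "L1 = L <+>\<^bsub>R\<^esub> PIdl a"
  have a: "a \<in> carrier R" "S \<subseteq> carrier R" using insert.prems by auto
  note P = cgenideal_ideal[OF a(1)]
  have L1: "ideal L1 R" "L \<subseteq> L1" "PIdl a \<subseteq> L1"
    unfolding L1_def using add_ideals[OF insert.prems(2) P] subset_add_ideals[OF insert.prems(2) P] .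
  have T: "ideal (L1 <+>\<^bsub>R\<^esub> Idl S) R" "L1 \<subseteq> L1 <+>\<^bsub>R\<^esub> Idl S" "Idl S \<subseteq> L1 <+>\<^bsub>R\<^esub> Idl S"
    using add_ideals[OF L1(1) genideal_ideal[OF a(2)]]
      subset_add_ideals[OF L1(1) genideal_ideal[OF a(2)]] .
  have fin: "ideal_length R L1 (L1 <+>\<^bsub>R\<^esub> Idl S) < \<infinity>"
    by (rule insert.IH[OF a(2) L1(1)]) (use insert.prems(3) L1(2) in blast)
  have "insert a S \<subseteq> L1 <+>\<^bsub>R\<^esub> Idl S"
    using subsetD[OF T(2) subsetD[OF L1(3) cgenideal_self[OF a(1)]]]
      order_trans[OF genideal_self[OF a(2)] T(3)] by simp
  then have "L <+>\<^bsub>R\<^esub> Idl (insert a S) \<subseteq> L1 <+>\<^bsub>R\<^esub> Idl S"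
    by (rule add_ideals_least[OF T(1) order_trans[OF L1(2) T(2)] genideal_minimal[OF T(1)]])
  then have "ideal_length R L (L <+>\<^bsub>R\<^esub> Idl (insert a S)) \<le> ideal_length R L (L1 <+>\<^bsub>R\<^esub> Idl S)"
    by (intro ideal_length_mono) auto
  also have "\<dots> = ideal_length R L L1 + ideal_length R L1 (L1 <+>\<^bsub>R\<^esub> Idl S)"
    by (rule ideal_length_add[OF insert.prems(2) L1(1) T(1) L1(2) T(2)])
  also have "\<dots> \<le> 1 + ideal_length R L1 (L1 <+>\<^bsub>R\<^esub> Idl S)"
    unfolding L1_def
    by (intro add_right_mono ideal_length_cyclic_le_1[OF max insert.prems(2) a(1)] insert.prems(3)) auto
  also have "\<dots> < \<infinity>" using fin by (cases "ideal_length R L1 (L1 <+>\<^bsub>R\<^esub> Idl S)") (auto simp: one_enat_def)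
  finally show ?case .
qed

end

section \<open>Powers of a maximal ideal\<close>

locale noetherian_maximal = noetherian_ring R + cring R for R (structure) +
  fixes \<mm> :: "'a set"
  assumes maximal: "maximalideal \<mm> R"
begin

definition mpow :: "nat \<Rightarrow> 'a set"
  where "mpow n = ideal_power R \<mm> n"

lemma m_ideal: "ideal \<mm> R" using maximal by (rule maximalideal.axioms)

lemma mpow_ideal: "ideal (mpow n) R"
  unfolding mpow_def by (rule ideal_power_ideal[OF m_ideal])

lemma mpow_carrier: "mpow n \<subseteq> carrier R" using ideal.Icarr[OF mpow_ideal] by blast

lemma mpow_0: "mpow 0 = carrier R" by (simp add: mpow_def ideals_set_def)

lemma mpow_Suc: "mpow (Suc n) = mpow n \<cdot> \<mm>"
  unfolding mpow_def by (rule ideal_power_Suc_prod)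

lemma mpow_1: "mpow (Suc 0) = \<mm>"
  using ideal_prod_one[OF m_ideal] ideal_prod_commute[OF m_ideal oneideal]
  by (simp add: mpow_Suc mpow_0)

lemma mpow_mult: "a \<in> mpow i \<Longrightarrow> b \<in> mpow j \<Longrightarrow> a \<otimes> b \<in> mpow (i + j)"
  unfolding mpow_def by (rule ideal_power_mult[OF m_ideal])

lemma mpow_antimono: "k \<le> n \<Longrightarrow> mpow n \<subseteq> mpow k"
  unfolding mpow_def by (rule ideal_power_antimono[OF m_ideal])

lemma mpow_mult': "a \<in> mpow i \<Longrightarrow> b \<in> mpow j \<Longrightarrow> k \<le> i + j \<Longrightarrow> a \<otimes> b \<in> mpow k"
  using mpow_mult mpow_antimono by blast

lemma mpow_add_mem: "a \<in> mpow k \<Longrightarrow> b \<in> mpow k \<Longrightarrow> a \<oplus> b \<in> mpow k"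
  by (rule ideal_plus_closed[OF mpow_ideal])

lemma pow_mpow: "x \<in> \<mm> \<Longrightarrow> x [^] n \<in> mpow n"
proof (induction n)
  case (Suc n)
  then show ?case using mpow_mult[of "x [^] n" n x 1] by (simp add: mpow_1)
qed (simp add: mpow_0)

lemma mpow_radical:
  assumes "1 \<le> l" shows "ideal_radical R (mpow l) = \<mm>"
proof (intro equalityI subsetI)
  interpret M: primeideal \<mm> R by (rule maximalideal_prime[OF maximal])
  have sub: "mpow l \<subseteq> \<mm>" using mpow_antimono[of "Suc 0" l] assms by (simp add: mpow_1)
  fix z assume "z \<in> ideal_radical R (mpow l)"
  then obtain n :: nat where z: "z \<in> carrier R" "z [^] n \<in> \<mm>" using sub by (auto simp: ideal_radical_def)
  from z(2) show "z \<in> \<mm>"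
  proof (induction n)
    case 0
    then show ?case using M.one_imp_carrier M.I_notcarr by simp
  next
    case (Suc n)
    then show ?case using M.I_prime[of "z [^] n" z] z(1) by auto
  qed
next
  fix z assume "z \<in> \<mm>"
  then show "z \<in> ideal_radical R (mpow l)"
    using pow_mpow ideal.Icarr[OF m_ideal] by (auto simp: ideal_radical_def)
qed

text \<open>If \<open>r \<notin> \<mm>\<close>, then \<open>1 = y + cr\<close> with \<open>y \<in> \<mm>\<close>, and \<open>a = ay + c(ar)\<close> shows that \<open>a \<in> \<mm>\<^bsup>k\<^esup>\<close>
  implies \<open>a \<in> \<mm>\<^bsup>k+1\<^esup>\<close> as long as \<open>ar \<in> \<mm>\<^bsup>k+1\<^esup>\<close>.\<close>

lemma mpow_primary:
  assumes "1 \<le> l" shows "primary_ideal R (mpow l)"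
proof -
  interpret M: maximalideal \<mm> R by (rule maximal)
  have sub: "mpow l \<subseteq> \<mm>" using mpow_antimono[of "Suc 0" l] assms by (simp add: mpow_1)
  have "a \<in> mpow l" if ab: "a \<in> carrier R" "r \<in> carrier R" "a \<otimes> r \<in> mpow l" and r: "r \<notin> \<mm>" for a r
  proof -
    have i: "ideal (\<mm> <+>\<^bsub>R\<^esub> PIdl r) R" by (rule add_ideals[OF m_ideal cgenideal_ideal[OF ab(2)]])
    note s = subset_add_ideals[OF m_ideal cgenideal_ideal[OF ab(2)]]
    have "\<mm> <+>\<^bsub>R\<^esub> PIdl r \<noteq> \<mm>" using s(2) cgenideal_self[OF ab(2)] r by blast
    then have "\<mm> <+>\<^bsub>R\<^esub> PIdl r = carrier R" using M.I_maximal[OF i s(1)] ideal.Icarr[OF i] by blast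
    then have "\<one> \<in> \<mm> <+>\<^bsub>R\<^esub> PIdl r" by simp
    then obtain y c where yc: "y \<in> \<mm>" "c \<in> carrier R" "\<one> = y \<oplus> c \<otimes> r"
      unfolding cgenideal_def by (auto elim!: add_idealsE)
    have y: "y \<in> carrier R" by (rule M.Icarr[OF yc(1)])
    have "a = a \<otimes> \<one>" using ab(1) by simp
    also have "\<dots> = a \<otimes> (y \<oplus> c \<otimes> r)" using yc(3) by simp
    also have "\<dots> = a \<otimes> y \<oplus> c \<otimes> (a \<otimes> r)" using ab(1,2) yc(2) y by algebra
    finally have a: "a = a \<otimes> y \<oplus> c \<otimes> (a \<otimes> r)" .
    have car: "c \<otimes> (a \<otimes> r) \<in> mpow l" by (rule ideal.I_l_closed[OF mpow_ideal ab(3) yc(2)])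
    have "a \<in> mpow k" if "k \<le> l" for k
      using that
    proof (induction k)
      case 0
      then show ?case using ab(1) by (simp add: mpow_0)
    next
      case (Suc k)
      then have "a \<otimes> y \<in> mpow (Suc k)" using mpow_mult[of a k y "Suc 0"] yc(1) by (simp add: mpow_1)
      moreover have "c \<otimes> (a \<otimes> r) \<in> mpow (Suc k)" using car mpow_antimono[OF Suc.prems] by blast
      ultimately show ?case using mpow_add_mem a by metis
    qed
    then show ?thesis by simp
  qed
  moreover have "mpow l \<noteq> carrier R" using sub M.I_notcarr M.Icarr by blast
  ultimately show ?thesis unfolding primary_ideal_def mpow_radical[OF assms] using mpow_ideal by blast
qed

lemma mpow_Suc_prod: "ideal J R \<Longrightarrow> mpow (Suc n) \<cdot> J = \<mm> \<cdot> (mpow n \<cdot> J)"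
  using ideal_prod_assoc[OF m_ideal mpow_ideal, of J n] ideal_prod_commute[OF m_ideal mpow_ideal, of n]
  by (simp add: mpow_Suc)

lemma mpow_0_prod: "ideal J R \<Longrightarrow> mpow 0 \<cdot> J = J"
  using ideal_prod_one ideal_prod_commute[OF oneideal] by (simp add: mpow_0)

lemma mpow_prod_mult:
  assumes a: "a \<in> mpow i" and J: "ideal J R" and g: "g \<in> mpow j \<cdot> J"
  shows "a \<otimes> g \<in> mpow (i + j) \<cdot> J"
proof -
  have ac: "a \<in> carrier R" using a mpow_carrier by blast
  have "mpow j \<cdot> J \<subseteq> {w \<in> carrier R. a \<otimes> w \<in> mpow (i + j) \<cdot> J}"
  proof (rule ideal_prod_least[OF preimage_mult_ideal[OF ac ideal_prod_is_ideal[OF mpow_ideal J]]])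
    fix b w assume b: "b \<in> mpow j" and w: "w \<in> J"
    have c: "b \<in> carrier R" "w \<in> carrier R" using b w mpow_carrier ideal.Icarr[OF J] by auto
    have "a \<otimes> (b \<otimes> w) = (a \<otimes> b) \<otimes> w" using c ac by (simp add: m_assoc)
    then show "b \<otimes> w \<in> {w \<in> carrier R. a \<otimes> w \<in> mpow (i + j) \<cdot> J}"
      using ideal_prod.prod[OF mpow_mult[OF a b] w] c by auto
  qed
  then show ?thesis using g by blast
qed

lemma ideal_length_m_finite:
  assumes "ideal J R"
  shows "ideal_length R (\<mm> \<cdot> J) J < \<infinity>"
proof -
  obtain S where S: "S \<subseteq> carrier R" "finite S" "J = Idl S" using finetely_gen[OF assms] by blast
  note i = ideal_prod_is_ideal[OF m_ideal assms]
  have "ideal_length R (\<mm> \<cdot> J) J \<le> ideal_length R (\<mm> \<cdot> J) ((\<mm> \<cdot> J) <+>\<^bsub>R\<^esub> J)"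
    by (rule ideal_length_mono[OF order_refl subset_add_ideals(2)[OF i assms]])
  also have "\<dots> < \<infinity>" unfolding S(3)
    by (rule ideal_length_finitely_generated[OF maximal S(2,1)])
      (use i S(3) genideal_self[OF S(1)] in \<open>auto intro: ideal_prod.prod\<close>)
  finally show ?thesis .
qed

lemma mpow_prod_subset: "ideal J R \<Longrightarrow> mpow n \<cdot> J \<subseteq> J"
  using ideal_prod_inter[OF mpow_ideal] by blast

lemma ideal_length_mpow_finite:
  assumes J: "ideal J R"
  shows "ideal_length R (mpow n \<cdot> J) J < \<infinity>"
proof (induction n)
  case 0
  have "ideal_length R J J \<le> ideal_length R (\<mm> \<cdot> J) J"
    by (intro ideal_length_mono) (use ideal_prod_inter[OF m_ideal J] in auto)
  also have "\<dots> < \<infinity>" by (rule ideal_length_m_finite[OF J])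
  finally show ?case by (simp only: mpow_0_prod[OF J])
next
  case (Suc n)
  note i = ideal_prod_is_ideal[OF mpow_ideal J]
  have "ideal_length R (mpow (Suc n) \<cdot> J) J
      = ideal_length R (mpow (Suc n) \<cdot> J) (mpow n \<cdot> J) + ideal_length R (mpow n \<cdot> J) J"
    by (rule ideal_length_add[OF i i J ideal_prod_mono mpow_prod_subset[OF J]])
      (auto intro: subsetD[OF mpow_antimono, of n "Suc n"])
  then show ?case using Suc ideal_length_m_finite[OF i[of n]]
    unfolding mpow_Suc_prod[OF J]
    by (cases "ideal_length R (\<mm> \<cdot> (mpow n \<cdot> J)) (mpow n \<cdot> J)"; cases "ideal_length R (mpow n \<cdot> J) J")
      auto
qed

section \<open>Ratliff-Rush closures of powers\<close>

lemma increasing_ideals_stable: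
  fixes Q :: "nat \<Rightarrow> 'a set"
  assumes "\<And>n. ideal (Q n) R" "\<And>n. Q n \<subseteq> Q (Suc n)"
  obtains k where "\<And>n. Q n \<subseteq> Q k"
proof -
  have "mono Q" unfolding mono_iff_le_Suc using assms(2) by blast
  then have "subset.chain {I. ideal I R} (range Q)"
    unfolding subset_chain_def using assms(1) by (auto simp: mono_def) (meson nat_le_linear subsetD)
  then have "\<Union>(range Q) \<in> range Q" by (intro ideal_chain_is_trivial) auto
  then show ?thesis using that by blast
qed

text \<open>The Ratliff-Rush closure of \<open>\<mm>\<^bsup>p\<^esup>\<close>, taken with respect to the powers of \<open>\<mm>\<close> instead of those
  of \<open>\<mm>\<^bsup>p\<^esup>\<close>. For \<open>p \<ge> 1\<close> the two agree, since the colon ideals increase with \<open>k\<close> and the multiples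
  of \<open>p\<close> are cofinal. In this form the closures for different \<open>p\<close> are linked by multiplication by
  \<open>\<mm>\<close> and by taking the colon by \<open>\<mm>\<close>.\<close>

definition ratliff_rush_mpow :: "nat \<Rightarrow> 'a set"
  where "ratliff_rush_mpow p = (\<Union>k. ideal_colon R (mpow (p + k)) (mpow k))"

lemma colon_mpow_Suc: "ideal_colon R (mpow (p + k)) (mpow k) \<subseteq> ideal_colon R (mpow (p + Suc k)) (mpow (Suc k))"
proof
  fix w assume w: "w \<in> ideal_colon R (mpow (p + k)) (mpow k)"
  then have wc: "w \<in> carrier R" by (simp add: ideal_colon_def)
  have "mpow (Suc k) \<subseteq> {v \<in> carrier R. w \<otimes> v \<in> mpow (p + Suc k)}"
    unfolding mpow_Suc[of k]
  proof (rule ideal_prod_least[OF preimage_mult_ideal[OF wc mpow_ideal]])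
    fix y z assume y: "y \<in> mpow k" and z: "z \<in> \<mm>"
    have c: "y \<in> carrier R" "z \<in> carrier R" using y z mpow_carrier ideal.Icarr[OF m_ideal] by auto
    have "w \<otimes> (y \<otimes> z) = (w \<otimes> y) \<otimes> z" using wc c by (simp add: m_assoc)
    moreover have "w \<otimes> y \<in> mpow (p + k)" using w y by (simp add: ideal_colon_def)
    ultimately have "w \<otimes> (y \<otimes> z) \<in> mpow (p + Suc k)"
      using mpow_mult[of "w \<otimes> y" "p + k" z "Suc 0"] z by (simp add: mpow_1)
    then show "y \<otimes> z \<in> {v \<in> carrier R. w \<otimes> v \<in> mpow (p + Suc k)}" using c by simp
  qed
  then show "w \<in> ideal_colon R (mpow (p + Suc k)) (mpow (Suc k))" using wc by (auto simp: ideal_colon_def)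
qed

lemma ratliff_rush_mpow_stable:
  obtains k where "\<And>n. k \<le> n \<Longrightarrow> ratliff_rush_mpow p = ideal_colon R (mpow (p + n)) (mpow n)"
proof -
  let ?C = "\<lambda>k. ideal_colon R (mpow (p + k)) (mpow k)"
  obtain k where k: "\<And>n. ?C n \<subseteq> ?C k"
    using increasing_ideals_stable[of ?C] ideal_colon_ideal[OF mpow_ideal mpow_carrier] colon_mpow_Suc
    by blast
  have "ratliff_rush_mpow p = ?C n" if "k \<le> n" for n
  proof -
    have "?C k \<subseteq> ?C n" using that by (rule lift_Suc_mono_le[of ?C, OF colon_mpow_Suc])
    then show ?thesis unfolding ratliff_rush_mpow_def using k by blast
  qed
  then show ?thesis using that by blast
qed

lemma ratliff_rush_mpow_ideal: "ideal (ratliff_rush_mpow p) R"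
  using ratliff_rush_mpow_stable[of p] ideal_colon_ideal[OF mpow_ideal mpow_carrier] by (metis order_refl)

lemma mpow_subset_ratliff_rush: "mpow p \<subseteq> ratliff_rush_mpow p"
  unfolding ratliff_rush_mpow_def ideal_colon_def using mpow_mult mpow_carrier by blast

lemma m_mult_ratliff_rush:
  assumes "z \<in> \<mm>" "w \<in> ratliff_rush_mpow p"
  shows "z \<otimes> w \<in> ratliff_rush_mpow (Suc p)"
proof -
  obtain k where w: "w \<in> carrier R" "\<And>y. y \<in> mpow k \<Longrightarrow> w \<otimes> y \<in> mpow (p + k)"
    using assms(2) by (auto simp: ratliff_rush_mpow_def ideal_colon_def)
  have z: "z \<in> carrier R" using assms(1) ideal.Icarr[OF m_ideal] by blast
  have "z \<otimes> w \<otimes> y \<in> mpow (Suc p + k)" if "y \<in> mpow k" for y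
  proof -
    have "z \<otimes> w \<otimes> y = z \<otimes> (w \<otimes> y)" using that mpow_carrier z w(1) by (meson m_assoc subsetD)
    then show ?thesis using mpow_mult[of z "Suc 0" "w \<otimes> y" "p + k"] assms(1) w(2)[OF that]
      by (simp add: mpow_1)
  qed
  then show ?thesis using z w(1) unfolding ratliff_rush_mpow_def ideal_colon_def by blast
qed

text \<open>With the powers of \<open>\<mm>\<close> in place of their closures the conclusion fails in general; it is the
  reason for using the closures. By \<open>ratliff_rush_mpow_stable\<close> one exponent \<open>k\<close> serves all \<open>z \<in> \<mm>\<close> at once.\<close>

lemma ratliff_rush_colon_m:
  assumes w: "w \<in> carrier R" and "\<And>z. z \<in> \<mm> \<Longrightarrow> z \<otimes> w \<in> ratliff_rush_mpow (Suc p)"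
  shows "w \<in> ratliff_rush_mpow p"
proof -
  obtain k where k: "ratliff_rush_mpow (Suc p) = ideal_colon R (mpow (Suc p + k)) (mpow k)"
    using ratliff_rush_mpow_stable by (metis order_refl)
  have "mpow (Suc k) \<subseteq> {v \<in> carrier R. w \<otimes> v \<in> mpow (p + Suc k)}"
    unfolding mpow_Suc[of k]
  proof (rule ideal_prod_least[OF preimage_mult_ideal[OF w mpow_ideal]])
    fix y z assume y: "y \<in> mpow k" and z: "z \<in> \<mm>"
    have c: "y \<in> carrier R" "z \<in> carrier R" using y z mpow_carrier ideal.Icarr[OF m_ideal] by auto
    have "w \<otimes> (y \<otimes> z) = (z \<otimes> w) \<otimes> y" using w c by algebra
    also have "\<dots> \<in> mpow (Suc p + k)" using assms(2)[OF z] y unfolding k by (simp add: ideal_colon_def)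
    finally show "y \<otimes> z \<in> {v \<in> carrier R. w \<otimes> v \<in> mpow (p + Suc k)}" using c by simp
  qed
  then show ?thesis using w unfolding ratliff_rush_mpow_def ideal_colon_def by blast
qed

text \<open>The exponents \<open>lk\<close> are large enough to compute \<open>ratliff_rush_mpow l\<close>, and at such an exponent
  the colon ideal is one of those in the Ratliff-Rush closure of the ideal \<open>\<mm>\<^bsup>l\<^esup>\<close>.\<close>

lemma ratliff_rush_closed_mpow:
  assumes "l \<ge> 1" "ratliff_rush_closed R (mpow l)"
  shows "ratliff_rush_mpow l = mpow l"
proof
  have pow: "ideal_power R (mpow l) n = mpow (l * n)" for n
  proof -
    interpret I: comm_monoid "ideals_set R" by (rule ideals_set_is_comm_monoid)
    have "\<mm> \<in> carrier (ideals_set R)" using m_ideal by (simp add: ideals_set_def)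
    then show ?thesis unfolding mpow_def by (rule I.nat_pow_pow)
  qed
  show "ratliff_rush_mpow l \<subseteq> mpow l"
  proof
    fix w assume w: "w \<in> ratliff_rush_mpow l"
    obtain k where k: "\<And>n. k \<le> n \<Longrightarrow> ratliff_rush_mpow l = ideal_colon R (mpow (l + n)) (mpow n)"
      using ratliff_rush_mpow_stable[of l] by blast
    have "k \<le> l * k" using assms(1) by simp
    then have "w \<in> ideal_colon R (mpow (l + l * k)) (mpow (l * k))" using k w by blast
    then have "w \<in> ideal_colon R (ideal_power R (mpow l) (k + 1)) (ideal_power R (mpow l) k)"
      unfolding pow by simp
    then show "w \<in> mpow l" using assms(2) unfolding ratliff_rush_closed_def ratliff_rush_closure_def by blast
  qed
qed (rule mpow_subset_ratliff_rush)


section \<open>One-dimensional submodules of the associated graded ring\<close>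

text \<open>For \<open>i \<ge> N\<close>, let \<open>V\<^sub>i\<close> be the image of \<open>x\<^sup>iJ\<close> in \<open>G\<^bsub>i+b\<^esub> = \<mm>\<^bsup>i+b\<^esup>/\<mm>\<^bsup>i+b+1\<^esup>\<close>, which makes sense by
  the second condition. The first condition says that \<open>\<mm>\<^sup>iJ\<close> has the same image, so the \<open>V\<^sub>i\<close> form a
  graded submodule \<open>V\<close> of \<open>G\<close>. By the third condition \<open>x : V\<^sub>i \<rightarrow> V\<^bsub>i+1\<^esub>\<close> is injective, hence
  bijective, and by the last one \<open>V\<close> is nonzero in every degree, witnessed by the classes of
  \<open>x\<^sup>iu\<close>. In other words, \<open>V\<close> is a one-dimensional submodule of \<open>G\<close> with parameter \<open>x\<close>.\<close>

definition persistent :: "'a set \<Rightarrow> 'a \<Rightarrow> nat \<Rightarrow> nat \<Rightarrow> 'a \<Rightarrow> bool"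
  where "persistent J x b N u \<longleftrightarrow> ideal J R \<and> x \<in> \<mm> \<and> u \<in> J \<and>
    (\<forall>i\<ge>N. \<forall>v\<in>mpow i \<cdot> J. \<exists>w\<in>J. v \<ominus> x [^] i \<otimes> w \<in> mpow (i + b + 1)) \<and>
    (\<forall>i\<ge>N. \<forall>w\<in>J. x [^] i \<otimes> w \<in> mpow (i + b)) \<and>
    (\<forall>i\<ge>N. \<forall>j. \<forall>w\<in>J. x [^] j \<otimes> w \<in> mpow (j + b + 1) \<longrightarrow> x [^] i \<otimes> w \<in> mpow (i + b + 1)) \<and>
    (\<forall>i. x [^] i \<otimes> u \<notin> mpow (i + b + 1))"

text \<open>The relation \<open>\<mm>J \<subseteq> xJ + \<mm>Q\<close> propagates to all powers: \<open>\<mm>\<^bsup>i+1\<^esup>J \<subseteq> x\<^sup>i\<mm>J + \<mm>\<^bsup>i+1\<^esup>Q\<close>, and the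
  relation can be used once more on \<open>\<mm>J\<close>.\<close>

lemma mpow_prod_reduction:
  assumes J: "ideal J R" and Q: "ideal Q R" and x: "x \<in> \<mm>"
    and red: "\<mm> \<cdot> J \<subseteq> ((\<otimes>) x ` J) <+>\<^bsub>R\<^esub> (\<mm> \<cdot> Q)"
  shows "mpow i \<cdot> J \<subseteq> ((\<otimes>) (x [^] i) ` J) <+>\<^bsub>R\<^esub> (mpow i \<cdot> Q)"
proof (induction i)
  case 0
  have "(\<otimes>) \<one> ` J = J" using ideal.Icarr[OF J] by force
  then show ?case using subset_add_ideals(1)[OF J Q] by (simp add: mpow_0_prod J Q)
next
  case (Suc i)
  have xc: "x \<in> carrier R" using x ideal.Icarr[OF m_ideal] by blast
  note i = image_mult_ideal[OF nat_pow_closed[OF xc] J] ideal_prod_is_ideal[OF mpow_ideal Q]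
  show ?case unfolding mpow_Suc_prod[OF J]
  proof (rule ideal_prod_least[OF add_ideals[OF i]])
    fix z v assume z: "z \<in> \<mm>" and "v \<in> mpow i \<cdot> J"
    then obtain w f where wf: "w \<in> J" "f \<in> mpow i \<cdot> Q" "v = x [^] i \<otimes> w \<oplus> f"
      using Suc by (auto elim!: add_idealsE dest!: subsetD)
    have "z \<otimes> w \<in> ((\<otimes>) x ` J) <+>\<^bsub>R\<^esub> (\<mm> \<cdot> Q)" using red ideal_prod.prod[OF z wf(1)] by blast
    then obtain w' g where w': "w' \<in> J" "g \<in> \<mm> \<cdot> Q" "z \<otimes> w = x \<otimes> w' \<oplus> g"
      by (auto elim!: add_idealsE)
    have c: "z \<in> carrier R" "w \<in> carrier R" "w' \<in> carrier R" "g \<in> carrier R" "f \<in> carrier R"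
      using ideal.Icarr[OF m_ideal z] ideal.Icarr[OF J wf(1)] ideal.Icarr[OF J w'(1)]
        ideal.Icarr[OF ideal_prod_is_ideal[OF m_ideal Q] w'(2)] ideal.Icarr[OF i(2) wf(2)] .
    have xi: "x [^] i \<in> carrier R" using xc by simp
    have "z \<otimes> v = x [^] i \<otimes> (z \<otimes> w) \<oplus> z \<otimes> f" unfolding wf(3) using c xi by algebra
    also have "\<dots> = x [^] Suc i \<otimes> w' \<oplus> (x [^] i \<otimes> g \<oplus> z \<otimes> f)"
      unfolding w'(3) nat_pow_Suc using c xi xc by algebra
    finally have eq: "z \<otimes> v = x [^] Suc i \<otimes> w' \<oplus> (x [^] i \<otimes> g \<oplus> z \<otimes> f)" .
    have "x [^] i \<otimes> g \<in> mpow (Suc i) \<cdot> Q"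
      using mpow_prod_mult[OF pow_mpow[OF x] Q, of g "Suc 0" i] w'(2) by (simp add: mpow_1)
    moreover have "z \<otimes> f \<in> mpow (Suc i) \<cdot> Q"
      using mpow_prod_mult[of z "Suc 0" Q f i] z Q wf(2) by (simp add: mpow_1)
    ultimately have "x [^] i \<otimes> g \<oplus> z \<otimes> f \<in> mpow (Suc i) \<cdot> Q"
      using ideal_plus_closed[OF i(2)] by blast
    then show "z \<otimes> v \<in> ((\<otimes>) (x [^] Suc i) ` J) <+>\<^bsub>R\<^esub> (mpow (Suc i) \<cdot> Q)"
      unfolding eq by (intro add_idealsI imageI w'(1))
  qed
qed

text \<open>By \<open>mpow_prod_reduction\<close> and since \<open>\<mm>\<^sup>iF \<subseteq> \<mm>\<^bsup>p+i\<^esup>\<close> for large \<open>i\<close>, where \<open>F\<close>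
  is the Ratliff-Rush closure of \<open>\<mm>\<^bsup>p\<^esup>\<close>, the ideal \<open>\<mm>\<^sup>iJ\<close> is \<open>x\<^sup>iJ\<close> modulo \<open>\<mm>\<^bsup>p+i\<^esup>\<close>. The
  hypothesis \<open>J \<not>\<subseteq> F\<close> means that \<open>\<mm>\<^sup>iJ\<close> is never contained in \<open>\<mm>\<^bsup>p+i\<^esup>\<close>. So there is a largest
  \<open>b < p\<close> such that \<open>\<mm>\<^sup>iJ \<subseteq> \<mm>\<^bsup>i+b\<^esup>\<close> for some \<open>i\<close>, and the images of these ideals in \<open>G\<close> form the
  required submodule.\<close>

lemma persistent_exists:
  assumes J: "ideal J R" and nsub: "\<not> J \<subseteq> ratliff_rush_mpow p" and x: "x \<in> \<mm>"
    and red: "\<mm> \<cdot> J \<subseteq> ((\<otimes>) x ` J) <+>\<^bsub>R\<^esub> (\<mm> \<cdot> ratliff_rush_mpow p)"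
  shows "\<exists>b N u. persistent J x b N u"
proof -
  let ?F = "ratliff_rush_mpow p"
  have xc: "x \<in> carrier R" using x ideal.Icarr[OF m_ideal] by blast
  have Jc: "w \<in> carrier R" if "w \<in> J" for w using ideal.Icarr[OF J that] .
  obtain k0 where k0: "\<And>n. k0 \<le> n \<Longrightarrow> ?F = ideal_colon R (mpow (p + n)) (mpow n)"
    using ratliff_rush_mpow_stable[of p] by blast
  have MF: "mpow i \<cdot> ?F \<subseteq> mpow (p + i)" if "k0 \<le> i" for i
    by (rule ideal_prod_least[OF mpow_ideal])
      (use k0[OF that] mpow_carrier in \<open>auto simp: ideal_colon_def m_comm subset_iff\<close>)
  define C where "C b \<longleftrightarrow> (\<exists>n. mpow n \<cdot> J \<subseteq> mpow (n + b))" for b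
  have C0: "C 0" unfolding C_def using ideal_prod_inter[OF mpow_ideal J] by auto
  have Cp: "\<not> C p"
  proof
    assume "C p"
    then obtain n where n: "mpow n \<cdot> J \<subseteq> mpow (n + p)" unfolding C_def by blast
    have "w \<in> ?F" if w: "w \<in> J" for w
    proof -
      have "w \<otimes> y \<in> mpow (p + n)" if y: "y \<in> mpow n" for y
      proof -
        have "w \<otimes> y = y \<otimes> w" using Jc[OF w] y mpow_carrier by (meson m_comm subsetD)
        moreover have "y \<otimes> w \<in> mpow (n + p)" using n ideal_prod.prod[OF y w] by blast
        ultimately show ?thesis by (simp add: add.commute)
      qed
      then show ?thesis using Jc[OF w] unfolding ratliff_rush_mpow_def ideal_colon_def by blast
    qed
    then show False using nsub by blast
  qed
  obtain b where b: "b < p" "C b" "\<not> C (Suc b)"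
    using ex_least_nat_less[of "\<lambda>b. \<not> C b" p] C0 Cp by auto
  obtain n1 where n1: "mpow n1 \<cdot> J \<subseteq> mpow (n1 + b)" using b(2) C_def by blast
  have Mb: "mpow i \<cdot> J \<subseteq> mpow (i + b)" if "n1 \<le> i" for i
    using that
  proof (induction i rule: dec_induct)
    case (step i)
    have "mpow (Suc i) \<cdot> J \<subseteq> \<mm> \<cdot> mpow (i + b)"
      unfolding mpow_Suc_prod[OF J] by (rule ideal_prod_mono[OF order_refl step.IH])
    also have "\<dots> = mpow (Suc i + b)"
      using ideal_prod_commute[OF m_ideal mpow_ideal] by (simp add: mpow_Suc)
    finally show ?case .
  qed (rule n1)
  \<comment> \<open>The kernels of the maps \<open>x\<^sup>i : J \<rightarrow> \<mm>\<^bsup>i+b\<^esup>/\<mm>\<^bsup>i+b+1\<^esup>\<close> increase with \<open>i\<close>, so they are eventually constant.\<close>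
  define U where "U i = J \<inter> {w \<in> carrier R. x [^] i \<otimes> w \<in> mpow (i + b + 1)}" for i
  have Ui: "ideal (U i) R" for i
    unfolding U_def by (intro i_intersect J preimage_mult_ideal mpow_ideal) (simp add: xc)
  have US: "U i \<subseteq> U (Suc i)" for i
  proof
    fix w assume w: "w \<in> U i"
    then have "x \<otimes> (x [^] i \<otimes> w) \<in> mpow (Suc 0 + (i + b + 1))"
      using mpow_mult[of x "Suc 0" "x [^] i \<otimes> w"] x by (simp add: U_def mpow_1)
    moreover have "x \<otimes> (x [^] i \<otimes> w) = x [^] Suc i \<otimes> w"
      using w xc by (simp add: U_def m_assoc m_comm m_lcomm)
    ultimately show "w \<in> U (Suc i)" using w by (simp add: U_def)
  qed
  obtain n2 where n2: "\<And>i. U i \<subseteq> U n2" using increasing_ideals_stable[of U] Ui US by blast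
  have red_i: "\<exists>w\<in>J. v \<ominus> x [^] i \<otimes> w \<in> mpow (i + b + 1)" if i: "k0 \<le> i" and v: "v \<in> mpow i \<cdot> J" for i v
  proof -
    obtain w f where wf: "w \<in> J" "f \<in> mpow i \<cdot> ?F" "v = x [^] i \<otimes> w \<oplus> f"
      using mpow_prod_reduction[OF J ratliff_rush_mpow_ideal x red, of i] v
      by (auto elim!: add_idealsE dest!: subsetD)
    have f: "f \<in> mpow (i + b + 1)"
      using MF[OF i] wf(2) mpow_antimono[of "i + b + 1" "p + i"] b(1) by auto
    then have "f \<in> carrier R" using mpow_carrier by blast
    moreover have "x [^] i \<otimes> w \<in> carrier R" using xc Jc[OF wf(1)] by simp
    ultimately have "v \<ominus> x [^] i \<otimes> w = f" unfolding wf(3) by algebra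
    then show ?thesis using wf(1) f by auto
  qed
  \<comment> \<open>Otherwise \<open>\<mm>\<^sup>iJ\<close> would drop into \<open>\<mm>\<^bsup>i+b+1\<^esup>\<close>, against the choice of \<open>b\<close>.\<close>
  have "U n2 \<noteq> J"
  proof
    assume eq: "U n2 = J"
    define i where "i = max n2 k0"
    have "U n2 \<subseteq> U i" by (rule lift_Suc_mono_le[of U, OF US]) (simp add: i_def)
    then have Ji: "w \<in> J \<Longrightarrow> x [^] i \<otimes> w \<in> mpow (i + b + 1)" for w using eq by (auto simp: U_def)
    have "mpow i \<cdot> J \<subseteq> mpow (i + Suc b)"
    proof
      fix v assume v: "v \<in> mpow i \<cdot> J"
      then obtain w where w: "w \<in> J" "v \<ominus> x [^] i \<otimes> w \<in> mpow (i + b + 1)"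
        using red_i[of i v] by (auto simp: i_def)
      have c: "v \<in> carrier R" "x [^] i \<otimes> w \<in> carrier R"
        using ideal.Icarr[OF ideal_prod_is_ideal[OF mpow_ideal J] v] xc Jc[OF w(1)] by auto
      have "v = (v \<ominus> x [^] i \<otimes> w) \<oplus> x [^] i \<otimes> w" using c by algebra
      then show "v \<in> mpow (i + Suc b)" using mpow_add_mem[OF w(2) Ji[OF w(1)]] by simp
    qed
    then show False using b(3) C_def by blast
  qed
  then obtain u where u: "u \<in> J" "u \<notin> U n2" using U_def by blast
  have "persistent J x b (max k0 (max n1 n2)) u"
    unfolding persistent_def
  proof (intro conjI allI ballI impI)
    fix i w assume i: "max k0 (max n1 n2) \<le> i" and w: "w \<in> J"
    have "x [^] i \<otimes> w \<in> mpow i \<cdot> J" by (rule ideal_prod.prod[OF pow_mpow[OF x] w])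
    then show "x [^] i \<otimes> w \<in> mpow (i + b)" using Mb i by auto
    fix j assume "x [^] j \<otimes> w \<in> mpow (j + b + 1)"
    then have "w \<in> U j" using w Jc by (simp add: U_def)
    then have "w \<in> U n2" using n2 by blast
    moreover have "U n2 \<subseteq> U i" by (rule lift_Suc_mono_le[of U, OF US]) (use i in simp)
    ultimately show "x [^] i \<otimes> w \<in> mpow (i + b + 1)" by (auto simp: U_def)
  next
    fix i show "x [^] i \<otimes> u \<notin> mpow (i + b + 1)" using u n2[of i] Jc by (auto simp: U_def)
  qed (use J x u red_i in auto)
  then show ?thesis by blast
qed

section \<open>Growth of length under multiplication by the maximal ideal\<close>

lemma enat_add_strict_mono: "(a::enat) < a' \<Longrightarrow> b < b' \<Longrightarrow> a + b < a' + b'"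
  by (cases a; cases b; cases a'; cases b') auto

lemma ideal_length_psubset: "ideal K R \<Longrightarrow> ideal J R \<Longrightarrow> K \<subset> J \<Longrightarrow> 1 \<le> ideal_length R K J"
  using ideal_chain_length_le[OF ideal_chain_Suc[OF ideal_chain_0[OF _ order_refl]], of K R J]
  by (simp add: one_enat_def)

text \<open>Here \<open>K\<close> is the kernel of multiplication by \<open>h\<close> from \<open>J\<close> to \<open>R/F\<^sub>p\<close>, where \<open>F\<^sub>p\<close> is the
  Ratliff-Rush closure of \<open>\<mm>\<^bsup>p\<^esup>\<close>. An element \<open>x \<in> \<mm>\<close> with injective multiplication
  \<open>J/K \<rightarrow> \<mm>J/\<mm>K\<close> gives the weak inequality. Such an \<open>x\<close> need not exist when the residue field is
  finite, so the proof picks any \<open>x \<in> \<mm>\<close> with \<open>xhJ \<not>\<subseteq> F\<^bsub>p+1\<^esub>\<close>. Let \<open>K'\<close> be the kernel for \<open>hx\<close> and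
  \<open>p + 1\<close>. If \<open>K \<subset> K'\<close>, then \<open>J/K'\<close> and \<open>K'/K\<close> are shorter instances of the claim. This is the
  reason for carrying \<open>h\<close> and \<open>p\<close>. If \<open>K' = K\<close>, then \<open>x\<close> is injective, and equality of lengths would
  force \<open>\<mm>J = xJ + \<mm>K\<close>, which \<open>persistent_exists\<close> for the ideal \<open>hJ\<close> excludes.\<close>

lemma ideal_length_grows:
  assumes none: "\<And>J x b N u. \<not> persistent J x b N u"
    and "ideal J R" "h \<in> carrier R" "\<not> J \<subseteq> {w \<in> carrier R. h \<otimes> w \<in> ratliff_rush_mpow p}"
    and "K = J \<inter> {w \<in> carrier R. h \<otimes> w \<in> ratliff_rush_mpow p}"
  shows "ideal_length R K J < ideal_length R (\<mm> \<cdot> K) (\<mm> \<cdot> J)"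
  using assms(2-)
proof (induction "the_enat (ideal_length R K J)" arbitrary: J K h p rule: less_induct)
  case less
  let ?F = ratliff_rush_mpow
  note J = less.prems(1) and h = less.prems(2)
  define T where "T h p = {w \<in> carrier R. h \<otimes> w \<in> ?F p}" for h p
  have T: "ideal (T h p) R" if "h \<in> carrier R" for h p
    unfolding T_def by (rule preimage_mult_ideal[OF that ratliff_rush_mpow_ideal])
  have K: "K = J \<inter> T h p" and nsub: "\<not> J \<subseteq> T h p" using less.prems(3,4) by (simp_all add: T_def)
  have Ki: "ideal K R" unfolding K by (rule i_intersect[OF J T[OF h]])
  have KJ: "K \<subset> J" using K nsub by blast
  have Jc: "w \<in> carrier R" if "w \<in> J" for w using ideal.Icarr[OF J that] .
  have finite: "ideal_length R L J < \<infinity>" if "K \<subseteq> L" for L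
  proof -
    have "mpow p \<cdot> J \<subseteq> T h p"
    proof (rule ideal_prod_least[OF T[OF h]])
      fix a w assume aw: "a \<in> mpow p" "w \<in> J"
      then have c: "a \<in> carrier R" "w \<in> carrier R" using mpow_carrier Jc by auto
      have "h \<otimes> (a \<otimes> w) = (h \<otimes> w) \<otimes> a" using c h by algebra
      moreover have "(h \<otimes> w) \<otimes> a \<in> ?F p"
        using ideal.I_l_closed[OF ratliff_rush_mpow_ideal subsetD[OF mpow_subset_ratliff_rush aw(1)]] c h
        by simp
      ultimately show "a \<otimes> w \<in> T h p" using c by (simp add: T_def)
    qed
    then have "ideal_length R L J \<le> ideal_length R (mpow p \<cdot> J) J"
      using that mpow_prod_subset[OF J, of p] unfolding K by (intro ideal_length_mono) auto
    then show ?thesis using ideal_length_mpow_finite[OF J, of p] by (rule order_le_less_trans)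
  qed
  note mi = ideal_prod_is_ideal[OF m_ideal]
  have mT: "x \<otimes> w \<in> T h (Suc p)" if "x \<in> \<mm>" "w \<in> T h p" for x w
  proof -
    have c: "x \<in> carrier R" "w \<in> carrier R" using that ideal.Icarr[OF m_ideal] by (auto simp: T_def)
    have "h \<otimes> (x \<otimes> w) = x \<otimes> (h \<otimes> w)" using c h by algebra
    then show ?thesis using m_mult_ratliff_rush[of x "h \<otimes> w" p] that c by (simp add: T_def)
  qed
  \<comment> \<open>If every \<open>x\<close> failed, then \<open>\<mm>hJ \<subseteq> F\<^bsub>p+1\<^esub>\<close> and so \<open>hJ \<subseteq> F\<^sub>p\<close>.\<close>
  have "\<exists>x\<in>\<mm>. \<not> J \<subseteq> T (h \<otimes> x) (Suc p)"
  proof (rule ccontr)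
    assume contra: "\<not> ?thesis"
    have "J \<subseteq> T h p"
    proof
      fix w assume w: "w \<in> J"
      have "z \<otimes> (h \<otimes> w) \<in> ?F (Suc p)" if z: "z \<in> \<mm>" for z
      proof -
        have "w \<in> T (h \<otimes> z) (Suc p)" using contra z w by blast
        moreover have "z \<otimes> (h \<otimes> w) = h \<otimes> z \<otimes> w"
          using ideal.Icarr[OF m_ideal z] Jc[OF w] h by algebra
        ultimately show ?thesis by (simp add: T_def)
      qed
      then have "h \<otimes> w \<in> ?F p" using ratliff_rush_colon_m[of "h \<otimes> w" p] h Jc[OF w] by simp
      then show "w \<in> T h p" using Jc[OF w] by (simp add: T_def)
    qed
    then show False using nsub by blast
  qed
  then obtain x where x: "x \<in> \<mm>" "\<not> J \<subseteq> T (h \<otimes> x) (Suc p)" by blast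
  have xc: "x \<in> carrier R" "h \<otimes> x \<in> carrier R" using ideal.Icarr[OF m_ideal x(1)] h by auto
  define K' where "K' = J \<inter> T (h \<otimes> x) (Suc p)"
  have K'i: "ideal K' R" unfolding K'_def by (rule i_intersect[OF J T[OF xc(2)]])
  have K'J: "K' \<subset> J" using x(2) K'_def by blast
  have hxw: "h \<otimes> x \<otimes> w = h \<otimes> (x \<otimes> w)" if "w \<in> carrier R" for w using that h xc by (simp add: m_assoc)
  have KK': "K \<subseteq> K'"
  proof
    fix w assume "w \<in> K"
    then have "x \<otimes> w \<in> T h (Suc p)" "w \<in> J" using mT[OF x(1)] by (auto simp: K)
    then show "w \<in> K'" using Jc hxw by (simp add: K'_def T_def)
  qed
  show ?case
  proof (cases "K' = K")
    case False
    have add: "ideal_length R K J = ideal_length R K K' + ideal_length R K' J"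
      by (rule ideal_length_add[OF Ki K'i J KK']) (use K'J in blast)
    have pos: "1 \<le> ideal_length R K K'" "1 \<le> ideal_length R K' J"
      using ideal_length_psubset[OF Ki K'i] ideal_length_psubset[OF K'i J] KK' False K'J by auto
    \<comment> \<open>Both pieces are nonzero, so each is strictly shorter than \<open>J/K\<close>.\<close>
    have small: "the_enat (ideal_length R K K') < the_enat (ideal_length R K J)"
      "the_enat (ideal_length R K' J) < the_enat (ideal_length R K J)"
      using pos finite[of K] unfolding add
      by (cases "ideal_length R K K'"; cases "ideal_length R K' J"; simp add: one_enat_def)+
    have "ideal_length R K K' < ideal_length R (\<mm> \<cdot> K) (\<mm> \<cdot> K')"
      by (rule less.hyps[OF small(1) K'i h, of p])
        (use K KK' K'J False in \<open>auto simp: T_def[symmetric]\<close>)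
    moreover have "ideal_length R K' J < ideal_length R (\<mm> \<cdot> K') (\<mm> \<cdot> J)"
      by (rule less.hyps[OF small(2) J xc(2), of "Suc p"])
        (use x(2) in \<open>auto simp: T_def[symmetric] K'_def\<close>)
    moreover have "ideal_length R (\<mm> \<cdot> K) (\<mm> \<cdot> J)
        = ideal_length R (\<mm> \<cdot> K) (\<mm> \<cdot> K') + ideal_length R (\<mm> \<cdot> K') (\<mm> \<cdot> J)"
      by (rule ideal_length_add[OF mi[OF Ki] mi[OF K'i] mi[OF J]])
        (intro ideal_prod_mono order_refl KK' psubset_imp_subset[OF K'J])+
    ultimately show ?thesis unfolding add using enat_add_strict_mono by simp
  next
    case True
    let ?L = "((\<otimes>) x ` J) <+>\<^bsub>R\<^esub> (\<mm> \<cdot> K)"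
    note xJ = image_mult_ideal[OF xc(1) J]
    have L: "ideal ?L R" by (rule add_ideals[OF xJ mi[OF Ki]])
    have mKT: "\<mm> \<cdot> K \<subseteq> T h (Suc p)"
      by (rule ideal_prod_least[OF T[OF h]]) (use mT in \<open>auto simp: K\<close>)
    have "ideal_length R K J \<le> ideal_length R (\<mm> \<cdot> K) ?L"
    proof (rule ideal_length_mult_le[OF xc(1) J mi[OF Ki]])
      fix w assume w: "w \<in> J" "x \<otimes> w \<in> \<mm> \<cdot> K"
      then have "w \<in> K'" using mKT hxw[OF Jc[OF w(1)]] Jc[OF w(1)] by (auto simp: K'_def T_def)
      then show "w \<in> K" using True by simp
    qed
    moreover have "?L \<subset> \<mm> \<cdot> J"
    proof
      show "?L \<subseteq> \<mm> \<cdot> J"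
        by (intro add_ideals_least[OF mi[OF J]] image_subsetI ideal_prod.prod[OF x(1)]
            ideal_prod_mono order_refl psubset_imp_subset[OF KJ])
      show "?L \<noteq> \<mm> \<cdot> J"
      proof
        assume eq: "?L = \<mm> \<cdot> J"
        let ?J = "(\<otimes>) h ` J"
        have hJ: "ideal ?J R" by (rule image_mult_ideal[OF h J])
        note Q = ratliff_rush_mpow_ideal
        have hmK: "\<mm> \<cdot> K \<subseteq> {w \<in> carrier R. h \<otimes> w \<in> \<mm> \<cdot> ?F p}"
        proof (rule ideal_prod_least[OF preimage_mult_ideal[OF h mi[OF Q]]])
          fix z w assume zw: "z \<in> \<mm>" "w \<in> K"
          have c: "z \<in> carrier R" "w \<in> carrier R"
            using ideal.Icarr[OF m_ideal zw(1)] ideal.Icarr[OF Ki zw(2)] .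
          have "h \<otimes> (z \<otimes> w) = z \<otimes> (h \<otimes> w)" using c h by algebra
          moreover have "z \<otimes> (h \<otimes> w) \<in> \<mm> \<cdot> ?F p"
            by (rule ideal_prod.prod) (use zw in \<open>auto simp: K T_def\<close>)
          ultimately show "z \<otimes> w \<in> {w \<in> carrier R. h \<otimes> w \<in> \<mm> \<cdot> ?F p}" using c by simp
        qed
        have "\<mm> \<cdot> ?J \<subseteq> ((\<otimes>) x ` ?J) <+>\<^bsub>R\<^esub> (\<mm> \<cdot> ?F p)"
        proof (rule ideal_prod_least[OF add_ideals[OF image_mult_ideal[OF xc(1) hJ] mi[OF Q]]])
          fix z v assume z: "z \<in> \<mm>" and "v \<in> ?J"
          then obtain w where w: "w \<in> J" "v = h \<otimes> w" by blast
          have "z \<otimes> w \<in> ?L" unfolding eq by (rule ideal_prod.prod[OF z w(1)])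
          then obtain w' k where wk: "w' \<in> J" "k \<in> \<mm> \<cdot> K" "z \<otimes> w = x \<otimes> w' \<oplus> k"
            by (auto elim!: add_idealsE)
          have c: "z \<in> carrier R" "w \<in> carrier R" "w' \<in> carrier R" "k \<in> carrier R"
            using ideal.Icarr[OF m_ideal z] Jc[OF w(1)] Jc[OF wk(1)] ideal.Icarr[OF mi[OF Ki] wk(2)] .
          have "z \<otimes> v = h \<otimes> (z \<otimes> w)" unfolding w(2) using c h by algebra
          also have "\<dots> = x \<otimes> (h \<otimes> w') \<oplus> h \<otimes> k" unfolding wk(3) using c h xc by algebra
          also have "\<dots> \<in> ((\<otimes>) x ` ?J) <+>\<^bsub>R\<^esub> (\<mm> \<cdot> ?F p)"
            using wk hmK by (intro add_idealsI) auto
          finally show "z \<otimes> v \<in> ((\<otimes>) x ` ?J) <+>\<^bsub>R\<^esub> (\<mm> \<cdot> ?F p)" .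
        qed
        moreover have "\<not> ?J \<subseteq> ?F p" using nsub Jc by (auto simp: T_def)
        ultimately show False using persistent_exists[OF hJ _ x(1)] none by blast
      qed
    qed
    then have "ideal_length R (\<mm> \<cdot> K) (\<mm> \<cdot> J)
        = ideal_length R (\<mm> \<cdot> K) ?L + ideal_length R ?L (\<mm> \<cdot> J)"
      by (intro ideal_length_add mi Ki J L subset_add_ideals(2) xJ) auto
    moreover have "1 \<le> ideal_length R ?L (\<mm> \<cdot> J)"
      by (rule ideal_length_psubset[OF L mi[OF J] \<open>?L \<subset> \<mm> \<cdot> J\<close>])
    ultimately have "ideal_length R K J + 1 \<le> ideal_length R (\<mm> \<cdot> K) (\<mm> \<cdot> J)"
      using add_mono \<open>ideal_length R K J \<le> ideal_length R (\<mm> \<cdot> K) ?L\<close> by metis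
    then show ?thesis using finite[OF order_refl]
      by (cases "ideal_length R K J"; cases "ideal_length R (\<mm> \<cdot> K) (\<mm> \<cdot> J)") (auto simp: one_enat_def)
  qed
qed

end

section \<open>Quotient modules and the number of generators\<close>

lemma (in module) submoduleI_smult:
  assumes "H \<subseteq> carrier M" "\<zero>\<^bsub>M\<^esub> \<in> H"
    and "\<And>x y. x \<in> H \<Longrightarrow> y \<in> H \<Longrightarrow> x \<oplus>\<^bsub>M\<^esub> y \<in> H"
    and smult: "\<And>a x. a \<in> carrier R \<Longrightarrow> x \<in> H \<Longrightarrow> a \<odot>\<^bsub>M\<^esub> x \<in> H"
  shows "submodule H R M"
proof (rule submoduleI[OF assms(1,2) _ assms(3) smult])
  fix x assume x: "x \<in> H"
  then have "(\<ominus> \<one>) \<odot>\<^bsub>M\<^esub> x = \<ominus>\<^bsub>M\<^esub> x"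
    using assms(1) smult_l_minus[of \<one> x] smult_one by auto
  then show "\<ominus>\<^bsub>M\<^esub> x \<in> H" using smult[of "\<ominus> \<one>" x] x by simp
qed

lemma quotient_module_simps [simp]:
  "carrier (quotient_module R M N) = a_rcosets\<^bsub>M\<^esub> N"
  "ring.add (quotient_module R M N) = set_add M"
  "ring.zero (quotient_module R M N) = N"
  by (simp_all add: quotient_module_def)

locale module_with_submodule = module R M + sub: submodule N R M
  for R :: "('r, 's) ring_scheme" and M :: "('r, 'm, 'q) module_scheme" (structure) and N
begin

lemma sub_abelian_subgroup: "abelian_subgroup N M"
  by (rule abelian_subgroupI3[OF additive_subgroupI[OF sub.subgroup_axioms] M.abelian_group_axioms])

sublocale sub_group: abelian_subgroup N M by (rule sub_abelian_subgroup)

lemma quotient_add: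
  "x \<in> carrier M \<Longrightarrow> y \<in> carrier M \<Longrightarrow> (N +> x) <+>\<^bsub>M\<^esub> (N +> y) = N +> (x \<oplus> y)"
  by (rule sub_group.a_rcos_sum)

lemma mem_coset_iff:
  assumes "x \<in> carrier M" shows "y \<in> N +> x \<longleftrightarrow> (\<exists>n\<in>N. y = n \<oplus> x)"
  by (auto simp: a_r_coset_def')

lemma quotient_smult:
  assumes a: "a \<in> carrier R" and x: "x \<in> carrier M"
  shows "a \<odot>\<^bsub>quotient_module R M N\<^esub> (N +> x) = N +> (a \<odot> x)"
proof -
  have Nc: "n \<in> carrier M" if "n \<in> N" for n using that by simp
  have "N <+>\<^bsub>M\<^esub> ((\<lambda>y. a \<odot> y) ` (N +> x)) = N +> (a \<odot> x)"
  proof (intro equalityI subsetI)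
    fix z assume "z \<in> N <+>\<^bsub>M\<^esub> ((\<lambda>y. a \<odot> y) ` (N +> x))"
    then obtain n k where nk: "n \<in> N" "k \<in> N" "z = n \<oplus> a \<odot> (k \<oplus> x)"
      by (auto simp: set_add_def' mem_coset_iff[OF x])
    then have "z = (n \<oplus> a \<odot> k) \<oplus> a \<odot> x"
      using a x Nc by (simp add: smult_r_distr M.a_assoc)
    moreover have "n \<oplus> a \<odot> k \<in> N" using nk a by (simp add: sub_group.a_closed)
    ultimately show "z \<in> N +> (a \<odot> x)" using a x by (auto simp: mem_coset_iff)
  next
    fix z assume "z \<in> N +> (a \<odot> x)"
    then obtain n where n: "n \<in> N" "z = n \<oplus> a \<odot> x" using a x by (auto simp: mem_coset_iff)
    moreover have "x \<in> N +> x" by (rule sub_group.a_rcos_self[OF x])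
    ultimately show "z \<in> N <+>\<^bsub>M\<^esub> ((\<lambda>y. a \<odot> y) ` (N +> x))" unfolding set_add_def' by blast
  qed
  then show ?thesis by (simp add: quotient_module_def)
qed

lemma quotient_carrierE:
  assumes "X \<in> a_rcosets\<^bsub>M\<^esub> N" obtains x where "x \<in> carrier M" "X = N +> x"
  using assms by (auto simp: A_RCOSETS_def')

lemma coset_in_quotient: "x \<in> carrier M \<Longrightarrow> N +> x \<in> a_rcosets\<^bsub>M\<^esub> N"
  by (auto simp: A_RCOSETS_def')


lemma quotient_is_module: "module R (quotient_module R M N)"
proof (rule moduleI)
  let ?Q = "quotient_module R M N"
  show "cring R" by (rule R.is_cring)
  show "abelian_group ?Q"
  proof (rule abelian_groupI)
    fix X Y Z assume "X \<in> carrier ?Q" "Y \<in> carrier ?Q" "Z \<in> carrier ?Q"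
    then obtain x y z where "x \<in> carrier M" "X = N +> x" "y \<in> carrier M" "Y = N +> y"
      "z \<in> carrier M" "Z = N +> z" by (auto elim!: quotient_carrierE)
    then show "X \<oplus>\<^bsub>?Q\<^esub> Y \<oplus>\<^bsub>?Q\<^esub> Z = X \<oplus>\<^bsub>?Q\<^esub> (Y \<oplus>\<^bsub>?Q\<^esub> Z)" by (simp add: quotient_add M.a_assoc)
  next
    fix X Y assume "X \<in> carrier ?Q" "Y \<in> carrier ?Q"
    then obtain x y where "x \<in> carrier M" "X = N +> x" "y \<in> carrier M" "Y = N +> y"
      by (auto elim!: quotient_carrierE)
    then show "X \<oplus>\<^bsub>?Q\<^esub> Y \<in> carrier ?Q" "X \<oplus>\<^bsub>?Q\<^esub> Y = Y \<oplus>\<^bsub>?Q\<^esub> X"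
      by (simp_all add: quotient_add coset_in_quotient M.a_comm)
  next
    have N0: "N = N +> \<zero>" using M.a_coset_add_zero[OF sub_group.a_subset] by simp
    show "\<zero>\<^bsub>?Q\<^esub> \<in> carrier ?Q" using coset_in_quotient[of \<zero>] N0 by simp
    fix X assume "X \<in> carrier ?Q"
    then obtain x where x: "x \<in> carrier M" "X = N +> x" by (auto elim!: quotient_carrierE)
    then show "\<zero>\<^bsub>?Q\<^esub> \<oplus>\<^bsub>?Q\<^esub> X = X" using quotient_add[of \<zero> x] N0 by simp
    show "\<exists>Y\<in>carrier ?Q. Y \<oplus>\<^bsub>?Q\<^esub> X = \<zero>\<^bsub>?Q\<^esub>"
      using x quotient_add[of "\<ominus> x" x] coset_in_quotient[of "\<ominus> x"] N0
      by (intro bexI[of _ "N +> \<ominus> x"]) (simp_all add: M.l_neg)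
  qed
  fix a b X Y assume "a \<in> carrier R" "b \<in> carrier R" "X \<in> carrier ?Q" "Y \<in> carrier ?Q"
  then show "(a \<oplus>\<^bsub>R\<^esub> b) \<odot>\<^bsub>?Q\<^esub> X = a \<odot>\<^bsub>?Q\<^esub> X \<oplus>\<^bsub>?Q\<^esub> b \<odot>\<^bsub>?Q\<^esub> X"
    "a \<odot>\<^bsub>?Q\<^esub> (X \<oplus>\<^bsub>?Q\<^esub> Y) = a \<odot>\<^bsub>?Q\<^esub> X \<oplus>\<^bsub>?Q\<^esub> a \<odot>\<^bsub>?Q\<^esub> Y"
    "(a \<otimes>\<^bsub>R\<^esub> b) \<odot>\<^bsub>?Q\<^esub> X = a \<odot>\<^bsub>?Q\<^esub> (b \<odot>\<^bsub>?Q\<^esub> X)"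
    by (auto elim!: quotient_carrierE
        simp: quotient_smult quotient_add smult_l_distr smult_r_distr smult_assoc1)
next
  let ?Q = "quotient_module R M N"
  fix a X assume "a \<in> carrier R" "X \<in> carrier ?Q"
  then show "a \<odot>\<^bsub>?Q\<^esub> X \<in> carrier ?Q"
    by (auto elim!: quotient_carrierE simp: quotient_smult coset_in_quotient)
next
  let ?Q = "quotient_module R M N"
  fix X assume "X \<in> carrier ?Q"
  then show "\<one>\<^bsub>R\<^esub> \<odot>\<^bsub>?Q\<^esub> X = X" by (auto elim!: quotient_carrierE simp: quotient_smult)
qed

lemma image_submodule:
  assumes L: "submodule L R M" and NL: "N \<subseteq> L"
  shows "submodule ((\<lambda>x. N +> x) ` L) R (quotient_module R M N)"
proof -
  interpret Q: module R "quotient_module R M N" by (rule quotient_is_module)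
  note E = submoduleE[OF L]
  show ?thesis
  proof (rule Q.submoduleI_smult)
    show "(\<lambda>x. N +> x) ` L \<subseteq> carrier (quotient_module R M N)"
      using E(1) coset_in_quotient by auto
    have "\<zero> \<in> L" using NL by (rule subsetD) simp
    then have "N +> \<zero> \<in> (\<lambda>x. N +> x) ` L" by (rule imageI)
    then show "\<zero>\<^bsub>quotient_module R M N\<^esub> \<in> (\<lambda>x. N +> x) ` L"
      using M.a_coset_add_zero[OF sub_group.a_subset] by simp
  next
    fix X Y assume "X \<in> (\<lambda>x. N +> x) ` L" "Y \<in> (\<lambda>x. N +> x) ` L"
    then obtain x y where xy: "x \<in> L" "X = N +> x" "y \<in> L" "Y = N +> y" by blast
    then have "X \<oplus>\<^bsub>quotient_module R M N\<^esub> Y = N +> (x \<oplus> y)"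
      using quotient_add E(1) by (simp add: subsetD)
    then show "X \<oplus>\<^bsub>quotient_module R M N\<^esub> Y \<in> (\<lambda>x. N +> x) ` L" using E(5) xy by simp
  next
    fix a X assume a: "a \<in> carrier R" and "X \<in> (\<lambda>x. N +> x) ` L"
    then obtain x where x: "x \<in> L" "X = N +> x" by blast
    then have "a \<odot>\<^bsub>quotient_module R M N\<^esub> X = N +> (a \<odot> x)"
      using quotient_smult[OF a] E(1) by (simp add: subsetD)
    then show "a \<odot>\<^bsub>quotient_module R M N\<^esub> X \<in> (\<lambda>x. N +> x) ` L" using E(4)[OF a] x by simp
  qed
qed

lemma image_strict_mono:
  assumes L: "submodule L R M" "submodule L' R M" "N \<subseteq> L" "L \<subset> L'"
  shows "(\<lambda>x. N +> x) ` L \<subset> (\<lambda>x. N +> x) ` L'"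
proof
  show "(\<lambda>x. N +> x) ` L \<subseteq> (\<lambda>x. N +> x) ` L'" using L(4) by blast
  obtain y where y: "y \<in> L'" "y \<notin> L" using L(4) by blast
  have yc: "y \<in> carrier M" using submoduleE(1)[OF L(2)] y by blast
  have "N +> y \<notin> (\<lambda>x. N +> x) ` L"
  proof
    assume "N +> y \<in> (\<lambda>x. N +> x) ` L"
    then obtain x where x: "x \<in> L" "N +> y = N +> x" by blast
    have xc: "x \<in> carrier M" using submoduleE(1)[OF L(1)] x by blast
    have "y \<in> N +> x" using sub_group.a_rcos_self[OF yc] x(2) by simp
    then obtain n where "n \<in> N" "y = n \<oplus> x" using mem_coset_iff[OF xc] by blast
    then show False using submoduleE(5)[OF L(1), of n x] L(3) x(1) y(2) by blast
  qed
  then show "(\<lambda>x. N +> x) ` L \<noteq> (\<lambda>x. N +> x) ` L'" using y(1) by blast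
qed

lemma preimage_submodule:
  assumes T: "submodule T R (quotient_module R M N)"
  shows "submodule {x \<in> carrier M. N +> x \<in> T} R M" "N \<subseteq> {x \<in> carrier M. N +> x \<in> T}"
proof -
  interpret Q: module R "quotient_module R M N" by (rule quotient_is_module)
  note E = Q.submoduleE[OF T]
  have "N \<in> T" using submodule.axioms(1)[OF T] subgroup.one_closed by fastforce
  then have N: "N +> x \<in> T" if "x \<in> N" for x
    using that sub_group.a_rcos_const[of x] by simp
  then show "N \<subseteq> {x \<in> carrier M. N +> x \<in> T}" by auto
  show "submodule {x \<in> carrier M. N +> x \<in> T} R M"
  proof (rule submoduleI_smult)
    show "\<zero> \<in> {x \<in> carrier M. N +> x \<in> T}" using N[of \<zero>] by simp
  next
    fix x y assume "x \<in> {x \<in> carrier M. N +> x \<in> T}" "y \<in> {x \<in> carrier M. N +> x \<in> T}"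
    then show "x \<oplus> y \<in> {x \<in> carrier M. N +> x \<in> T}" using E(5)[of "N +> x" "N +> y"]
      by (simp add: quotient_add)
  next
    fix a x assume "a \<in> carrier R" "x \<in> {x \<in> carrier M. N +> x \<in> T}"
    then show "a \<odot> x \<in> {x \<in> carrier M. N +> x \<in> T}" using E(4)[of a "N +> x"]
      by (simp add: quotient_smult)
  qed auto
qed

text \<open>Submodules of \<open>M/N\<close> correspond to the submodules of \<open>M\<close> that contain \<open>N\<close>.\<close>

lemma module_length_quotient:
  "module_length R (quotient_module R M N) = Sup {enat n | n. \<exists>L.
    (\<forall>i\<le>n. submodule (L i) R M \<and> N \<subseteq> L i) \<and> (\<forall>i<n. L i \<subset> L (Suc i))}"
proof -
  let ?Q = "quotient_module R M N"
  interpret Q: module R ?Q by (rule quotient_is_module)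
  have "(\<exists>T. (\<forall>i\<le>n. submodule (T i) R ?Q) \<and> (\<forall>i<n. T i \<subset> T (Suc i))) \<longleftrightarrow>
    (\<exists>L. (\<forall>i\<le>n. submodule (L i) R M \<and> N \<subseteq> L i) \<and> (\<forall>i<n. L i \<subset> L (Suc i)))" for n :: nat
  proof
    assume "\<exists>T. (\<forall>i\<le>n. submodule (T i) R ?Q) \<and> (\<forall>i<n. T i \<subset> T (Suc i))"
    then obtain T where T: "\<forall>i\<le>n. submodule (T i) R ?Q" "\<forall>i<n. T i \<subset> T (Suc i)" by blast
    define L where "L i = {x \<in> carrier M. N +> x \<in> T i}" for i
    have "L i \<subset> L (Suc i)" if i: "i < n" for i
    proof -
      obtain X where X: "X \<in> T (Suc i)" "X \<notin> T i" using T(2) i by blast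
      have "submodule (T (Suc i)) R ?Q" using T(1) i by simp
      then have "X \<in> carrier ?Q" using Q.submoduleE(1) X(1) by blast
      then obtain x where "x \<in> carrier M" "X = N +> x" by (auto elim!: quotient_carrierE)
      then show ?thesis using X T(2) i unfolding L_def by blast
    qed
    then show "\<exists>L. (\<forall>i\<le>n. submodule (L i) R M \<and> N \<subseteq> L i) \<and> (\<forall>i<n. L i \<subset> L (Suc i))"
      using preimage_submodule T(1) unfolding L_def by (intro exI[of _ L]) (simp add: L_def)
  next
    assume "\<exists>L. (\<forall>i\<le>n. submodule (L i) R M \<and> N \<subseteq> L i) \<and> (\<forall>i<n. L i \<subset> L (Suc i))"
    then obtain L where L: "\<forall>i\<le>n. submodule (L i) R M \<and> N \<subseteq> L i" "\<forall>i<n. L i \<subset> L (Suc i)" by blast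
    then show "\<exists>T. (\<forall>i\<le>n. submodule (T i) R ?Q) \<and> (\<forall>i<n. T i \<subset> T (Suc i))"
      using image_submodule image_strict_mono
      by (intro exI[of _ "\<lambda>i. (\<lambda>x. N +> x) ` L i"]) (simp add: Suc_le_eq)
  qed
  then show ?thesis unfolding module_length_def by simp
qed

end

lemma (in cring) regular_module_module: "module R (regular_module R)"
proof (rule moduleI)
  show "abelian_group (regular_module R)"
    by (rule abelian_groupI)
      (auto simp: regular_module_def a_ac intro!: bexI[of _ "\<ominus> _"] l_neg)
qed (auto simp: regular_module_def l_distr r_distr m_assoc is_cring)

lemma (in cring) ideal_submodule:
  assumes "ideal J R" shows "submodule J R (regular_module R)"
proof -
  interpret M: module R "regular_module R" by (rule regular_module_module)
  show ?thesis
    using ideal_plus_closed[OF assms] ideal_zero_closed[OF assms] ideal.I_l_closed[OF assms] ideal.Icarr[OF assms]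
    by (intro M.submoduleI_smult) (auto simp: regular_module_def)
qed

lemma (in cring) ideal_module_module: "ideal J R \<Longrightarrow> module R (ideal_module R J)"
  unfolding ideal_module_def
  by (rule submodule.submodule_is_module[OF ideal_submodule regular_module_module])

lemma (in cring) submodule_ideal_module_iff:
  assumes "ideal J R"
  shows "submodule L R (ideal_module R J) \<longleftrightarrow> ideal L R \<and> L \<subseteq> J"
proof -
  interpret M: module R "ideal_module R J" by (rule ideal_module_module[OF assms])
  have s: "carrier (ideal_module R J) = J" "ring.add (ideal_module R J) = ring.add R"
    "ring.zero (ideal_module R J) = \<zero>" "smult (ideal_module R J) = monoid.mult R"
    by (simp_all add: ideal_module_def regular_module_def)
  show ?thesis
  proof
    assume L: "submodule L R (ideal_module R J)"
    note E = M.submoduleE[OF L, unfolded s]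
    have Lc: "L \<subseteq> carrier R" using E(1) ideal.Icarr[OF assms] by blast
    have "ideal L R"
    proof (rule idealI[OF ring_axioms])
      show "subgroup L (add_monoid R)"
      proof (rule add.subgroupI[OF Lc E(2)])
        fix a assume a: "a \<in> L"
        have "(\<ominus> \<one>) \<otimes> a = \<ominus> a" using a Lc by (simp add: l_minus subsetD)
        then show "\<ominus> a \<in> L" using E(4)[of "\<ominus> \<one>" a] a by simp
      qed (rule E(5))
      fix a r assume ar: "a \<in> L" "r \<in> carrier R"
      then show "r \<otimes> a \<in> L" using E(4) by blast
      moreover have "a \<otimes> r = r \<otimes> a" using ar Lc by (simp add: m_comm subsetD)
      ultimately show "a \<otimes> r \<in> L" by simp
    qed
    then show "ideal L R \<and> L \<subseteq> J" using E(1) by blast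
  next
    assume L: "ideal L R \<and> L \<subseteq> J"
    then have i: "ideal L R" by blast
    show "submodule L R (ideal_module R J)"
      using L ideal_plus_closed[OF i] ideal_zero_closed[OF i] ideal.I_l_closed[OF i]
      by (intro M.submoduleI_smult) (auto simp: s)
  qed
qed

lemma (in cring) num_generators_eq_ideal_length:
  assumes "ideal J R" "ideal \<mm> R"
  shows "num_generators R \<mm> J = ideal_length R (\<mm> \<cdot> J) J"
proof -
  have "ideal (\<mm> \<cdot> J) R" "\<mm> \<cdot> J \<subseteq> J"
    using ideal_prod_is_ideal ideal_prod_inter assms by blast+
  then have "submodule (\<mm> \<cdot> J) R (ideal_module R J)" using submodule_ideal_module_iff[OF assms(1)] by blast
  then interpret Q: module_with_submodule R "ideal_module R J" "\<mm> \<cdot> J"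
    by (intro module_with_submodule.intro ideal_module_module[OF assms(1)])
  show ?thesis
    unfolding num_generators_def Q.module_length_quotient ideal_length_def ideal_chain_def
    using submodule_ideal_module_iff[OF assms(1)] by (simp add: conj_ac)
qed

section \<open>Homogeneous ideals of the Rees algebra\<close>

locale rees_setting = UP_cring R P + noetherian_maximal R \<mm>
  for R :: "('a, 'b) ring_scheme" (structure) and P (structure) and \<mm>
begin

abbreviation S where "S \<equiv> rees_algebra R \<mm>"

lemma S_simps [simp]:
  "ring.add S = ring.add P" "monoid.mult S = monoid.mult P" "ring.zero S = ring.zero P" "one S = one P"
  by (auto simp: rees_algebra_def P_def)

lemma S_cring: "cring S" by (rule rees_cring[OF m_ideal])

sublocale S: cring S by (rule S_cring)

definition graded :: "(nat \<Rightarrow> 'a set) \<Rightarrow> (nat \<Rightarrow> 'a) set"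
  where "graded Q = {p \<in> carrier P. \<forall>n. coeff P p n \<in> Q n}"

lemma gradedI: "p \<in> carrier P \<Longrightarrow> (\<And>n. coeff P p n \<in> Q n) \<Longrightarrow> p \<in> graded Q"
  by (simp add: graded_def)

lemma gradedD: "p \<in> graded Q \<Longrightarrow> p \<in> carrier P" "p \<in> graded Q \<Longrightarrow> coeff P p n \<in> Q n"
  by (simp_all add: graded_def)

lemma graded_mono: "(\<And>n. Q n \<subseteq> Q' n) \<Longrightarrow> graded Q \<subseteq> graded Q'"
  by (auto simp: graded_def)

lemma S_carrier: "carrier S = graded mpow"
  by (simp add: rees_algebra_def P_def graded_def mpow_def)

lemma S_carrier_P: "p \<in> carrier S \<Longrightarrow> p \<in> carrier P"
  unfolding S_carrier by (rule gradedD)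

lemma rees_extension_graded: "rees_extension R \<mm> = graded (\<lambda>n. mpow (Suc n))"
  using rees_extension_degreewise[OF m_ideal] by (simp add: graded_def mpow_def del: Group.nat_pow_Suc)

lemma coeff_mult_mem:
  assumes "p \<in> carrier P" "q \<in> carrier P" "ideal Q R"
    and "\<And>i. i \<le> n \<Longrightarrow> coeff P p i \<otimes> coeff P q (n - i) \<in> Q"
  shows "coeff P (p \<otimes>\<^bsub>P\<^esub> q) n \<in> Q"
  unfolding coeff_mult[OF assms(1,2)]
  by (rule R.ideal_power_finsum[OF assms(3)]) (use assms(4) in auto)

lemma graded_mult:
  assumes p: "p \<in> graded Q'" and q: "q \<in> graded Q" and T: "\<And>n. ideal (T n) R"
    and "\<And>i j a c. a \<in> Q' i \<Longrightarrow> c \<in> Q j \<Longrightarrow> a \<otimes> c \<in> T (i + j)"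
  shows "p \<otimes>\<^bsub>P\<^esub> q \<in> graded T"
proof (rule gradedI)
  show "p \<otimes>\<^bsub>P\<^esub> q \<in> carrier P" using gradedD(1)[OF p] gradedD(1)[OF q] by simp
  show "coeff P (p \<otimes>\<^bsub>P\<^esub> q) n \<in> T n" for n
  proof (rule coeff_mult_mem[OF gradedD(1)[OF p] gradedD(1)[OF q] T])
    fix i assume "i \<le> n"
    then show "coeff P p i \<otimes> coeff P q (n - i) \<in> T n"
      using assms(4)[OF gradedD(2)[OF p] gradedD(2)[OF q], of i "n - i"] by simp
  qed
qed

lemma graded_add:
  assumes "\<And>n. ideal (Q n) R" "p \<in> graded Q" "q \<in> graded Q"
  shows "p \<oplus>\<^bsub>P\<^esub> q \<in> graded Q"
  using assms(2,3) R.ideal_plus_closed[OF assms(1)] by (auto simp: graded_def)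

lemma graded_zero: "(\<And>n. ideal (Q n) R) \<Longrightarrow> \<zero>\<^bsub>P\<^esub> \<in> graded Q"
  using R.ideal_zero_closed by (auto simp: graded_def)

text \<open>All ideals of the Rees algebra that occur below are homogeneous with explicit pieces, and their
  closure properties reduce to those of the pieces.\<close>

lemma graded_ideal:
  assumes Q: "\<And>n. ideal (Q n) R" "\<And>n. Q n \<subseteq> mpow n"
    and mult: "\<And>i j a c. a \<in> mpow i \<Longrightarrow> c \<in> Q j \<Longrightarrow> a \<otimes> c \<in> Q (i + j)"
  shows "ideal (graded Q) S"
proof (rule idealI[OF S.ring_axioms])
  have sub: "graded Q \<subseteq> carrier S" unfolding S_carrier by (rule graded_mono[OF Q(2)])
  have l: "x \<otimes>\<^bsub>S\<^esub> p \<in> graded Q" if "p \<in> graded Q" "x \<in> carrier S" for p x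
    using graded_mult[of x mpow p Q Q] that Q(1) mult by (simp add: S_carrier)
  show "subgroup (graded Q) (add_monoid S)"
  proof (rule S.add.subgroupI[OF sub])
    show "graded Q \<noteq> {}" using graded_zero[of Q] Q(1) by blast
  next
    fix p assume p: "p \<in> graded Q"
    then have pS: "p \<in> carrier S" using sub by blast
    have "\<ominus>\<^bsub>S\<^esub> \<one>\<^bsub>S\<^esub> \<otimes>\<^bsub>S\<^esub> p = \<ominus>\<^bsub>S\<^esub> p"
      using S.l_minus[OF S.one_closed pS] S.l_one[OF pS] by (simp only:)
    then show "\<ominus>\<^bsub>S\<^esub> p \<in> graded Q"
      using l[OF p S.a_inv_closed[OF S.one_closed]] by (simp only:)
  next
    fix p q assume "p \<in> graded Q" "q \<in> graded Q"
    then show "p \<oplus>\<^bsub>S\<^esub> q \<in> graded Q" using graded_add[of Q] Q(1) by simp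
  qed
  fix p x assume px: "p \<in> graded Q" "x \<in> carrier S"
  then show "x \<otimes>\<^bsub>S\<^esub> p \<in> graded Q" by (rule l)
  then show "p \<otimes>\<^bsub>S\<^esub> x \<in> graded Q" using S.m_comm[of x p] px sub by auto
qed

lemma coeff_monom_times:
  assumes "a \<in> carrier R" "q \<in> carrier P"
  shows "coeff P (monom P a n \<otimes>\<^bsub>P\<^esub> q) j = (if j < n then \<zero> else a \<otimes> coeff P q (j - n))"
proof -
  have "coeff P (monom P a n \<otimes>\<^bsub>P\<^esub> q) j
      = (\<Oplus>i\<in>{..j}. if n = i then a \<otimes> coeff P q (j - i) else \<zero>)"
    using assms by (simp add: if_distrib[of "\<lambda>c. c \<otimes> _"] cong: if_cong)
  also have "\<dots> = (if j < n then \<zero> else a \<otimes> coeff P q (j - n))"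
  proof (cases "j < n")
    case True
    then have "(\<Oplus>i\<in>{..j}. if n = i then a \<otimes> coeff P q (j - i) else \<zero>) = (\<Oplus>i\<in>{..j}. \<zero>)"
      by (intro R.finsum_cong') auto
    then show ?thesis using True by simp
  next
    case False
    then show ?thesis using assms R.finsum_singleton[of n "{..j}" "\<lambda>i. a \<otimes> coeff P q (j - i)"] by auto
  qed
  finally show ?thesis .
qed

abbreviation \<MM> where "\<MM> \<equiv> rees_max_ideal R \<mm>"

lemma rees_plus_graded: "rees_plus R \<mm> = graded (\<lambda>n. if n = 0 then {\<zero>} else mpow n)"
proof -
  have "\<zero> \<in> mpow 0" by (simp add: mpow_0)
  then show ?thesis
    unfolding rees_plus_def S_carrier graded_def P_def[symmetric]
    by auto
qed

lemma rees_plus_ideal: "ideal (rees_plus R \<mm>) S"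
  unfolding rees_plus_graded
proof (rule graded_ideal)
  fix i j a c assume ac: "a \<in> mpow i" "c \<in> (if j = 0 then {\<zero>} else mpow j)"
  then have "a \<in> carrier R" "a \<otimes> \<zero> \<in> mpow (i + j)"
    using mpow_carrier R.ideal_zero_closed[OF mpow_ideal] by (auto simp: subset_iff)
  then show "a \<otimes> c \<in> (if i + j = 0 then {\<zero>} else mpow (i + j))"
    using ac mpow_mult by (auto split: if_splits)
qed (use mpow_ideal R.zeroideal R.ideal_zero_closed in auto)

lemma rees_extension_ideal: "ideal (rees_extension R \<mm>) S"
  unfolding rees_extension_graded
proof (rule graded_ideal)
  fix i j a c assume "a \<in> mpow i" "c \<in> mpow (Suc j)"
  then show "a \<otimes> c \<in> mpow (Suc (i + j))" using mpow_mult[of a i c "Suc j"] by simp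
qed (use mpow_ideal mpow_antimono in auto)

lemma MM_ideal: "ideal \<MM> S"
  unfolding rees_max_ideal_def by (rule S.add_ideals[OF rees_extension_ideal rees_plus_ideal])

text \<open>These pieces bound those of \<open>\<MM>\<^sup>k\<close> from above: a homogeneous element of \<open>\<MM>\<close> has its coefficient
  in \<open>\<mm>\<close>, even in degree \<open>0\<close>, so each of \<open>k\<close> factors contributes at least one power of \<open>\<mm>\<close>.
  Homomorphisms on \<open>\<MM>\<^sup>k\<close> are constructed on this explicit ideal.\<close>

definition truncated :: "nat \<Rightarrow> (nat \<Rightarrow> 'a) set"
  where "truncated k = graded (\<lambda>n. mpow (max n k))"

lemma truncated_ideal: "ideal (truncated k) S"
  unfolding truncated_def
proof (rule graded_ideal)
  fix i j a c assume "a \<in> mpow i" "c \<in> mpow (max j k)"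
  then show "a \<otimes> c \<in> mpow (max (i + j) k)" by (rule mpow_mult') auto
qed (use mpow_ideal mpow_antimono in auto)

lemma MM_subset_truncated: "\<MM> \<subseteq> truncated 1"
  unfolding rees_max_ideal_def
proof (rule S.add_ideals_least[OF truncated_ideal])
  show "rees_extension R \<mm> \<subseteq> truncated 1"
    unfolding rees_extension_graded truncated_def by (intro graded_mono mpow_antimono) auto
  show "rees_plus R \<mm> \<subseteq> truncated 1"
    unfolding rees_plus_graded truncated_def
    by (intro graded_mono) (use R.ideal_zero_closed[OF mpow_ideal] in auto)
qed

lemma MM_power_subset_truncated: "ideal_power S \<MM> k \<subseteq> truncated k"
proof (induction k)
  case 0
  then show ?case by (simp add: ideals_set_def truncated_def S_carrier)
next
  case (Suc k)
  show ?case unfolding S.ideal_power_Suc_prod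
  proof (rule S.ideal_prod_least[OF truncated_ideal])
    fix p q assume "p \<in> ideal_power S \<MM> k" "q \<in> \<MM>"
    then have "p \<in> truncated k" "q \<in> truncated 1" using Suc MM_subset_truncated by auto
    then have "p \<otimes>\<^bsub>P\<^esub> q \<in> truncated (Suc k)" unfolding truncated_def
    proof (rule graded_mult[OF _ _ mpow_ideal])
      fix i j a c assume "a \<in> mpow (max i k)" "c \<in> mpow (max j 1)"
      then show "a \<otimes> c \<in> mpow (max (i + j) (Suc k))" by (rule mpow_mult') auto
    qed
    then show "p \<otimes>\<^bsub>S\<^esub> q \<in> truncated (Suc k)" by simp
  qed
qed

lemma monom_in_MM_power:
  assumes "x \<in> \<mm>" shows "monom P (x [^] i) i \<in> ideal_power S \<MM> i"
proof (induction i)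
  case 0
  then show ?case using S.one_closed by (simp add: ideals_set_def)
next
  case (Suc i)
  have xc: "x \<in> carrier R" using assms ideal.Icarr[OF m_ideal] by blast
  have "monom P x 1 \<in> rees_plus R \<mm>"
    unfolding rees_plus_graded
    by (rule gradedI) (use assms xc R.ideal_zero_closed[OF mpow_ideal] mpow_1 in auto)
  then have "monom P x 1 \<in> \<MM>"
    unfolding rees_max_ideal_def
    using S.subset_add_ideals(2)[OF rees_extension_ideal rees_plus_ideal] by blast
  then have "monom P (x [^] i) i \<otimes>\<^bsub>S\<^esub> monom P x 1 \<in> ideal_power S \<MM> (Suc i)"
    unfolding S.ideal_power_Suc_prod by (rule ideal_prod.prod[OF Suc])
  then show ?case using monom_mult[of "x [^] i" x i 1] xc by simp
qed

lemma MM_power_antimono: "i \<le> j \<Longrightarrow> ideal_power S \<MM> j \<subseteq> ideal_power S \<MM> i"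
  by (rule S.ideal_power_antimono[OF MM_ideal])

end

section \<open>The associated graded module\<close>

lemma regular_module_simps [simp]:
  "carrier (regular_module R) = carrier R" "ring.add (regular_module R) = ring.add R"
  "ring.zero (regular_module R) = ring.zero R" "smult (regular_module R) = monoid.mult R"
  by (simp_all add: regular_module_def)

text \<open>A homomorphism from an ideal to an injective module is multiplication by the value at \<open>1\<close> of its
  extension to \<open>R\<close>.\<close>

lemma (in cring) injective_module_extend:
  assumes inj: "injective_module R E" and H: "ideal H R"
    and closed: "\<And>p. p \<in> H \<Longrightarrow> \<phi> p \<in> carrier E"
    and add: "\<And>p q. p \<in> H \<Longrightarrow> q \<in> H \<Longrightarrow> \<phi> (p \<oplus> q) = \<phi> p \<oplus>\<^bsub>E\<^esub> \<phi> q"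
    and smult: "\<And>a p. a \<in> carrier R \<Longrightarrow> p \<in> H \<Longrightarrow> \<phi> (a \<otimes> p) = a \<odot>\<^bsub>E\<^esub> \<phi> p"
  obtains e where "e \<in> carrier E" "\<And>p. p \<in> H \<Longrightarrow> \<phi> p = p \<odot>\<^bsub>E\<^esub> e"
proof -
  have "\<phi> \<in> module_hom R ((regular_module R)\<lparr>carrier := H\<rparr>) E"
    using closed add smult by (simp add: module_hom_def)
  then obtain g where g: "g \<in> module_hom R (regular_module R) E" "\<forall>x\<in>H. g x = \<phi> x"
    using inj regular_module_module ideal_submodule[OF H] unfolding injective_module_def by meson
  show ?thesis
  proof (rule that)
    show "g \<one> \<in> carrier E" using g(1) by (auto simp: module_hom_def)
    fix p assume p: "p \<in> H"
    then have "p \<in> carrier R" by (rule ideal.Icarr[OF H])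
    then have "g (p \<otimes> \<one>) = p \<odot>\<^bsub>E\<^esub> g \<one>" using g(1) unfolding module_hom_def by (simp del: r_one)
    then show "\<phi> p = p \<odot>\<^bsub>E\<^esub> g \<one>" using g(2) p \<open>p \<in> carrier R\<close> by simp
  qed
qed

context rees_setting
begin

abbreviation mS where "mS \<equiv> rees_extension R \<mm>"

definition graded_class :: "(nat \<Rightarrow> 'a) \<Rightarrow> (nat \<Rightarrow> 'a) set"
  where "graded_class q = mS +>\<^bsub>regular_module S\<^esub> q"

lemma G_module_with_submodule: "module_with_submodule S (regular_module S) mS"
  by (intro module_with_submodule.intro S.regular_module_module S.ideal_submodule rees_extension_ideal)

sublocale G: module_with_submodule S "regular_module S" mS
  by (rule G_module_with_submodule)

lemma graded_class_closed: "q \<in> carrier S \<Longrightarrow> graded_class q \<in> carrier (assoc_graded R \<mm>)"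
  unfolding graded_class_def assoc_graded_def using G.coset_in_quotient by simp

lemma assoc_gradedE:
  assumes "X \<in> carrier (assoc_graded R \<mm>)" obtains q where "q \<in> carrier S" "X = graded_class q"
  using assms G.quotient_carrierE unfolding graded_class_def assoc_graded_def by (metis quotient_module_simps(1) regular_module_simps(1))

lemma graded_class_add: "p \<in> carrier S \<Longrightarrow> q \<in> carrier S \<Longrightarrow>
    graded_class (p \<oplus>\<^bsub>P\<^esub> q) = graded_class p \<oplus>\<^bsub>assoc_graded R \<mm>\<^esub> graded_class q"
  unfolding graded_class_def assoc_graded_def using G.quotient_add[of p q] by simp

lemma graded_class_smult: "a \<in> carrier S \<Longrightarrow> q \<in> carrier S \<Longrightarrow>
    graded_class (a \<otimes>\<^bsub>P\<^esub> q) = a \<odot>\<^bsub>assoc_graded R \<mm>\<^esub> graded_class q"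
  unfolding graded_class_def assoc_graded_def using G.quotient_smult[of a q] by simp

lemma graded_class_eqI:
  assumes "q' \<in> carrier S" "n \<in> mS" shows "graded_class (n \<oplus>\<^bsub>P\<^esub> q') = graded_class q'"
proof -
  have "n \<oplus>\<^bsub>P\<^esub> q' \<in> mS +>\<^bsub>regular_module S\<^esub> q'" using G.mem_coset_iff[of q'] assms by auto
  then show ?thesis unfolding graded_class_def
    using G.M.a_repr_independence[of _ mS q'] assms G.sub.subgroup_axioms by (metis regular_module_simps(1))
qed

lemma graded_class_eqD:
  assumes "graded_class q = graded_class q'" "q \<in> carrier S" "q' \<in> carrier S"
  obtains n where "n \<in> mS" "q = n \<oplus>\<^bsub>P\<^esub> q'"
proof -
  have "q \<in> mS +>\<^bsub>regular_module S\<^esub> q" by (rule G.sub_group.a_rcos_self) (simp add: assms(2))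
  then have "q \<in> mS +>\<^bsub>regular_module S\<^esub> q'" using assms(1) by (simp add: graded_class_def)
  then show ?thesis using that G.mem_coset_iff[of q' q] assms(3) by auto
qed

end

section \<open>Homomorphisms of negative degree into the associated graded module\<close>

locale rees_persistent = rees_setting +
  fixes J :: "'a set" and x :: 'a and b N :: nat and u :: 'a
  assumes persistent: "persistent J x b N u"
begin

lemma J_ideal: "ideal J R" and x_in: "x \<in> \<mm>" and u_in: "u \<in> J"
  and reduce: "N \<le> i \<Longrightarrow> v \<in> mpow i \<cdot> J \<Longrightarrow> \<exists>w\<in>J. v \<ominus> x [^] i \<otimes> w \<in> mpow (i + b + 1)"
  and shift: "N \<le> i \<Longrightarrow> w \<in> J \<Longrightarrow> x [^] i \<otimes> w \<in> mpow (i + b)"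
  and cancel: "N \<le> i \<Longrightarrow> w \<in> J \<Longrightarrow> x [^] j \<otimes> w \<in> mpow (j + b + 1) \<Longrightarrow> x [^] i \<otimes> w \<in> mpow (i + b + 1)"
  and survive: "x [^] i \<otimes> u \<notin> mpow (i + b + 1)"
  using persistent unfolding persistent_def by auto

lemma x_carr: "x \<in> carrier R" using x_in ideal.Icarr[OF m_ideal] by blast
lemma J_carr: "w \<in> J \<Longrightarrow> w \<in> carrier R" using ideal.Icarr[OF J_ideal] by blast
lemma u_carr: "u \<in> carrier R" using u_in J_carr by blast
lemma mpow_carr: "w \<in> mpow n \<Longrightarrow> w \<in> carrier R" using mpow_carrier by blast

text \<open>The submodule \<open>V\<close> of \<open>G\<close> that \<open>persistent\<close> describes, pulled back to \<open>\<R>\<close>: the degree-\<open>i\<close>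
  piece of \<open>V\<close> comes from \<open>\<mm>\<^bsup>i-b\<^esup>J\<close> and is set to zero below degree \<open>N + b\<close>.\<close>

definition W :: "nat \<Rightarrow> 'a set"
  where "W i = (if i < N + b then mpow (Suc i) else (mpow (i - b) \<cdot> J) <+>\<^bsub>R\<^esub> mpow (Suc i))"

lemma MJ_ideal: "ideal (mpow i \<cdot> J) R" by (rule R.ideal_prod_is_ideal[OF mpow_ideal J_ideal])

lemma W_ideal: "ideal (W i) R"
  unfolding W_def using mpow_ideal R.add_ideals[OF MJ_ideal mpow_ideal] by simp

lemma mpow_Suc_subset_W: "mpow (Suc i) \<subseteq> W i"
  unfolding W_def using R.subset_add_ideals(2)[OF MJ_ideal mpow_ideal] by simp

lemma W_subset_mpow: "W i \<subseteq> mpow i"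
proof (cases "i < N + b")
  case True
  then show ?thesis unfolding W_def using mpow_antimono by simp
next
  case False
  have "mpow (i - b) \<cdot> J \<subseteq> mpow i"
  proof
    fix v assume v: "v \<in> mpow (i - b) \<cdot> J"
    have "N \<le> i - b" using False by linarith
    then obtain w where w: "w \<in> J" "v \<ominus> x [^] (i - b) \<otimes> w \<in> mpow (i - b + b + 1)"
      using reduce[OF _ v] by blast
    have c: "v \<in> carrier R" "x [^] (i - b) \<otimes> w \<in> carrier R"
      using ideal.Icarr[OF MJ_ideal v] x_carr J_carr[OF w(1)] by auto
    have "v = (v \<ominus> x [^] (i - b) \<otimes> w) \<oplus> x [^] (i - b) \<otimes> w" using c by algebra
    moreover have "v \<ominus> x [^] (i - b) \<otimes> w \<in> mpow i"
      using w(2) False mpow_antimono[of i "i - b + b + 1"] by auto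
    moreover have "x [^] (i - b) \<otimes> w \<in> mpow i" using shift[of "i - b" w] w(1) False by simp
    ultimately show "v \<in> mpow i" using mpow_add_mem by metis
  qed
  then show ?thesis unfolding W_def using False
    by (simp add: R.add_ideals_least[OF mpow_ideal] mpow_antimono)
qed

lemma W_mult:
  assumes a: "a \<in> mpow i" and c: "c \<in> W j" shows "a \<otimes> c \<in> W (i + j)"
proof (cases "j < N + b")
  case True
  then have "a \<otimes> c \<in> mpow (Suc (i + j))" using mpow_mult[OF a, of c "Suc j"] c by (simp add: W_def)
  then show ?thesis using mpow_Suc_subset_W by blast
next
  case False
  then obtain v z where vz: "v \<in> mpow (j - b) \<cdot> J" "z \<in> mpow (Suc j)" "c = v \<oplus> z"
    using c by (auto simp: W_def elim!: R.add_idealsE)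
  have "a \<otimes> c = a \<otimes> v \<oplus> a \<otimes> z"
    using vz(3) mpow_carr[OF a] ideal.Icarr[OF MJ_ideal vz(1)] mpow_carr[OF vz(2)] by (simp add: R.r_distr)
  moreover have "a \<otimes> v \<in> mpow (i + j - b) \<cdot> J"
    using mpow_prod_mult[OF a J_ideal vz(1)] False by simp
  moreover have "a \<otimes> z \<in> mpow (Suc (i + j))" using mpow_mult[OF a vz(2)] by simp
  ultimately show ?thesis using False by (auto simp: W_def intro: R.add_idealsI)
qed

lemma W_graded_ideal: "ideal (graded W) S"
  by (rule graded_ideal[OF W_ideal W_subset_mpow W_mult])

text \<open>An element of \<open>V\<close> of degree \<open>j + b\<close> is written as the coefficient of \<open>t\<^sup>j\<close> in \<open>R[t]\<close>, so it
  matters modulo \<open>\<mm>\<^bsup>j+b+1\<^esup>\<close>. The resulting set is an \<open>\<R>\<close>-submodule of \<open>R[t]\<close>.\<close>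

definition Z :: "(nat \<Rightarrow> 'a) set" where "Z = graded (\<lambda>j. mpow (j + b + 1))"

lemma Z_mult: "r \<in> carrier S \<Longrightarrow> f \<in> Z \<Longrightarrow> r \<otimes>\<^bsub>P\<^esub> f \<in> Z"
  unfolding Z_def S_carrier
proof (rule graded_mult[OF _ _ mpow_ideal])
  fix i j a c assume "a \<in> mpow i" "c \<in> mpow (j + b + 1)"
  then show "a \<otimes> c \<in> mpow (i + j + b + 1)" using mpow_mult[of a i c "j + b + 1"] by (simp add: add.assoc)
qed

lemma Z_add: "f \<in> Z \<Longrightarrow> g \<in> Z \<Longrightarrow> f \<oplus>\<^bsub>P\<^esub> g \<in> Z"
  unfolding Z_def by (rule graded_add[OF mpow_ideal])

text \<open>Let \<open>p\<close> have degree \<open>n\<close>. Then \<open>pu\<close> gives an element of \<open>V\<close> of degree \<open>n + b\<close> if \<open>n\<close> is large, and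
  \<open>q\<close> represents the unique element of \<open>V\<close> with \<open>x\<^bsup>D+b\<^esup>q = pu\<close>. It lies in degree \<open>n - D\<close>. So \<open>p \<mapsto> q\<close> is a
  homomorphism to \<open>G\<close> of degree \<open>-D\<close>, namely \<open>p \<mapsto> x\<^bsup>-(D+b)\<^esup>pu\<close>. The condition is written as one
  congruence in \<open>R[t]\<close>, so that linearity in \<open>p\<close> and \<open>q\<close> is immediate from ring identities.\<close>

definition divided :: "nat \<Rightarrow> (nat \<Rightarrow> 'a) \<Rightarrow> (nat \<Rightarrow> 'a) \<Rightarrow> bool"
  where "divided D p q \<longleftrightarrow> p \<in> carrier S \<and> q \<in> graded W \<and>
    (monom P (x [^] (D + b)) D \<otimes>\<^bsub>P\<^esub> q) \<ominus>\<^bsub>P\<^esub> (monom P u 0 \<otimes>\<^bsub>P\<^esub> p) \<in> Z"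

lemma divided_carrier: "divided D p q \<Longrightarrow> p \<in> carrier S" "divided D p q \<Longrightarrow> q \<in> carrier S"
  using ideal.Icarr[OF W_graded_ideal] by (auto simp: divided_def)

lemma monoms_closed: "monom P (x [^] (D + b)) D \<in> carrier P" "monom P u 0 \<in> carrier P"
  using x_carr u_carr by auto

lemma divided_add:
  assumes "divided D p q" "divided D p' q'" shows "divided D (p \<oplus>\<^bsub>P\<^esub> p') (q \<oplus>\<^bsub>P\<^esub> q')"
proof -
  note c = divided_carrier[OF assms(1), THEN S_carrier_P] divided_carrier[OF assms(2), THEN S_carrier_P]
  let ?X = "monom P (x [^] (D + b)) D" and ?U = "monom P u 0"
  have "(?X \<otimes>\<^bsub>P\<^esub> (q \<oplus>\<^bsub>P\<^esub> q')) \<ominus>\<^bsub>P\<^esub> (?U \<otimes>\<^bsub>P\<^esub> (p \<oplus>\<^bsub>P\<^esub> p'))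
    = ((?X \<otimes>\<^bsub>P\<^esub> q) \<ominus>\<^bsub>P\<^esub> (?U \<otimes>\<^bsub>P\<^esub> p)) \<oplus>\<^bsub>P\<^esub> ((?X \<otimes>\<^bsub>P\<^esub> q') \<ominus>\<^bsub>P\<^esub> (?U \<otimes>\<^bsub>P\<^esub> p'))"
    using c monoms_closed(1)[of D] monoms_closed(2) by algebra
  then show ?thesis using assms Z_add graded_add[OF W_ideal] S.a_closed[of p p']
    unfolding divided_def by simp
qed

lemma divided_smult:
  assumes "divided D p q" and r: "r \<in> carrier S" shows "divided D (r \<otimes>\<^bsub>P\<^esub> p) (r \<otimes>\<^bsub>P\<^esub> q)"
proof -
  note c = divided_carrier[OF assms(1), THEN S_carrier_P] S_carrier_P[OF r]
  let ?X = "monom P (x [^] (D + b)) D" and ?U = "monom P u 0"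
  have "(?X \<otimes>\<^bsub>P\<^esub> (r \<otimes>\<^bsub>P\<^esub> q)) \<ominus>\<^bsub>P\<^esub> (?U \<otimes>\<^bsub>P\<^esub> (r \<otimes>\<^bsub>P\<^esub> p))
    = r \<otimes>\<^bsub>P\<^esub> ((?X \<otimes>\<^bsub>P\<^esub> q) \<ominus>\<^bsub>P\<^esub> (?U \<otimes>\<^bsub>P\<^esub> p))"
    using c monoms_closed(1)[of D] monoms_closed(2) by algebra
  then show ?thesis using assms Z_mult[OF r] ideal.I_l_closed[OF W_graded_ideal _ r, of q] S.m_closed[OF r, of p]
    unfolding divided_def by simp
qed

lemma coeff_difference:
  assumes "p \<in> carrier P" "q \<in> carrier P"
  shows "coeff P ((monom P (x [^] (D + b)) D \<otimes>\<^bsub>P\<^esub> q) \<ominus>\<^bsub>P\<^esub> (monom P u 0 \<otimes>\<^bsub>P\<^esub> p)) j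
    = (if j < D then \<zero> else x [^] (D + b) \<otimes> coeff P q (j - D)) \<ominus> u \<otimes> coeff P p j"
  using assms monoms_closed(1)[of D] monoms_closed(2) x_carr u_carr
  by (simp add: a_minus_def[of P] a_minus_def[of R] coeff_monom_times del: coeff_mult)

lemma divided_coeff:
  assumes "divided D p q"
  shows "x [^] (D + b) \<otimes> coeff P q c \<ominus> u \<otimes> coeff P p (c + D) \<in> mpow (c + D + b + 1)"
proof -
  note c = divided_carrier[OF assms(1), THEN S_carrier_P]
  have "(monom P (x [^] (D + b)) D \<otimes>\<^bsub>P\<^esub> q) \<ominus>\<^bsub>P\<^esub> (monom P u 0 \<otimes>\<^bsub>P\<^esub> p) \<in> Z"
    using assms by (simp add: divided_def)
  from gradedD(2)[OF this[unfolded Z_def], of "c + D"] show ?thesis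
    unfolding coeff_difference[OF c] by simp
qed

text \<open>The element \<open>q\<close> is determined by \<open>p\<close> degree by degree, because the powers of \<open>x\<close> are injective on
  \<open>V\<close>. This gives both uniqueness of \<open>q\<close> modulo \<open>\<mm>\<R>\<close> and the bound on the degree.\<close>

lemma divided_vanish:
  assumes rel: "divided D p q" and z: "coeff P p (c + D) = \<zero>"
  shows "coeff P q c \<in> mpow (Suc c)"
proof -
  note carr = divided_carrier[OF rel, THEN S_carrier_P]
  have qW: "coeff P q c \<in> W c" using rel by (auto simp: divided_def gradedD)
  show ?thesis
  proof (cases "c < N + b")
    case True
    then show ?thesis using qW by (simp add: W_def)
  next
    case False
    then obtain v z where vz: "v \<in> mpow (c - b) \<cdot> J" "z \<in> mpow (Suc c)" "coeff P q c = v \<oplus> z"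
      using qW by (auto simp: W_def elim!: R.add_idealsE)
    obtain w where w: "w \<in> J" "v \<ominus> x [^] (c - b) \<otimes> w \<in> mpow (c - b + b + 1)"
      using reduce[OF _ vz(1)] False by fastforce
    define y where "y = (v \<ominus> x [^] (c - b) \<otimes> w) \<oplus> z"
    have y: "y \<in> mpow (Suc c)" unfolding y_def using w(2) vz(2) False by (intro mpow_add_mem) simp_all
    have cc: "v \<in> carrier R" "z \<in> carrier R" "w \<in> carrier R" "y \<in> carrier R" "x [^] (c - b) \<in> carrier R"
      "x [^] (D + b) \<in> carrier R"
      using ideal.Icarr[OF MJ_ideal vz(1)] mpow_carr[OF vz(2)] J_carr[OF w(1)] mpow_carr[OF y] x_carr by auto
    have eq: "coeff P q c = x [^] (c - b) \<otimes> w \<oplus> y" unfolding vz(3) y_def using cc by algebra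
    have "x [^] (D + b) \<otimes> x [^] (c - b) = x [^] (c + D)"
      using False by (simp add: R.nat_pow_mult x_carr add.commute)
    then have "x [^] (c + D) \<otimes> w = (x [^] (D + b) \<otimes> x [^] (c - b)) \<otimes> w" by simp
    also have "\<dots> = x [^] (D + b) \<otimes> coeff P q c \<ominus> x [^] (D + b) \<otimes> y"
      unfolding eq using cc by algebra
    finally have "x [^] (c + D) \<otimes> w = x [^] (D + b) \<otimes> coeff P q c \<ominus> x [^] (D + b) \<otimes> y" .
    moreover have "x [^] (D + b) \<otimes> coeff P q c \<in> mpow (c + D + b + 1)"
      using divided_coeff[OF rel, of c] z u_carr x_carr carr by (simp add: a_minus_def)
    moreover have "x [^] (D + b) \<otimes> y \<in> mpow (c + D + b + 1)"
      using mpow_mult[OF pow_mpow[OF x_in] y, of "D + b"] by (simp add: add_ac)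
    ultimately have "x [^] (c + D) \<otimes> w \<in> mpow (c + D + b + 1)"
      using R.ideal_minus_closed[OF mpow_ideal] by metis
    then have "x [^] (c - b) \<otimes> w \<in> mpow (c - b + b + 1)" using cancel[of "c - b" w] False w(1) by simp
    then have "x [^] (c - b) \<otimes> w \<in> mpow (Suc c)" using False by simp
    then show ?thesis unfolding eq using y by (rule mpow_add_mem)
  qed
qed

lemma divided_unique:
  assumes "divided D p q" "divided D p q'" shows "graded_class q = graded_class q'"
proof -
  note c = divided_carrier[OF assms(1)] divided_carrier[OF assms(2)]
  have m1: "\<ominus>\<^bsub>S\<^esub> \<one>\<^bsub>S\<^esub> \<in> carrier S" by (rule S.a_inv_closed[OF S.one_closed])
  have neg: "r \<oplus>\<^bsub>P\<^esub> ((\<ominus>\<^bsub>S\<^esub> \<one>\<^bsub>S\<^esub>) \<otimes>\<^bsub>P\<^esub> r) = \<zero>\<^bsub>P\<^esub>" if "r \<in> carrier S" for r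
    using S.l_minus[OF S.one_closed that] S.l_one[OF that] S.r_neg[OF that] by (simp only: S_simps)
  let ?n = "q \<oplus>\<^bsub>P\<^esub> ((\<ominus>\<^bsub>S\<^esub> \<one>\<^bsub>S\<^esub>) \<otimes>\<^bsub>P\<^esub> q')"
  have rel: "divided D \<zero>\<^bsub>P\<^esub> ?n"
    using divided_add[OF assms(1) divided_smult[OF assms(2) m1]] neg[OF c(1)] by simp
  have "?n \<in> mS" unfolding rees_extension_graded
    by (rule gradedI[OF S_carrier_P[OF divided_carrier(2)[OF rel]] divided_vanish[OF rel]]) simp
  moreover have "?n \<oplus>\<^bsub>P\<^esub> q' = q"
  proof -
    have "(\<ominus>\<^bsub>S\<^esub> \<one>\<^bsub>S\<^esub>) \<otimes>\<^bsub>P\<^esub> q' \<in> carrier S" using S.m_closed[OF m1 c(4)] by simp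
    then have "?n \<oplus>\<^bsub>P\<^esub> q' = q \<oplus>\<^bsub>P\<^esub> (q' \<oplus>\<^bsub>P\<^esub> ((\<ominus>\<^bsub>S\<^esub> \<one>\<^bsub>S\<^esub>) \<otimes>\<^bsub>P\<^esub> q'))"
      using c(2,4)[THEN S_carrier_P] S_carrier_P by (simp add: P.a_ac)
    then show ?thesis unfolding neg[OF c(4)] using c(2)[THEN S_carrier_P] by simp
  qed
  ultimately show ?thesis using graded_class_eqI[OF c(4), of ?n] by simp
qed

text \<open>In degrees where \<open>V\<close> is available, \<open>pu\<close> is \<open>x\<^bsup>i+D\<^esup>w\<close> with \<open>w \<in> J\<close>, and \<open>x\<^bsup>i-b\<^esup>w\<close> is the quotient.
  In lower degrees \<open>q = 0\<close> is correct, because the coefficients of \<open>p\<close> lie in a power of \<open>\<mm>\<close> high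
  enough to make \<open>pu\<close> vanish; this determines the exponent \<open>N + 2b + D + 1\<close>.\<close>

lemma divided_exists:
  assumes p: "p \<in> truncated (N + 2 * b + D + 1)" shows "\<exists>q. divided D p q"
proof -
  let ?k = "N + 2 * b + D + 1"
  have pS: "p \<in> carrier S" by (rule ideal.Icarr[OF truncated_ideal p])
  have pP: "p \<in> carrier P" by (rule S_carrier_P[OF pS])
  have pc: "coeff P p i \<in> mpow (max i ?k)" for i using gradedD(2)[OF p[unfolded truncated_def]] .
  have pcar: "coeff P p i \<in> carrier R" for i using pP by simp
  have "\<exists>w\<in>J. coeff P p (i + D) \<otimes> u \<ominus> x [^] (i + D) \<otimes> w \<in> mpow (i + D + b + 1)" if "N + b \<le> i" for i
  proof (rule reduce)
    show "N \<le> i + D" using that by simp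
    have "coeff P p (i + D) \<in> mpow (i + D)" using pc[of "i + D"] mpow_antimono[of "i + D" "max (i + D) ?k"] by auto
    then show "coeff P p (i + D) \<otimes> u \<in> mpow (i + D) \<cdot> J" by (rule ideal_prod.prod[OF _ u_in])
  qed
  then obtain w where w: "\<And>i. N + b \<le> i \<Longrightarrow> w i \<in> J"
    "\<And>i. N + b \<le> i \<Longrightarrow> coeff P p (i + D) \<otimes> u \<ominus> x [^] (i + D) \<otimes> w i \<in> mpow (i + D + b + 1)"
    by metis
  define q where "q i = (if i < N + b \<or> coeff P p (i + D) = \<zero> then \<zero> else x [^] (i - b) \<otimes> w i)" for i
  have qW: "q i \<in> W i" for i
  proof (cases "i < N + b \<or> coeff P p (i + D) = \<zero>")
    case True
    then show ?thesis using R.ideal_zero_closed[OF W_ideal] by (auto simp: q_def)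
  next
    case False
    then have "x [^] (i - b) \<otimes> w i \<in> mpow (i - b) \<cdot> J" using w(1)[of i] pow_mpow[OF x_in] by (auto intro: ideal_prod.prod)
    then show ?thesis using False R.subset_add_ideals(1)[OF MJ_ideal mpow_ideal, of "i - b" "Suc i"]
      by (auto simp: q_def W_def)
  qed
  have qcar: "q i \<in> carrier R" for i using ideal.Icarr[OF W_ideal qW] .
  obtain n where n: "\<And>m. n < m \<Longrightarrow> coeff P p m = \<zero>"
    using R.bound_upD[of p] pP by (auto simp: P_def UP_def bound_def)
  have "q \<in> up R"
  proof (rule mem_upI[OF qcar])
    have "bound \<zero> n q" by (rule bound.intro) (auto simp: q_def n)
    then show "\<exists>n. bound \<zero> n q" by blast
  qed
  then have qP: "q \<in> carrier P" and coeff_q: "coeff P q = q" by (auto simp: P_def UP_def)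
  have "(monom P (x [^] (D + b)) D \<otimes>\<^bsub>P\<^esub> q) \<ominus>\<^bsub>P\<^esub> (monom P u 0 \<otimes>\<^bsub>P\<^esub> p) \<in> Z"
    unfolding Z_def
  proof (rule gradedI)
    show "(monom P (x [^] (D + b)) D \<otimes>\<^bsub>P\<^esub> q) \<ominus>\<^bsub>P\<^esub> (monom P u 0 \<otimes>\<^bsub>P\<^esub> p) \<in> carrier P"
      using monoms_closed(1)[of D] monoms_closed(2) qP pP by simp
    fix j
    have up: "u \<otimes> coeff P p j \<in> mpow (j + b + 1)" if "j + b + 1 \<le> ?k"
      using pc[of j] mpow_antimono[of "j + b + 1" "max j ?k"] that ideal.I_l_closed[OF mpow_ideal _ u_carr] by auto
    have "(if j < D then \<zero> else x [^] (D + b) \<otimes> q (j - D)) \<ominus> u \<otimes> coeff P p j \<in> mpow (j + b + 1)"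
    proof (cases "j < D \<or> j - D < N + b")
      case True
      then have "(if j < D then \<zero> else x [^] (D + b) \<otimes> q (j - D)) = \<zero>" using x_carr by (auto simp: q_def)
      moreover have "u \<otimes> coeff P p j \<in> mpow (j + b + 1)" by (rule up) (use True in auto)
      ultimately show ?thesis using R.ideal_minus_closed[OF mpow_ideal R.ideal_zero_closed[OF mpow_ideal]] by simp
    next
      case False
      define i where "i = j - D"
      have j: "j = i + D" and i: "N + b \<le> i" using False by (auto simp: i_def)
      have c: "w i \<in> carrier R" "coeff P p j \<in> carrier R" using J_carr[OF w(1)[OF i]] pcar by auto
      show ?thesis
      proof (cases "coeff P p j = \<zero>")
        case True
        then show ?thesis using False x_carr u_carr R.ideal_zero_closed[OF mpow_ideal]
          by (simp add: q_def a_minus_def j)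
      next
        case nz: False
        have "x [^] (D + b) \<otimes> x [^] (i - b) = x [^] j"
          using i by (simp add: R.nat_pow_mult x_carr j add.commute)
        then have "x [^] (D + b) \<otimes> q i = x [^] j \<otimes> w i"
          using nz i c x_carr by (simp add: q_def j R.m_assoc[symmetric])
        moreover have "x [^] j \<otimes> w i \<ominus> u \<otimes> coeff P p j
            = \<zero> \<ominus> (coeff P p j \<otimes> u \<ominus> x [^] j \<otimes> w i)"
          using c u_carr R.nat_pow_closed[OF x_carr, of j] by algebra
        moreover have "coeff P p j \<otimes> u \<ominus> x [^] j \<otimes> w i \<in> mpow (j + b + 1)" using w(2)[OF i] j by simp
        ultimately show ?thesis
          using R.ideal_minus_closed[OF mpow_ideal R.ideal_zero_closed[OF mpow_ideal]] False i_def by simp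
      qed
    qed
    then show "coeff P ((monom P (x [^] (D + b)) D \<otimes>\<^bsub>P\<^esub> q) \<ominus>\<^bsub>P\<^esub> (monom P u 0 \<otimes>\<^bsub>P\<^esub> p)) j \<in> mpow (j + b + 1)"
      unfolding coeff_difference[OF pP qP] coeff_q .
  qed
  then show ?thesis unfolding divided_def using pS qP qW coeff_q by (auto intro!: gradedI)
qed

text \<open>Dividing \<open>x\<^sup>iu\<close> by a power of \<open>x\<close> gives a nonzero class for every \<open>i \<ge> D\<close>. So the homomorphism
  vanishes on no power of \<open>\<MM>\<close>.\<close>

lemma divided_survive:
  assumes "divided D (monom P (x [^] i) i) q" "D \<le> i"
  shows "coeff P q (i - D) \<notin> mpow (Suc (i - D))"
proof
  assume "coeff P q (i - D) \<in> mpow (Suc (i - D))"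
  then have 1: "x [^] (D + b) \<otimes> coeff P q (i - D) \<in> mpow (i + b + 1)"
    using mpow_mult[OF pow_mpow[OF x_in], of _ "Suc (i - D)" "D + b"] assms(2) by (simp add: add_ac)
  have xi: "x [^] i \<in> carrier R" using x_carr by simp
  have 2: "x [^] (D + b) \<otimes> coeff P q (i - D) \<ominus> u \<otimes> x [^] i \<in> mpow (i + b + 1)"
    using divided_coeff[OF assms(1), of "i - D"] assms(2) xi by simp
  have "x [^] i \<otimes> u = x [^] (D + b) \<otimes> coeff P q (i - D) \<ominus> (x [^] (D + b) \<otimes> coeff P q (i - D) \<ominus> u \<otimes> x [^] i)"
    using xi u_carr mpow_carr[OF 1] by algebra
  then have "x [^] i \<otimes> u \<in> mpow (i + b + 1)" using R.ideal_minus_closed[OF mpow_ideal 1 2] by simp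
  then show False using survive by blast
qed

text \<open>The homomorphism of degree \<open>-D\<close> on a power of \<open>\<MM>\<close> becomes multiplication by an element \<open>e\<close> of
  the first injective module of a resolution of \<open>G\<close>. The image of \<open>e\<close> in the next module will be the
  cocycle for a class of degree \<open>-D\<close> in \<open>H\<^sup>1\<close>.\<close>

lemma extension_exists:
  assumes inj: "injective_module S E" and \<epsilon>: "\<epsilon> \<in> module_hom S (assoc_graded R \<mm>) E"
  obtains e where "e \<in> carrier E"
    "\<And>p q. p \<in> truncated (N + 2 * b + D + 1) \<Longrightarrow> divided D p q \<Longrightarrow> \<epsilon> (graded_class q) = p \<odot>\<^bsub>E\<^esub> e"
proof -
  let ?H = "truncated (N + 2 * b + D + 1)"
  define \<phi> where "\<phi> p = \<epsilon> (graded_class (SOME q. divided D p q))" for p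
  have \<phi>: "\<phi> p = \<epsilon> (graded_class q)" if "divided D p q" for p q
    unfolding \<phi>_def using divided_unique[OF someI[of "divided D p", OF that] that] by simp
  have hom: "\<And>X. X \<in> carrier (assoc_graded R \<mm>) \<Longrightarrow> \<epsilon> X \<in> carrier E"
    "\<And>X Y. X \<in> carrier (assoc_graded R \<mm>) \<Longrightarrow> Y \<in> carrier (assoc_graded R \<mm>) \<Longrightarrow>
      \<epsilon> (X \<oplus>\<^bsub>assoc_graded R \<mm>\<^esub> Y) = \<epsilon> X \<oplus>\<^bsub>E\<^esub> \<epsilon> Y"
    "\<And>a X. a \<in> carrier S \<Longrightarrow> X \<in> carrier (assoc_graded R \<mm>) \<Longrightarrow> \<epsilon> (a \<odot>\<^bsub>assoc_graded R \<mm>\<^esub> X) = a \<odot>\<^bsub>E\<^esub> \<epsilon> X"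
    using \<epsilon> by (auto simp: module_hom_def)
  obtain e where e: "e \<in> carrier E" "\<And>p. p \<in> ?H \<Longrightarrow> \<phi> p = p \<odot>\<^bsub>E\<^esub> e"
  proof (rule S.injective_module_extend[OF inj truncated_ideal[of "N + 2 * b + D + 1"], of \<phi>])
    fix p assume "p \<in> ?H"
    then obtain q where q: "divided D p q" using divided_exists by blast
    then show "\<phi> p \<in> carrier E" using \<phi>[OF q] hom(1) graded_class_closed divided_carrier(2) by simp
    show "\<phi> (a \<otimes>\<^bsub>S\<^esub> p) = a \<odot>\<^bsub>E\<^esub> \<phi> p" if a: "a \<in> carrier S" for a
      using \<phi>[OF divided_smult[OF q a]] \<phi>[OF q] graded_class_smult[OF a divided_carrier(2)[OF q]]
        hom(3)[OF a graded_class_closed[OF divided_carrier(2)[OF q]]] by simp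
    fix p' assume "p' \<in> ?H"
    then obtain q' where q': "divided D p' q'" using divided_exists by blast
    show "\<phi> (p \<oplus>\<^bsub>S\<^esub> p') = \<phi> p \<oplus>\<^bsub>E\<^esub> \<phi> p'"
      using \<phi>[OF divided_add[OF q q']] \<phi>[OF q] \<phi>[OF q'] graded_class_add[OF divided_carrier(2)[OF q] divided_carrier(2)[OF q']]
        hom(2)[OF graded_class_closed[OF divided_carrier(2)[OF q]] graded_class_closed[OF divided_carrier(2)[OF q']]] by simp
  qed (rule that)
  show ?thesis using that[OF e(1)] e(2) \<phi> by metis
qed

end

section \<open>Infinite length of the first local cohomology\<close>

lemma module_homD:
  assumes "f \<in> module_hom R M N"
  shows "x \<in> carrier M \<Longrightarrow> f x \<in> carrier N"
    "x \<in> carrier M \<Longrightarrow> y \<in> carrier M \<Longrightarrow> f (x \<oplus>\<^bsub>M\<^esub> y) = f x \<oplus>\<^bsub>N\<^esub> f y"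
    "a \<in> carrier R \<Longrightarrow> x \<in> carrier M \<Longrightarrow> f (a \<odot>\<^bsub>M\<^esub> x) = a \<odot>\<^bsub>N\<^esub> f x"
  using assms by (auto simp: module_hom_def)

lemma module_hom_zero:
  assumes f: "f \<in> module_hom R M N" and M: "module R M" and N: "module R N"
  shows "f \<zero>\<^bsub>M\<^esub> = \<zero>\<^bsub>N\<^esub>"
proof -
  interpret M: module R M by fact
  interpret N: module R N by fact
  have "f (\<zero>\<^bsub>R\<^esub> \<odot>\<^bsub>M\<^esub> \<zero>\<^bsub>M\<^esub>) = \<zero>\<^bsub>R\<^esub> \<odot>\<^bsub>N\<^esub> f \<zero>\<^bsub>M\<^esub>" by (rule module_homD(3)[OF f]) auto
  then show ?thesis using module_homD(1)[OF f, of "\<zero>\<^bsub>M\<^esub>"] by simp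
qed

lemma hom_image_submodule:
  assumes f: "f \<in> module_hom R M N" and M: "module R M" and N: "module R N" and L: "submodule L R M"
  shows "submodule (f ` L) R N"
proof -
  interpret M: module R M by fact
  interpret N: module R N by fact
  note E = M.submoduleE[OF L]
  have z: "\<zero>\<^bsub>M\<^esub> \<in> L" using subgroup.one_closed[OF submodule.axioms(1)[OF L]] by simp
  show ?thesis
  proof (rule N.submoduleI_smult)
    show "f ` L \<subseteq> carrier N" using E(1) module_homD(1)[OF f] by blast
    show "\<zero>\<^bsub>N\<^esub> \<in> f ` L" using z module_hom_zero[OF f M N] by (metis imageI)
  next
    fix y y' assume "y \<in> f ` L" "y' \<in> f ` L"
    then obtain x x' where x: "x \<in> L" "x' \<in> L" "y = f x" "y' = f x'" by blast
    then have "y \<oplus>\<^bsub>N\<^esub> y' = f (x \<oplus>\<^bsub>M\<^esub> x')" using module_homD(2)[OF f] E(1) by (simp add: subsetD)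
    then show "y \<oplus>\<^bsub>N\<^esub> y' \<in> f ` L" using E(5)[OF x(1,2)] by simp
  next
    fix a y assume a: "a \<in> carrier R" and "y \<in> f ` L"
    then obtain x where x: "x \<in> L" "y = f x" by blast
    then have "a \<odot>\<^bsub>N\<^esub> y = f (a \<odot>\<^bsub>M\<^esub> x)" using module_homD(3)[OF f a] E(1) by (simp add: subsetD)
    then show "a \<odot>\<^bsub>N\<^esub> y \<in> f ` L" using E(4)[OF a x(1)] by simp
  qed
qed

lemma submodule_restrict:
  assumes M: "module R M" and C: "submodule C R M" and L: "submodule L R M" and "L \<subseteq> C"
  shows "submodule L R (M\<lparr>carrier := C\<rparr>)"
proof -
  interpret M: module R M by fact
  interpret C: module R "M\<lparr>carrier := C\<rparr>" by (rule submodule.submodule_is_module[OF C M])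
  have "\<zero>\<^bsub>M\<^esub> \<in> L" using subgroup.one_closed[OF submodule.axioms(1)[OF L]] by simp
  then show ?thesis using M.submoduleE[OF L] \<open>L \<subseteq> C\<close> by (intro C.submoduleI_smult) auto
qed

lemma (in cring) torsion_submodule:
  assumes I: "ideal I R" and N: "module R N" shows "submodule (torsion R I N) R N"
proof -
  interpret N: module R N by fact
  note Ic = ideal.Icarr[OF ideal_power_ideal[OF I]]
  show ?thesis
  proof (rule N.submoduleI_smult)
    show "\<zero>\<^bsub>N\<^esub> \<in> torsion R I N" using Ic by (auto simp: torsion_def)
  next
    fix x y assume "x \<in> torsion R I N" "y \<in> torsion R I N"
    then obtain n k where x: "x \<in> carrier N" "\<And>a. a \<in> ideal_power R I n \<Longrightarrow> a \<odot>\<^bsub>N\<^esub> x = \<zero>\<^bsub>N\<^esub>"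
      and y: "y \<in> carrier N" "\<And>a. a \<in> ideal_power R I k \<Longrightarrow> a \<odot>\<^bsub>N\<^esub> y = \<zero>\<^bsub>N\<^esub>" by (auto simp: torsion_def)
    have "a \<odot>\<^bsub>N\<^esub> (x \<oplus>\<^bsub>N\<^esub> y) = \<zero>\<^bsub>N\<^esub>" if "a \<in> ideal_power R I (max n k)" for a
      using that x y Ic[OF that] ideal_power_antimono[OF I, of n "max n k"]
        ideal_power_antimono[OF I, of k "max n k"] by (simp add: N.smult_r_distr subset_iff)
    then show "x \<oplus>\<^bsub>N\<^esub> y \<in> torsion R I N" using x(1) y(1) by (auto simp: torsion_def)
  next
    fix r x assume r: "r \<in> carrier R" and "x \<in> torsion R I N"
    then obtain n where x: "x \<in> carrier N" "\<And>a. a \<in> ideal_power R I n \<Longrightarrow> a \<odot>\<^bsub>N\<^esub> x = \<zero>\<^bsub>N\<^esub>"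
      by (auto simp: torsion_def)
    have "a \<odot>\<^bsub>N\<^esub> (r \<odot>\<^bsub>N\<^esub> x) = \<zero>\<^bsub>N\<^esub>" if a: "a \<in> ideal_power R I n" for a
    proof -
      have "a \<odot>\<^bsub>N\<^esub> (r \<odot>\<^bsub>N\<^esub> x) = r \<odot>\<^bsub>N\<^esub> (a \<odot>\<^bsub>N\<^esub> x)"
        using r x(1) Ic[OF a] by (metis N.smult_assoc1 m_comm)
      then show ?thesis using x(2)[OF a] r by simp
    qed
    then show "r \<odot>\<^bsub>N\<^esub> x \<in> torsion R I N" using r x(1) by (auto simp: torsion_def)
  qed (auto simp: torsion_def)
qed

lemma (in cring) torsion_cocycles_submodule:
  assumes I: "ideal I R" and res: "injective_resolution R N \<epsilon> E d"
  shows "submodule (torsion_cocycles R I E d i) R (E i)"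
proof -
  have E: "module R (E i)" "module R (E (Suc i))" and d: "d i \<in> module_hom R (E i) (E (Suc i))"
    using res by (auto simp: injective_resolution_def injective_module_def)
  interpret E: module R "E i" by (rule E)
  interpret E': module R "E (Suc i)" by (rule E)
  note T = E.submoduleE[OF torsion_submodule[OF I E(1)]]
  have z: "\<zero>\<^bsub>E i\<^esub> \<in> torsion R I (E i)"
    using subgroup.one_closed[OF submodule.axioms(1)[OF torsion_submodule[OF I E(1)]]] by simp
  show ?thesis
    by (rule E.submoduleI_smult)
      (use T z module_hom_zero[OF d E] module_homD[OF d] in \<open>auto simp: torsion_cocycles_def subset_iff\<close>)
qed

context rees_persistent
begin

text \<open>The injective modules of the resolution carry no grading. An element \<open>e\<close> with \<open>\<MM>\<^sup>Ke \<subseteq> G\<close> still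
  has a degree, read off from the homomorphism \<open>p \<mapsto> pe\<close>, and \<open>degree_ge \<epsilon> E t\<close> consists of those
  \<open>e\<close> for which this homomorphism lowers degrees by at most \<open>t\<close>. It is tested on elements \<open>p\<close>
  without terms below degree \<open>i\<close>.\<close>

definition degree_ge :: "((nat \<Rightarrow> 'a) set \<Rightarrow> 'e) \<Rightarrow> (nat \<Rightarrow> 'a, 'e) module \<Rightarrow> nat \<Rightarrow> 'e set"
  where "degree_ge \<epsilon> E t = {e \<in> carrier E. \<exists>K. \<forall>i. \<forall>p\<in>ideal_power S \<MM> K.
    (\<forall>c<i. coeff P p c = \<zero>) \<longrightarrow>
    (\<exists>q\<in>carrier S. p \<odot>\<^bsub>E\<^esub> e = \<epsilon> (graded_class q) \<and> (\<forall>c. c + t < i \<longrightarrow> coeff P q c \<in> mpow (Suc c)))}"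

lemma degree_geI:
  assumes "e \<in> carrier E"
    "\<And>i p. p \<in> ideal_power S \<MM> K \<Longrightarrow> \<forall>c<i. coeff P p c = \<zero> \<Longrightarrow>
    (\<exists>q\<in>carrier S. p \<odot>\<^bsub>E\<^esub> e = \<epsilon> (graded_class q) \<and> (\<forall>c. c + t < i \<longrightarrow> coeff P q c \<in> mpow (Suc c)))"
  shows "e \<in> degree_ge \<epsilon> E t"
  using assms unfolding degree_ge_def by blast

lemma degree_geE:
  assumes "e \<in> degree_ge \<epsilon> E t"
  obtains K where "e \<in> carrier E"
    "\<And>i p. p \<in> ideal_power S \<MM> K \<Longrightarrow> \<forall>c<i. coeff P p c = \<zero> \<Longrightarrow>
    (\<exists>q\<in>carrier S. p \<odot>\<^bsub>E\<^esub> e = \<epsilon> (graded_class q) \<and> (\<forall>c. c + t < i \<longrightarrow> coeff P q c \<in> mpow (Suc c)))"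
  using assms unfolding degree_ge_def by blast

lemma degree_ge_mono: "s \<le> t \<Longrightarrow> degree_ge \<epsilon> E s \<subseteq> degree_ge \<epsilon> E t"
proof
  fix e assume "s \<le> t" "e \<in> degree_ge \<epsilon> E s"
  then obtain K where K: "e \<in> carrier E"
    "\<And>i p. p \<in> ideal_power S \<MM> K \<Longrightarrow> \<forall>c<i. coeff P p c = \<zero> \<Longrightarrow>
    (\<exists>q\<in>carrier S. p \<odot>\<^bsub>E\<^esub> e = \<epsilon> (graded_class q) \<and> (\<forall>c. c + s < i \<longrightarrow> coeff P q c \<in> mpow (Suc c)))"
    by (elim degree_geE) blast
  show "e \<in> degree_ge \<epsilon> E t"
  proof (rule degree_geI[OF K(1)])
    fix i p assume p: "p \<in> ideal_power S \<MM> K" "\<forall>c<i. coeff P p c = \<zero>"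
    show "\<exists>q\<in>carrier S. p \<odot>\<^bsub>E\<^esub> e = \<epsilon> (graded_class q) \<and> (\<forall>c. c + t < i \<longrightarrow> coeff P q c \<in> mpow (Suc c))"
      using K(2)[OF p] \<open>s \<le> t\<close> by (meson add_le_mono1 le_trans add_left_mono order_le_less_trans)
  qed
qed

lemma MM_power_carrier: "p \<in> ideal_power S \<MM> K \<Longrightarrow> p \<in> carrier S"
  by (rule ideal.Icarr[OF S.ideal_power_ideal[OF MM_ideal]])

lemma mult_low_coeff_zero:
  assumes "p \<in> carrier P" "q \<in> carrier P" "\<forall>c<i. coeff P p c = \<zero>"
  shows "\<forall>c<i. coeff P (p \<otimes>\<^bsub>P\<^esub> q) c = \<zero>"
proof (intro allI impI)
  fix c assume "c < i"
  then have "coeff P (p \<otimes>\<^bsub>P\<^esub> q) c \<in> {\<zero>}"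
    using assms by (intro coeff_mult_mem R.zeroideal) auto
  then show "coeff P (p \<otimes>\<^bsub>P\<^esub> q) c = \<zero>" by simp
qed

lemma degree_ge_submodule:
  assumes E: "module S E" and \<epsilon>: "\<epsilon> \<in> module_hom S (assoc_graded R \<mm>) E"
  shows "submodule (degree_ge \<epsilon> E t) S E"
proof -
  interpret E: module S E by fact
  have G: "module S (assoc_graded R \<mm>)" unfolding assoc_graded_def by (rule G.quotient_is_module)
  have zero: "\<epsilon> (graded_class \<zero>\<^bsub>P\<^esub>) = \<zero>\<^bsub>E\<^esub>"
  proof -
    have "graded_class \<zero>\<^bsub>P\<^esub> = \<zero>\<^bsub>assoc_graded R \<mm>\<^esub>"
      using G.M.a_coset_add_zero[OF G.sub_group.a_subset] by (simp add: graded_class_def assoc_graded_def)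
    then show ?thesis using module_hom_zero[OF \<epsilon> G E] by simp
  qed
  show ?thesis
  proof (rule E.submoduleI_smult)
    show "degree_ge \<epsilon> E t \<subseteq> carrier E" by (auto simp: degree_ge_def)
    show "\<zero>\<^bsub>E\<^esub> \<in> degree_ge \<epsilon> E t"
    proof (rule degree_geI[where K = 0])
      fix i p assume "p \<in> ideal_power S \<MM> 0"
      then have "p \<in> carrier S" by (rule MM_power_carrier)
      then have "p \<odot>\<^bsub>E\<^esub> \<zero>\<^bsub>E\<^esub> = \<epsilon> (graded_class \<zero>\<^bsub>P\<^esub>)" using zero by simp
      then show "\<exists>q\<in>carrier S. p \<odot>\<^bsub>E\<^esub> \<zero>\<^bsub>E\<^esub> = \<epsilon> (graded_class q) \<and> (\<forall>c. c + t < i \<longrightarrow> coeff P q c \<in> mpow (Suc c))"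
        using S.zero_closed R.ideal_zero_closed[OF mpow_ideal] by (intro bexI[of _ "\<zero>\<^bsub>P\<^esub>"]) auto
    qed simp
  next
    fix e e' assume "e \<in> degree_ge \<epsilon> E t" "e' \<in> degree_ge \<epsilon> E t"
    then obtain K K' where e: "e \<in> carrier E"
      "\<And>i p. p \<in> ideal_power S \<MM> K \<Longrightarrow> \<forall>c<i. coeff P p c = \<zero> \<Longrightarrow>
        (\<exists>q\<in>carrier S. p \<odot>\<^bsub>E\<^esub> e = \<epsilon> (graded_class q) \<and> (\<forall>c. c + t < i \<longrightarrow> coeff P q c \<in> mpow (Suc c)))"
      and e': "e' \<in> carrier E"
      "\<And>i p. p \<in> ideal_power S \<MM> K' \<Longrightarrow> \<forall>c<i. coeff P p c = \<zero> \<Longrightarrow>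
        (\<exists>q\<in>carrier S. p \<odot>\<^bsub>E\<^esub> e' = \<epsilon> (graded_class q) \<and> (\<forall>c. c + t < i \<longrightarrow> coeff P q c \<in> mpow (Suc c)))"
      by (elim degree_geE) blast
    show "e \<oplus>\<^bsub>E\<^esub> e' \<in> degree_ge \<epsilon> E t"
    proof (rule degree_geI[where K = "max K K'"])
      fix i p assume p: "p \<in> ideal_power S \<MM> (max K K')" "\<forall>c<i. coeff P p c = \<zero>"
      have "p \<in> ideal_power S \<MM> K" "p \<in> ideal_power S \<MM> K'"
        using p(1) MM_power_antimono[of K "max K K'"] MM_power_antimono[of K' "max K K'"] by auto
      then obtain q q' where q: "q \<in> carrier S" "p \<odot>\<^bsub>E\<^esub> e = \<epsilon> (graded_class q)"
        "\<forall>c. c + t < i \<longrightarrow> coeff P q c \<in> mpow (Suc c)"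
        and q': "q' \<in> carrier S" "p \<odot>\<^bsub>E\<^esub> e' = \<epsilon> (graded_class q')"
        "\<forall>c. c + t < i \<longrightarrow> coeff P q' c \<in> mpow (Suc c)"
        using e(2)[OF _ p(2)] e'(2)[OF _ p(2)] by blast
      have "p \<odot>\<^bsub>E\<^esub> (e \<oplus>\<^bsub>E\<^esub> e') = \<epsilon> (graded_class (q \<oplus>\<^bsub>P\<^esub> q'))"
        using e(1) e'(1) MM_power_carrier[OF p(1)] q q' module_homD(2)[OF \<epsilon> graded_class_closed graded_class_closed, of q q']
        by (simp add: E.smult_r_distr graded_class_add)
      moreover have "q \<oplus>\<^bsub>P\<^esub> q' \<in> carrier S" using S.a_closed[OF q(1) q'(1)] by simp
      ultimately show "\<exists>q\<in>carrier S. p \<odot>\<^bsub>E\<^esub> (e \<oplus>\<^bsub>E\<^esub> e') = \<epsilon> (graded_class q) \<and>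
          (\<forall>c. c + t < i \<longrightarrow> coeff P q c \<in> mpow (Suc c))"
        using q q' S_carrier_P mpow_add_mem by (intro bexI[of _ "q \<oplus>\<^bsub>P\<^esub> q'"]) auto
    qed (use e(1) e'(1) in simp)
  next
    fix r e assume r: "r \<in> carrier S" and "e \<in> degree_ge \<epsilon> E t"
    then obtain K where e: "e \<in> carrier E"
      "\<And>i p. p \<in> ideal_power S \<MM> K \<Longrightarrow> \<forall>c<i. coeff P p c = \<zero> \<Longrightarrow>
        (\<exists>q\<in>carrier S. p \<odot>\<^bsub>E\<^esub> e = \<epsilon> (graded_class q) \<and> (\<forall>c. c + t < i \<longrightarrow> coeff P q c \<in> mpow (Suc c)))"
      by (elim degree_geE) blast
    show "r \<odot>\<^bsub>E\<^esub> e \<in> degree_ge \<epsilon> E t"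
    proof (rule degree_geI[where K = K])
      fix i p assume p: "p \<in> ideal_power S \<MM> K" "\<forall>c<i. coeff P p c = \<zero>"
      note pS = MM_power_carrier[OF p(1)]
      have "p \<otimes>\<^bsub>P\<^esub> r \<in> ideal_power S \<MM> K"
        using ideal.I_r_closed[OF S.ideal_power_ideal[OF MM_ideal] p(1) r] by simp
      moreover have "p \<odot>\<^bsub>E\<^esub> (r \<odot>\<^bsub>E\<^esub> e) = (p \<otimes>\<^bsub>P\<^esub> r) \<odot>\<^bsub>E\<^esub> e"
        using E.smult_assoc1[OF pS r e(1)] by simp
      ultimately show "\<exists>q\<in>carrier S. p \<odot>\<^bsub>E\<^esub> (r \<odot>\<^bsub>E\<^esub> e) = \<epsilon> (graded_class q) \<and>
          (\<forall>c. c + t < i \<longrightarrow> coeff P q c \<in> mpow (Suc c))"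
        using e(2) mult_low_coeff_zero[OF S_carrier_P[OF pS] S_carrier_P[OF r] p(2)] by simp
    qed (use e(1) r in simp)
  qed
qed

text \<open>The images of the submodules \<open>degree_ge \<epsilon> (E 0) t\<close> under \<open>d 0\<close> filter the elements of \<open>H\<^sup>1\<close> by
  degree. All inclusions are strict: the class of the homomorphism of degree \<open>-(t+1)\<close> from
  \<open>extension_exists\<close> does not lie in degrees \<open>\<ge> -t\<close>. Otherwise that homomorphism would agree on a
  power of \<open>\<MM>\<close> with one that lowers degrees by at most \<open>t\<close>, up to multiplication by an
  element of \<open>G\<close>, which does not lower degrees at all. On \<open>x\<^sup>it\<^sup>i\<close> for large \<open>i\<close> this contradicts
  \<open>divided_survive\<close>.\<close>

lemma local_cohomology_length_infinite:
  assumes res: "injective_resolution S (assoc_graded R \<mm>) \<epsilon> E d"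
  shows "module_length S (local_cohomology S \<MM> E d 1) = \<infinity>"
proof -
  have E: "module S (E i)" "injective_module S (E i)" and d: "d i \<in> module_hom S (E i) (E (Suc i))" for i
    using res by (auto simp: injective_resolution_def injective_module_def)
  have \<epsilon>: "\<epsilon> \<in> module_hom S (assoc_graded R \<mm>) (E 0)" "inj_on \<epsilon> (carrier (assoc_graded R \<mm>))"
    "\<epsilon> ` carrier (assoc_graded R \<mm>) = hom_kernel (E 0) (E (Suc 0)) (d 0)"
    "d 0 ` carrier (E 0) = hom_kernel (E (Suc 0)) (E (Suc (Suc 0))) (d (Suc 0))"
    using res by (auto simp: injective_resolution_def)
  interpret E0: module S "E 0" by (rule E)
  interpret E1: module S "E (Suc 0)" by (rule E)
  let ?C = "torsion_cocycles S \<MM> E d (Suc 0)"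
  have C: "submodule ?C S (E (Suc 0))" by (rule S.torsion_cocycles_submodule[OF MM_ideal res])
  have d\<epsilon>: "d 0 (\<epsilon> (graded_class q)) = \<zero>\<^bsub>E (Suc 0)\<^esub>" if "q \<in> carrier S" for q
    using \<epsilon>(3) graded_class_closed[OF that] by blast
  define L where "L t = d 0 ` degree_ge \<epsilon> (E 0) t" for t
  note DG = degree_ge_submodule[OF E(1) \<epsilon>(1)]
  have LC: "L t \<subseteq> ?C" for t
  proof
    fix z assume "z \<in> L t"
    then obtain e where e: "e \<in> degree_ge \<epsilon> (E 0) t" "z = d 0 e" by (auto simp: L_def)
    from e(1) obtain K where K: "e \<in> carrier (E 0)"
      "\<And>i p. p \<in> ideal_power S \<MM> K \<Longrightarrow> \<forall>c<i. coeff P p c = \<zero> \<Longrightarrow>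
        (\<exists>q\<in>carrier S. p \<odot>\<^bsub>E 0\<^esub> e = \<epsilon> (graded_class q) \<and> (\<forall>c. c + t < i \<longrightarrow> coeff P q c \<in> mpow (Suc c)))"
      by (elim degree_geE) blast
    have "p \<odot>\<^bsub>E (Suc 0)\<^esub> z = \<zero>\<^bsub>E (Suc 0)\<^esub>" if p: "p \<in> ideal_power S \<MM> K" for p
    proof -
      obtain q where "q \<in> carrier S" "p \<odot>\<^bsub>E 0\<^esub> e = \<epsilon> (graded_class q)" using K(2)[OF p, of 0] by blast
      then show ?thesis using d\<epsilon> module_homD(3)[OF d MM_power_carrier[OF p] K(1)] e(2) by simp
    qed
    moreover have "z \<in> carrier (E (Suc 0))" "d (Suc 0) z = \<zero>\<^bsub>E (Suc (Suc 0))\<^esub>"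
      using \<epsilon>(4) e(2) K(1) by auto
    ultimately show "z \<in> ?C" by (auto simp: torsion_cocycles_def torsion_def)
  qed
  have L: "submodule (L t) S ((E (Suc 0))\<lparr>carrier := ?C\<rparr>)" for t
    unfolding L_def by (rule submodule_restrict[OF E(1) C hom_image_submodule[OF d E(1) E(1) DG]])
      (use LC L_def in auto)
  let ?B = "torsion_coboundaries S \<MM> E d (Suc 0)"
  \<comment> \<open>A torsion element of \<open>E 0\<close> gives the zero homomorphism on a power of \<open>\<MM>\<close>, of any degree.\<close>
  have BL: "?B \<subseteq> L t" for t
    unfolding L_def torsion_coboundaries.simps
  proof (rule image_mono, rule subsetI)
    fix e assume "e \<in> torsion S \<MM> (E 0)"
    then obtain n where e: "e \<in> carrier (E 0)" "\<And>p. p \<in> ideal_power S \<MM> n \<Longrightarrow> p \<odot>\<^bsub>E 0\<^esub> e = \<zero>\<^bsub>E 0\<^esub>"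
      by (auto simp: torsion_def)
    have "\<zero>\<^bsub>E 0\<^esub> \<in> degree_ge \<epsilon> (E 0) t"
      using subgroup.one_closed[OF submodule.axioms(1)[OF DG]] by simp
    then obtain K where K: "\<And>i p. p \<in> ideal_power S \<MM> K \<Longrightarrow> \<forall>c<i. coeff P p c = \<zero> \<Longrightarrow>
        (\<exists>q\<in>carrier S. p \<odot>\<^bsub>E 0\<^esub> \<zero>\<^bsub>E 0\<^esub> = \<epsilon> (graded_class q) \<and> (\<forall>c. c + t < i \<longrightarrow> coeff P q c \<in> mpow (Suc c)))"
      by (elim degree_geE) blast
    show "e \<in> degree_ge \<epsilon> (E 0) t"
    proof (rule degree_geI[OF e(1), where K = "max n K"])
      fix i p assume p: "p \<in> ideal_power S \<MM> (max n K)" "\<forall>c<i. coeff P p c = \<zero>"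
      have pn: "p \<in> ideal_power S \<MM> n" and pK: "p \<in> ideal_power S \<MM> K"
        using p(1) MM_power_antimono[of n "max n K"] MM_power_antimono[of K "max n K"] by auto
      have "p \<odot>\<^bsub>E 0\<^esub> e = p \<odot>\<^bsub>E 0\<^esub> \<zero>\<^bsub>E 0\<^esub>" using e(2)[OF pn] MM_power_carrier[OF p(1)] by simp
      then show "\<exists>q\<in>carrier S. p \<odot>\<^bsub>E 0\<^esub> e = \<epsilon> (graded_class q) \<and> (\<forall>c. c + t < i \<longrightarrow> coeff P q c \<in> mpow (Suc c))"
        using K[OF pK p(2)] by simp
    qed
  qed
  have strict: "L t \<subset> L (Suc t)" for t
  proof
    show "L t \<subseteq> L (Suc t)" unfolding L_def by (intro image_mono degree_ge_mono) simp
    let ?k = "N + 2 * b + Suc t + 1"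
    obtain e where e: "e \<in> carrier (E 0)"
      "\<And>p q. p \<in> truncated ?k \<Longrightarrow> divided (Suc t) p q \<Longrightarrow> \<epsilon> (graded_class q) = p \<odot>\<^bsub>E 0\<^esub> e"
      using extension_exists[OF E(2) \<epsilon>(1), of "Suc t"] by blast
    have eD: "e \<in> degree_ge \<epsilon> (E 0) (Suc t)"
    proof (rule degree_geI[OF e(1), where K = ?k])
      fix i p assume p: "p \<in> ideal_power S \<MM> ?k" "\<forall>c<i. coeff P p c = \<zero>"
      have pH: "p \<in> truncated ?k" using p(1) MM_power_subset_truncated by blast
      then obtain q where q: "divided (Suc t) p q" using divided_exists by blast
      have "coeff P q c \<in> mpow (Suc c)" if "c + Suc t < i" for c
        using divided_vanish[OF q, of c] p(2) that by blast
      then show "\<exists>q\<in>carrier S. p \<odot>\<^bsub>E 0\<^esub> e = \<epsilon> (graded_class q) \<and> (\<forall>c. c + Suc t < i \<longrightarrow> coeff P q c \<in> mpow (Suc c))"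
        using e(2)[OF pH q] divided_carrier(2)[OF q] by (intro bexI[of _ q]) auto
    qed
    have "d 0 e \<notin> L t"
    proof
      assume "d 0 e \<in> L t"
      then obtain e' where e': "e' \<in> degree_ge \<epsilon> (E 0) t" "d 0 e = d 0 e'" by (auto simp: L_def)
      then obtain K where K: "e' \<in> carrier (E 0)"
        "\<And>i p. p \<in> ideal_power S \<MM> K \<Longrightarrow> \<forall>c<i. coeff P p c = \<zero> \<Longrightarrow>
          (\<exists>q\<in>carrier S. p \<odot>\<^bsub>E 0\<^esub> e' = \<epsilon> (graded_class q) \<and> (\<forall>c. c + t < i \<longrightarrow> coeff P q c \<in> mpow (Suc c)))"
        by (elim degree_geE) blast
      have "d 0 (e \<ominus>\<^bsub>E 0\<^esub> e') = \<zero>\<^bsub>E (Suc 0)\<^esub>"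
      proof -
        have m1: "\<ominus>\<^bsub>S\<^esub> \<one>\<^bsub>S\<^esub> \<in> carrier S" by (rule S.a_inv_closed[OF S.one_closed])
        have "e \<ominus>\<^bsub>E 0\<^esub> e' = e \<oplus>\<^bsub>E 0\<^esub> ((\<ominus>\<^bsub>S\<^esub> \<one>\<^bsub>S\<^esub>) \<odot>\<^bsub>E 0\<^esub> e')"
          using E0.smult_l_minus[OF S.one_closed K(1)] E0.smult_one[OF K(1)] by (simp only: a_minus_def)
        then have "d 0 (e \<ominus>\<^bsub>E 0\<^esub> e') = d 0 e \<oplus>\<^bsub>E (Suc 0)\<^esub> ((\<ominus>\<^bsub>S\<^esub> \<one>\<^bsub>S\<^esub>) \<odot>\<^bsub>E (Suc 0)\<^esub> d 0 e')"
          using module_homD(2)[OF d e(1) E0.smult_closed[OF m1 K(1)]] module_homD(3)[OF d m1 K(1)] by (simp only:)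
        also have "\<dots> = d 0 e' \<oplus>\<^bsub>E (Suc 0)\<^esub> (\<ominus>\<^bsub>E (Suc 0)\<^esub> d 0 e')"
          using E1.smult_l_minus[OF S.one_closed module_homD(1)[OF d K(1)]]
            E1.smult_one[OF module_homD(1)[OF d K(1)]] e'(2) by (simp only:)
        also have "\<dots> = \<zero>\<^bsub>E (Suc 0)\<^esub>" by (rule E1.M.r_neg[OF module_homD(1)[OF d K(1)]])
        finally show ?thesis .
      qed
      then have "e \<ominus>\<^bsub>E 0\<^esub> e' \<in> \<epsilon> ` carrier (assoc_graded R \<mm>)"
        unfolding \<epsilon>(3) using e(1) K(1) by simp
      then obtain g where g: "g \<in> carrier S" "e \<ominus>\<^bsub>E 0\<^esub> e' = \<epsilon> (graded_class g)" by (auto elim!: assoc_gradedE)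
      define i where "i = max K ?k"
      define p where "p = monom P (x [^] i) i"
      have pM: "p \<in> ideal_power S \<MM> K" "p \<in> ideal_power S \<MM> ?k"
        using monom_in_MM_power[OF x_in, of i] MM_power_antimono[of K i] MM_power_antimono[of ?k i]
        unfolding p_def i_def by auto
      have pc: "\<forall>c<i. coeff P p c = \<zero>" unfolding p_def using x_carr by simp
      note pS = MM_power_carrier[OF pM(1)]
      have pH: "p \<in> truncated ?k" using pM(2) MM_power_subset_truncated by blast
      then obtain q where q: "divided (Suc t) p q" using divided_exists by blast
      obtain q2 where q2: "q2 \<in> carrier S" "p \<odot>\<^bsub>E 0\<^esub> e' = \<epsilon> (graded_class q2)"
        "\<forall>c. c + t < i \<longrightarrow> coeff P q2 c \<in> mpow (Suc c)" using K(2)[OF pM(1) pc] by blast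
      have pg: "p \<otimes>\<^bsub>P\<^esub> g \<in> carrier S" using S.m_closed[OF pS g(1)] by simp
      have "e = (e \<ominus>\<^bsub>E 0\<^esub> e') \<oplus>\<^bsub>E 0\<^esub> e'"
        using e(1) K(1) by (simp add: a_minus_def E0.M.a_assoc E0.M.l_neg)
      then have "e = \<epsilon> (graded_class g) \<oplus>\<^bsub>E 0\<^esub> e'" using g(2) by simp
      then have "p \<odot>\<^bsub>E 0\<^esub> e = p \<odot>\<^bsub>E 0\<^esub> \<epsilon> (graded_class g) \<oplus>\<^bsub>E 0\<^esub> \<epsilon> (graded_class q2)"
        using E0.smult_r_distr[OF pS module_homD(1)[OF \<epsilon>(1) graded_class_closed[OF g(1)]] K(1)] q2(2) by simp
      also have "\<dots> = \<epsilon> (graded_class (p \<otimes>\<^bsub>P\<^esub> g)) \<oplus>\<^bsub>E 0\<^esub> \<epsilon> (graded_class q2)"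
        using module_homD(3)[OF \<epsilon>(1) pS graded_class_closed[OF g(1)]] graded_class_smult[OF pS g(1)] by simp
      also have "\<dots> = \<epsilon> (graded_class ((p \<otimes>\<^bsub>P\<^esub> g) \<oplus>\<^bsub>P\<^esub> q2))"
        using module_homD(2)[OF \<epsilon>(1) graded_class_closed[OF pg] graded_class_closed[OF q2(1)]] graded_class_add[OF pg q2(1)] by simp
      finally have "\<epsilon> (graded_class q) = \<epsilon> (graded_class ((p \<otimes>\<^bsub>P\<^esub> g) \<oplus>\<^bsub>P\<^esub> q2))" using e(2)[OF pH q] by simp
      moreover have sum: "(p \<otimes>\<^bsub>P\<^esub> g) \<oplus>\<^bsub>P\<^esub> q2 \<in> carrier S" using S.a_closed[OF pg q2(1)] by simp
      ultimately have "graded_class q = graded_class ((p \<otimes>\<^bsub>P\<^esub> g) \<oplus>\<^bsub>P\<^esub> q2)"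
        using inj_onD[OF \<epsilon>(2)] graded_class_closed divided_carrier(2)[OF q] by blast
      then obtain n where n: "n \<in> mS" "q = n \<oplus>\<^bsub>P\<^esub> ((p \<otimes>\<^bsub>P\<^esub> g) \<oplus>\<^bsub>P\<^esub> q2)"
        using graded_class_eqD[OF _ divided_carrier(2)[OF q] sum] by blast
      \<comment> \<open>In degree \<open>i - (t+1)\<close> all summands of the right-hand side vanish in \<open>G\<close>, but the left-hand side does not.\<close>
      define c where "c = i - Suc t"
      have c: "c < i" "c + t < i" "Suc t \<le> i" by (auto simp: c_def i_def)
      note nP = gradedD[OF n(1)[unfolded rees_extension_graded]]
      have "coeff P q c = coeff P n c \<oplus> (coeff P (p \<otimes>\<^bsub>P\<^esub> g) c \<oplus> coeff P q2 c)"
        unfolding n(2) using nP(1) S_carrier_P[OF pg] S_carrier_P[OF q2(1)] by (simp del: coeff_mult)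
      also have "coeff P (p \<otimes>\<^bsub>P\<^esub> g) c = \<zero>"
        using mult_low_coeff_zero[OF S_carrier_P[OF pS] S_carrier_P[OF g(1)] pc] c(1) by blast
      finally have "coeff P q c \<in> mpow (Suc c)"
        using nP(2)[of c] q2(3) c(2) R.ideal_zero_closed[OF mpow_ideal] by (auto intro!: mpow_add_mem)
      then show False using divided_survive[OF q[unfolded p_def] c(3)] by (simp add: c_def)
    qed
    then show "L t \<noteq> L (Suc t)" using eD unfolding L_def by blast
  qed
  have B: "submodule ?B S ((E (Suc 0))\<lparr>carrier := ?C\<rparr>)"
    by (rule submodule_restrict[OF E(1) C])
      (use hom_image_submodule[OF d[of 0] E(1) E(1) S.torsion_submodule[OF MM_ideal E(1)]] BL LC in auto)
  interpret Q: module_with_submodule S "(E (Suc 0))\<lparr>carrier := ?C\<rparr>" ?B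
    by (intro module_with_submodule.intro submodule.submodule_is_module[OF C E(1)] B)
  have "enat n \<le> module_length S (local_cohomology S \<MM> E d 1)" for n
    unfolding local_cohomology_def One_nat_def Q.module_length_quotient
    by (rule Sup_upper) (use L BL strict in blast)
  then show ?thesis by (metis enat_ord_simps(1) not_enat_eq not_less_eq_eq order_refl)
qed

end

section \<open>The strong Rees property of powers of the maximal ideal\<close>

theorem theorem3p2:
  fixes A :: "('a, 'b) ring_scheme" and \<mm> :: "'a set" and l :: nat
    and \<epsilon> :: "(nat \<Rightarrow> 'a) set \<Rightarrow> 'e"
    and E :: "nat \<Rightarrow> (nat \<Rightarrow> 'a, 'e) module"
    and d :: "nat \<Rightarrow> 'e \<Rightarrow> 'e"
  assumes "noetherian_local_ring A \<mm>"
    and "local_depth A \<mm> \<ge> 2"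
    and "injective_resolution (rees_algebra A \<mm>) (assoc_graded A \<mm>) \<epsilon> E d"
    and "module_length (rees_algebra A \<mm>)
           (local_cohomology (rees_algebra A \<mm>) (rees_max_ideal A \<mm>) E d 1) < \<infinity>"
    and "l \<ge> 1"
    and "ratliff_rush_closed A (ideal_power A \<mm> l)"
  shows "strong_rees_property A \<mm> (ideal_power A \<mm> l)"
proof -
  interpret noetherian_maximal A \<mm>
    using assms(1) unfolding noetherian_local_ring_def
    by (intro noetherian_maximal.intro noetherian_maximal_axioms.intro) auto
  have none: "\<not> persistent J x b N u" for J x b N u
  proof
    assume p: "persistent J x b N u"
    interpret rees_persistent A "UP A" \<mm> J x b N u
      by (intro rees_persistent.intro rees_setting.intro UP_cring.intro rees_persistent_axioms.intro p
          cring_axioms noetherian_maximal_axioms) (simp add: noetherian_maximal_axioms)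
    show False using local_cohomology_length_infinite[OF assms(3)] assms(4) by simp
  qed
  define I where "I = mpow l"
  have I: "ideal I A" unfolding I_def by (rule mpow_ideal)
  have RR: "ratliff_rush_mpow l = I"
    unfolding I_def by (rule ratliff_rush_closed_mpow[OF assms(5)]) (use assms(6) in \<open>simp add: mpow_def\<close>)
  have "num_generators A \<mm> J < num_generators A \<mm> I" if J: "ideal J A" "I \<subset> J" for J
  proof -
    note mJ = ideal_prod_is_ideal[OF m_ideal J(1)] and mI = ideal_prod_is_ideal[OF m_ideal I]
    have "I = J \<inter> {w \<in> carrier A. \<one>\<^bsub>A\<^esub> \<otimes>\<^bsub>A\<^esub> w \<in> ratliff_rush_mpow l}"
      using J(2) ideal.Icarr[OF I] RR by auto
    then have less: "ideal_length A I J < ideal_length A (\<mm> \<cdot>\<^bsub>A\<^esub> I) (\<mm> \<cdot>\<^bsub>A\<^esub> J)"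
      using J by (intro ideal_length_grows[OF none J(1) one_closed, of l]) auto
    have sub: "\<mm> \<cdot>\<^bsub>A\<^esub> J \<subseteq> J" "\<mm> \<cdot>\<^bsub>A\<^esub> I \<subseteq> I" "\<mm> \<cdot>\<^bsub>A\<^esub> I \<subseteq> \<mm> \<cdot>\<^bsub>A\<^esub> J"
      using ideal_prod_inter[OF m_ideal] J I ideal_prod_mono[of \<mm> \<mm> I J] by blast+
    have "ideal_length A (\<mm> \<cdot>\<^bsub>A\<^esub> I) (\<mm> \<cdot>\<^bsub>A\<^esub> J) + ideal_length A (\<mm> \<cdot>\<^bsub>A\<^esub> J) J
        = ideal_length A (\<mm> \<cdot>\<^bsub>A\<^esub> I) I + ideal_length A I J"
      using ideal_length_add[OF mI mJ J(1) sub(3,1)] ideal_length_add[OF mI I J(1) sub(2)] J(2) by auto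
    moreover have "ideal_length A (\<mm> \<cdot>\<^bsub>A\<^esub> I) I < \<infinity>" "ideal_length A (\<mm> \<cdot>\<^bsub>A\<^esub> J) J < \<infinity>"
      using ideal_length_m_finite I J(1) by blast+
    ultimately have "ideal_length A (\<mm> \<cdot>\<^bsub>A\<^esub> J) J < ideal_length A (\<mm> \<cdot>\<^bsub>A\<^esub> I) I"
      using less
      by (cases "ideal_length A (\<mm> \<cdot>\<^bsub>A\<^esub> I) I"; cases "ideal_length A (\<mm> \<cdot>\<^bsub>A\<^esub> J) J";
          cases "ideal_length A I J"; cases "ideal_length A (\<mm> \<cdot>\<^bsub>A\<^esub> I) (\<mm> \<cdot>\<^bsub>A\<^esub> J)") auto
    then show ?thesis using num_generators_eq_ideal_length m_ideal I J(1) by simp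
  qed
  moreover have "primary_ideal A I" "ideal_radical A I = \<mm>" 
    using mpow_primary mpow_radical assms(5) unfolding I_def by blast+
  ultimately show ?thesis unfolding strong_rees_property_def I_def mpow_def by blast
qed

end
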